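(* Let $\gamma>\frac32$, $T>0$, and $u_0\in H^\gamma(\mathbb{T})$. Let $u\in C([0,T];H^\gamma(\mathbb{T}))$ be the solution of $$ i\partial_t u+\partial_{xx}u-|u|^2u=0,\quad t>0,\ x\in\mathbb{T},\qquad u(0,\cdot)=u_0, $$ and let $u^n$ be the numerical solution defined by $u^0=u_0$, $u^{n+1}=\Psi(u^n)$ for $n=0,1,\dots,\frac{T}{\tau}-1$, with $\Psi$ as defined below. Then there exist constants $\tau_0>0$ and $C>0$, depending only on $T$ and $\|u\|_{L^\infty((0,T);H^\gamma)}$, such that for all $0<\tau\le\tau_0$ (with $T/\tau$ an integer) $$ \|u(t_n,\cdot)-u^n\|_{H^\gamma(\mathbb{T})}\le C\tau,\qquad n=0,1,\dots,\tfrac{T}{\tau}, $$ where $t_n=n\tau$.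
   Context: $\mathbb{T}=\mathbb{R}/2\pi\mathbb{Z}$. Fourier coefficients: $\hat f_k=\frac1{2\pi}\int_{\mathbb{T}}e^{-ikx}f(x)\,dx$, $k\in\mathbb{Z}$; $\|f\|_{H^s}^2=2\pi\sum_k(1+k^2)^s|\hat f_k|^2$. The operator $\partial_x^{-1}$ is the Fourier multiplier $\widehat{\partial_x^{-1}f}_k=(ik)^{-1}\hat f_k$ for $k\neq0$ and $0$ for $k=0$; $\partial_x^{-2}=(\partial_x^{-1})^2$. $S(t)=e^{it\partial_x^2}$ is the Fourier multiplier $e^{-itk^2}$. $\Pi_0(f)=\frac1{2\pi}\int_{\mathbb{T}}f\,dx$ (the zero mode). $M_0=\Pi_0(|u_0|^2)$ and $P_0=\Pi_0(u_0\,\partial_x\overline{u_0})$. The operator $e^{i\tau(-2M_0-2P_0\partial_x^{-1}+\partial_x^2)}$ is the Fourier multiplier $\exp\big(i\tau(-2M_0-2P_0\,m_k-k^2)\big)$ where $m_k=(ik)^{-1}$ for $k\ne0$, $m_0=0$. The map $\Psi$ is $$\Psi(u)=e^{i\tau(-2M_0-2P_0\partial_x^{-1}+\partial_x^2)}u-i\tau\,\Pi_0(|u|^2u)+2i\tau M_0\,\Pi_0(u)-\tfrac12\partial_x^{-2}\Big[\big(e^{-i\tau\partial_x^2}\bar u\big)\cdot e^{i\tau\partial_x^2}(u^2)\Big]+\tfrac12 e^{i\tau\partial_x^2}\partial_x^{-2}\big[|u|^2u\big]$$ $$\qquad+\partial_x^{-1}\Big[\big(e^{i\tau\partial_x^2}u\big)\cdot\partial_x^{-1}\big(|e^{i\tau\partial_x^2}u|^2\big)\Big]-e^{i\tau\partial_x^2}\partial_x^{-1}\Big[u\cdot\partial_x^{-1}\big(|u|^2\big)\Big].$$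 *)

theory Defs
  imports "HOL-Analysis.Analysis"
begin

text \<open>Functions on the torus are represented as functions real \<Rightarrow> complex; only their
values on [0, 2 pi] enter (through Fourier coefficients).\<close>

definition fcoef :: "(real \<Rightarrow> complex) \<Rightarrow> int \<Rightarrow> complex" where
  "fcoef f k = complex_of_real (1 / (2*pi)) *
      integral {0..2*pi} (\<lambda>x. exp (- \<i> * of_int k * of_real x) * f x)"

definition Hnorm :: "real \<Rightarrow> (real \<Rightarrow> complex) \<Rightarrow> real" where
  "Hnorm s f = sqrt (2*pi * (\<Sum>\<^sub>\<infinity>k\<in>UNIV. (1 + (real_of_int k)^2) powr s * (cmod (fcoef f k))^2))"

definition Hs :: "real \<Rightarrow> (real \<Rightarrow> complex) \<Rightarrow> bool" where
  "Hs s f \<longleftrightarrow> f absolutely_integrable_on {0..2*pi} \<and>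
     (\<lambda>k. (1 + (real_of_int k)^2) powr s * (cmod (fcoef f k))^2) summable_on UNIV"

definition fmult :: "(int \<Rightarrow> complex) \<Rightarrow> (real \<Rightarrow> complex) \<Rightarrow> (real \<Rightarrow> complex)" where
  "fmult m f = (\<lambda>x. \<Sum>\<^sub>\<infinity>k\<in>UNIV. m k * fcoef f k * exp (\<i> * of_int k * of_real x))"

definition msym :: "int \<Rightarrow> complex" where
  "msym k = (if k = 0 then 0 else 1 / (\<i> * of_int k))"

definition dinv :: "(real \<Rightarrow> complex) \<Rightarrow> (real \<Rightarrow> complex)" where
  "dinv f = fmult msym f"

definition dinv2 :: "(real \<Rightarrow> complex) \<Rightarrow> (real \<Rightarrow> complex)" where
  "dinv2 f = dinv (dinv f)"

definition dx :: "(real \<Rightarrow> complex) \<Rightarrow> (real \<Rightarrow> complex)" where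
  "dx f = fmult (\<lambda>k. \<i> * of_int k) f"

text \<open>S t = exp(i t d_xx), symbol exp(-i t k^2).\<close>
definition Sop :: "real \<Rightarrow> (real \<Rightarrow> complex) \<Rightarrow> (real \<Rightarrow> complex)" where
  "Sop t f = fmult (\<lambda>k. exp (- \<i> * of_real t * of_int (k^2))) f"

definition Pi0 :: "(real \<Rightarrow> complex) \<Rightarrow> complex" where
  "Pi0 f = fcoef f 0"

definition cnjf :: "(real \<Rightarrow> complex) \<Rightarrow> (real \<Rightarrow> complex)" where
  "cnjf f = (\<lambda>x. cnj (f x))"

definition abs2 :: "(real \<Rightarrow> complex) \<Rightarrow> (real \<Rightarrow> complex)" where
  "abs2 f = (\<lambda>x. complex_of_real ((cmod (f x))^2))"

definition M0 :: "(real \<Rightarrow> complex) \<Rightarrow> complex" where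
  "M0 u0 = Pi0 (abs2 u0)"

definition P0 :: "(real \<Rightarrow> complex) \<Rightarrow> complex" where
  "P0 u0 = Pi0 (\<lambda>x. u0 x * dx (cnjf u0) x)"

definition Eop :: "real \<Rightarrow> (real \<Rightarrow> complex) \<Rightarrow> (real \<Rightarrow> complex) \<Rightarrow> (real \<Rightarrow> complex)" where
  "Eop \<tau> u0 f = fmult (\<lambda>k. exp (\<i> * of_real \<tau> *
       (- 2 * M0 u0 - 2 * P0 u0 * msym k - of_int (k^2)))) f"

definition Psi :: "real \<Rightarrow> (real \<Rightarrow> complex) \<Rightarrow> (real \<Rightarrow> complex) \<Rightarrow> (real \<Rightarrow> complex)" where
  "Psi \<tau> u0 u = (\<lambda>x.
       Eop \<tau> u0 u x
     - \<i> * of_real \<tau> * Pi0 (\<lambda>y. abs2 u y * u y)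
     + 2 * \<i> * of_real \<tau> * M0 u0 * Pi0 u
     - (1/2) * dinv2 (\<lambda>y. Sop (-\<tau>) (cnjf u) y * Sop \<tau> (\<lambda>z. (u z)^2) y) x
     + (1/2) * Sop \<tau> (dinv2 (\<lambda>y. abs2 u y * u y)) x
     + dinv (\<lambda>y. Sop \<tau> u y * dinv (abs2 (Sop \<tau> u)) y) x
     - Sop \<tau> (dinv (\<lambda>y. u y * dinv (abs2 u) y)) x)"

text \<open>u is a solution in C([0,T];H^gamma) of i u_t + u_xx - |u|^2 u = 0, u(0) = u0;
  the equation is imposed Fourier-coefficientwise:
  d/dt u_k = - i k^2 u_k - i (|u|^2 u)_k.\<close>
definition nls_solution :: "real \<Rightarrow> real \<Rightarrow> (real \<Rightarrow> complex) \<Rightarrow> (real \<Rightarrow> real \<Rightarrow> complex) \<Rightarrow> bool" where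
  "nls_solution \<gamma> T u0 u \<longleftrightarrow>
     (\<forall>t\<in>{0..T}. Hs \<gamma> (u t)) \<and>
     (\<forall>t\<in>{0..T}. ((\<lambda>s. Hnorm \<gamma> (u s - u t)) \<longlongrightarrow> 0) (at t within {0..T})) \<and>
     u 0 = u0 \<and>
     (\<forall>k. \<forall>t\<in>{0..T}. ((\<lambda>s. fcoef (u s) k) has_vector_derivative
          (- \<i> * of_int (k^2) * fcoef (u t) k - \<i> * fcoef (\<lambda>x. abs2 (u t) x * u t x) k))
        (at t within {0..T}))"

end

theory Submission
  imports Defs
begin

text \<open>
  Everything happens on the Fourier side. With \<open>r = k - p - q\<close> the cubic interaction has phase
  \<open>\<phi> = k\<^sup>2 + p\<^sup>2 - q\<^sup>2 - r\<^sup>2 = 2 (p + q) (p + r) = 2 k p + 2 q r\<close>, where \<open>p\<close> is the frequency of the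
  conjugated factor. For \<open>k \<noteq> 0\<close> one writes \<open>1 = (1 + p / k) - p / k\<close>. By symmetry in \<open>q, r\<close> the first
  part may be replaced by \<open>2 (p + q) / k\<close>, which cancels a factor of \<open>\<phi>\<close>, so that the scheme
  integrates it exactly; its resonant terms \<open>p + r = 0\<close> produce the mass and momentum in the
  exponential, and both are conserved by the flow. In the second part \<open>\<phi>\<close> is replaced by \<open>2 k p\<close>,
  with an error of multiplier \<open>\<tau>\<^sup>2 |p q r / k|\<close>. All multipliers are dominated by
  \<open>\<langle>p\<rangle> \<langle>q\<rangle> \<langle>r\<rangle> / \<langle>k\<rangle>\<close>, and a trilinear form with this multiplier is bounded on \<open>H\<^sup>\<gamma>\<close> for
  \<open>\<gamma> > 3/2\<close>, because \<open>H\<close> of order \<open>\<gamma> - 1 > 1/2\<close> is an algebra. This gives a local error \<open>O(\<tau>\<^sup>2)\<close>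
  and stability in \<open>H\<^sup>\<gamma>\<close> without loss of derivatives, and Gronwall's argument concludes.
\<close>

subsection \<open>Weighted square-summable sequences\<close>

text \<open>Freezing the whole phase would cost the multiplier |\<phi>|: for \<open>p = 0\<close>,
  \<open>q = r = N\<close>, \<open>k = 2 N\<close> it equals \<open>2 N^2\<close>, whereas a bound
  without loss of derivatives tolerates only about \<open>N\<close>. In the splitting this
  interaction has \<open>p / k = 0\<close> and is integrated exactly. The weight
  \<open>1 + p / k\<close> arises as the mean of \<open>2 (p + q) / k\<close> and
  \<open>2 (p + r) / k\<close>, because \<open>p + q + r = k\<close>. At \<open>k = 0\<close> there
  are no such quotients; the phase is then \<open>2 q r\<close> and is frozen at 0, an error that
  the same weight absorbs. The second obstacle is that the solution is an integrable function known
  only through its Fourier coefficients, while the equation and the scheme involve coefficients of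
  pointwise products. Identifying these with convolutions requires that a function with absolutely
  summable coefficients equals its Fourier series almost everywhere, so the uniqueness theorem for
  Fourier coefficients is part of the proof.\<close>

definition bra :: "int \<Rightarrow> real" where
  "bra k = 1 + (real_of_int k)\<^sup>2"

lemma bra_ge_1 [simp]: "1 \<le> bra k"
  by (simp add: bra_def)

lemma bra_pos [simp]: "0 < bra k"
  using bra_ge_1[of k] by linarith

lemma bra_nonneg [simp]: "0 \<le> bra k"
  using bra_ge_1[of k] by linarith

lemma bra_neq_0 [simp]: "bra k \<noteq> 0"
  using bra_pos[of k] by linarith

lemma bra_uminus [simp]: "bra (- k) = bra k"
  by (simp add: bra_def)

lemma bra_zero [simp]: "bra 0 = 1"
  by (simp add: bra_def)

lemma abs_le_sqrt_bra: "\<bar>real_of_int k\<bar> \<le> sqrt (bra k)"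
  by (rule real_le_rsqrt) (simp add: bra_def)

lemma sqrt_bra_le: "k \<noteq> 0 \<Longrightarrow> sqrt (bra k) \<le> sqrt 2 * \<bar>real_of_int k\<bar>"
proof -
  assume "k \<noteq> 0"
  then have "1 \<le> \<bar>k\<bar>" by simp
  then have "1 \<le> \<bar>real_of_int k\<bar>" by linarith
  then have "1 \<le> (real_of_int k)\<^sup>2"
    by (metis abs_ge_zero one_le_power power2_abs)
  then have "bra k \<le> 2 * (real_of_int k)\<^sup>2" by (simp add: bra_def)
  then have "sqrt (bra k) \<le> sqrt (2 * (real_of_int k)\<^sup>2)" by (rule real_sqrt_le_mono)
  also have "\<dots> = sqrt 2 * \<bar>real_of_int k\<bar>" by (simp add: real_sqrt_mult)
  finally show ?thesis .
qed

lemma summable_bra_powr: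
  assumes "\<sigma> > 1/2"
  shows "(\<lambda>k. bra k powr (- \<sigma>)) summable_on UNIV"
proof -
  have "summable (\<lambda>n. real n powr (- 2 * \<sigma>))"
    using assms by (simp add: summable_real_powr_iff)
  then have "summable (\<lambda>n. bra (int n) powr (- \<sigma>))"
  proof (rule summable_comparison_test_ev[rotated])
    show "\<forall>\<^sub>F n in sequentially. norm (bra (int n) powr (- \<sigma>)) \<le> real n powr (- 2 * \<sigma>)"
    proof (rule eventually_sequentiallyI[of 1])
      fix n :: nat assume n: "1 \<le> n"
      have "real n powr (- 2 * \<sigma>) = ((real n)\<^sup>2) powr (- \<sigma>)"
        using n by (simp add: powr_powr flip: powr_numeral)
      moreover have "bra (int n) powr (- \<sigma>) \<le> ((real n)\<^sup>2) powr (- \<sigma>)"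
        using n assms by (intro powr_mono2') (auto simp: bra_def)
      ultimately show "norm (bra (int n) powr (- \<sigma>)) \<le> real n powr (- 2 * \<sigma>)" by simp
    qed
  qed
  then have nat: "(\<lambda>n. bra (int n) powr (- \<sigma>)) summable_on UNIV"
    by (intro summable_nonneg_imp_summable_on) auto
  have 1: "(\<lambda>k. bra k powr (- \<sigma>)) summable_on range int"
    using nat by (subst summable_on_reindex) (auto simp: o_def)
  have 2: "(\<lambda>k. bra k powr (- \<sigma>)) summable_on range (\<lambda>n. - int n)"
    using nat by (subst summable_on_reindex) (auto simp: o_def inj_on_def)
  have "range int \<union> range (\<lambda>n. - int n) = UNIV"
  proof -
    have "k \<in> range int \<union> range (\<lambda>n. - int n)" for k
      by (cases k rule: int_cases2) auto
    then show ?thesis by blast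
  qed
  then show ?thesis using summable_on_union[OF 1 2] by simp
qed

definition bsum :: "real \<Rightarrow> real" where
  "bsum \<sigma> = (\<Sum>\<^sub>\<infinity>k\<in>UNIV. bra k powr (- \<sigma>))"

lemma bsum_nonneg: "0 \<le> bsum \<sigma>"
  unfolding bsum_def by (rule infsum_nonneg) simp

lemma sum_bra_le_bsum:
  assumes "\<sigma> > 1/2" "finite F"
  shows "(\<Sum>k\<in>F. bra k powr (- \<sigma>)) \<le> bsum \<sigma>"
  unfolding bsum_def using assms by (intro finite_sum_le_infsum summable_bra_powr) auto

text \<open>\<open>hbd s a B\<close> says that \<open>a\<close> has \<open>H\<^sup>s\<close> norm at most \<open>B\<close>; bounding all finite partial sums includes
  summability.\<close>
definition hbd :: "real \<Rightarrow> (int \<Rightarrow> complex) \<Rightarrow> real \<Rightarrow> bool" where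
  "hbd s a B \<longleftrightarrow> (\<forall>F. finite F \<longrightarrow> L2_set (\<lambda>k. bra k powr (s/2) * cmod (a k)) F \<le> B)"

lemma hbdD: "hbd s a B \<Longrightarrow> finite F \<Longrightarrow> L2_set (\<lambda>k. bra k powr (s/2) * cmod (a k)) F \<le> B"
  by (simp add: hbd_def)

lemma hbd_nonneg: "hbd s a B \<Longrightarrow> 0 \<le> B"
  using hbdD[of s a B "{}"] by simp

lemma hbd_mono: "hbd s a B \<Longrightarrow> B \<le> C \<Longrightarrow> hbd s a C"
  by (force simp: hbd_def)

lemma hbd_coeff: "hbd s a B \<Longrightarrow> bra k powr (s/2) * cmod (a k) \<le> B"
  using hbdD[of s a B "{k}"] by simp

lemma hbd_sum_sq:
  assumes "hbd s a B" "finite F"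
  shows "(\<Sum>k\<in>F. (bra k powr (s/2) * cmod (a k))\<^sup>2) \<le> B\<^sup>2"
proof -
  have "sqrt (\<Sum>k\<in>F. (bra k powr (s/2) * cmod (a k))\<^sup>2) \<le> B"
    using hbdD[OF assms] by (simp add: L2_set_def)
  then show ?thesis
    by (rule sqrt_le_D)
qed

lemma hbd_scale:
  assumes "hbd s a B" "0 \<le> c" "\<And>k. cmod (b k) \<le> c * cmod (a k)"
  shows "hbd s b (c * B)"
  unfolding hbd_def
proof (intro allI impI)
  fix F :: "int set" assume "finite F"
  have "L2_set (\<lambda>k. bra k powr (s/2) * cmod (b k)) F
      \<le> L2_set (\<lambda>k. c * (bra k powr (s/2) * cmod (a k))) F"
  proof (rule L2_set_mono)
    fix k
    show "bra k powr (s/2) * cmod (b k) \<le> c * (bra k powr (s/2) * cmod (a k))"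
      using mult_left_mono[OF assms(3)[of k], of "bra k powr (s/2)"] by (simp add: mult_ac)
  qed auto
  also have "\<dots> = c * L2_set (\<lambda>k. bra k powr (s/2) * cmod (a k)) F"
    using assms by (simp add: L2_set_right_distrib)
  also have "\<dots> \<le> c * B"
    using hbdD[OF assms(1) \<open>finite F\<close>] assms(2) by (rule mult_left_mono)
  finally show "L2_set (\<lambda>k. bra k powr (s/2) * cmod (b k)) F \<le> c * B" .
qed

lemma hbd_cong_cmod:
  assumes "hbd s a B" "\<And>k. cmod (b k) = cmod (a k)"
  shows "hbd s b B"
  using hbd_scale[of s a B 1 b] assms by simp

lemma hbd_add:
  assumes "hbd s a A" "hbd s b B"
  shows "hbd s (\<lambda>k. a k + b k) (A + B)"
  unfolding hbd_def
proof (intro allI impI)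
  fix F :: "int set" assume "finite F"
  have "L2_set (\<lambda>k. bra k powr (s/2) * cmod (a k + b k)) F
      \<le> L2_set (\<lambda>k. bra k powr (s/2) * cmod (a k) + bra k powr (s/2) * cmod (b k)) F"
    by (rule L2_set_mono) (auto simp: distrib_left[symmetric] intro!: mult_left_mono norm_triangle_ineq)
  also have "\<dots> \<le> L2_set (\<lambda>k. bra k powr (s/2) * cmod (a k)) F + L2_set (\<lambda>k. bra k powr (s/2) * cmod (b k)) F"
    by (rule L2_set_triangle_ineq)
  also have "\<dots> \<le> A + B"
    using hbdD[OF assms(1) \<open>finite F\<close>] hbdD[OF assms(2) \<open>finite F\<close>] by simp
  finally show "L2_set (\<lambda>k. bra k powr (s/2) * cmod (a k + b k)) F \<le> A + B" .
qed

lemma hbd_uminus: "hbd s a B \<Longrightarrow> hbd s (\<lambda>k. - a k) B"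
  by (erule hbd_cong_cmod) simp

lemma hbd_diff: "hbd s a A \<Longrightarrow> hbd s b B \<Longrightarrow> hbd s (\<lambda>k. a k - b k) (A + B)"
  using hbd_add[of s a A "\<lambda>k. - b k" B] hbd_uminus[of s b B] by simp

definition rcnj :: "(int \<Rightarrow> complex) \<Rightarrow> int \<Rightarrow> complex" where
  "rcnj a k = cnj (a (- k))"

lemma hbd_rcnj:
  assumes "hbd s a B" shows "hbd s (rcnj a) B"
  unfolding hbd_def
proof (intro allI impI)
  fix F :: "int set" assume "finite F"
  have "L2_set (\<lambda>k. bra k powr (s/2) * cmod (rcnj a k)) F
     = L2_set (\<lambda>k. bra k powr (s/2) * cmod (a k)) (uminus ` F)"
    unfolding L2_set_def by (subst sum.reindex) (auto simp: rcnj_def)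
  also have "\<dots> \<le> B" using assms \<open>finite F\<close> by (intro hbdD) auto
  finally show "L2_set (\<lambda>k. bra k powr (s/2) * cmod (rcnj a k)) F \<le> B" .
qed

text \<open>Cauchy-Schwarz after writing \<open>sqrt (bra k)\<close> as
  \<open>bra k powr (-(s-1)/2) * bra k powr (s/2)\<close>; the hypothesis on \<open>s\<close> makes
  \<open>bsum (s - 1)\<close> a convergent sum. In terms of functions: the derivative of an
  \<open>H^s\<close> function has an absolutely convergent Fourier series. The momentum, which
  contains one derivative, rests on this.\<close>

lemma hbd_sum_weighted:
  assumes "s > 3/2" "hbd s a B" "finite F"
  shows "(\<Sum>k\<in>F. sqrt (bra k) * cmod (a k)) \<le> sqrt (bsum (s - 1)) * B"
proof -
  have "(\<Sum>k\<in>F. sqrt (bra k) * cmod (a k))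
     = (\<Sum>k\<in>F. \<bar>bra k powr (- (s - 1)/2)\<bar> * \<bar>bra k powr (s/2) * cmod (a k)\<bar>)"
  proof (rule sum.cong)
    fix k
    have "sqrt (bra k) = bra k powr (- (s - 1)/2) * bra k powr (s/2)"
      by (simp add: powr_add[symmetric] powr_half_sqrt[symmetric] field_simps)
    then show "sqrt (bra k) * cmod (a k) = \<bar>bra k powr (- (s - 1)/2)\<bar> * \<bar>bra k powr (s/2) * cmod (a k)\<bar>"
      by (simp add: abs_mult)
  qed auto
  also have "\<dots> \<le> L2_set (\<lambda>k. bra k powr (- (s - 1)/2)) F * L2_set (\<lambda>k. bra k powr (s/2) * cmod (a k)) F"
    by (rule L2_set_mult_ineq)
  also have "\<dots> \<le> sqrt (bsum (s - 1)) * B"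
  proof (rule mult_mono)
    have "(\<Sum>k\<in>F. (bra k powr (- (s - 1)/2))\<^sup>2) = (\<Sum>k\<in>F. bra k powr (- (s - 1)))"
      by (intro sum.cong) (auto simp: power2_eq_square powr_add[symmetric])
    also have "\<dots> \<le> bsum (s - 1)" using assms by (intro sum_bra_le_bsum) auto
    finally show "L2_set (\<lambda>k. bra k powr (- (s - 1)/2)) F \<le> sqrt (bsum (s - 1))"
      by (simp add: L2_set_def)
  qed (use assms hbdD in \<open>auto simp: bsum_nonneg\<close>)
  finally show ?thesis .
qed

lemma hbd_abs_summable_weighted:
  assumes "s > 3/2" "hbd s a B"
  shows "(\<lambda>k. sqrt (bra k) * cmod (a k)) summable_on UNIV"
  by (rule nonneg_bdd_above_summable_on)
    (use hbd_sum_weighted[OF assms] in \<open>auto intro!: bdd_aboveI2\<close>)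

lemma hbd_abs_summable:
  assumes "s > 3/2" "hbd s a B"
  shows "(\<lambda>k. cmod (a k)) summable_on UNIV"
proof (rule Infinite_Sum.abs_summable_on_comparison_test)
  show "(\<lambda>k. norm (sqrt (bra k) * cmod (a k))) summable_on UNIV"
    using hbd_abs_summable_weighted[OF assms] by simp
  show "norm (a k) \<le> norm (sqrt (bra k) * cmod (a k))" for k
    using mult_right_mono[of 1 "sqrt (bra k)" "cmod (a k)"] by simp
qed

subsection \<open>Trilinear sums\<close>

lemma bra_le_sum3: "bra k \<le> 3 * (bra p + bra q + bra (k - p - q))"
proof -
  define r where "r = k - p - q"
  have k: "real_of_int k = real_of_int p + real_of_int q + real_of_int r" by (simp add: r_def)
  have "0 \<le> (real_of_int p - real_of_int q)\<^sup>2 + (real_of_int p - real_of_int r)\<^sup>2 + (real_of_int q - real_of_int r)\<^sup>2"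
    by simp
  then have "bra k \<le> 3 * (bra p + bra q + bra r)"
    unfolding bra_def k by (simp add: power2_eq_square algebra_simps)
  then show ?thesis by (simp only: r_def)
qed

text \<open>Comparing with the largest of the three brackets avoids convexity of the power, so
  exponents below 1 are covered. The \<open>9\<close> is the \<open>3\<close> of
  \<open>bra_le_sum3\<close> times the number of terms.\<close>

lemma bra_powr_le_sum3:
  assumes "0 \<le> \<sigma>"
  shows "bra k powr \<sigma> \<le> 9 powr \<sigma> * (bra p powr \<sigma> + bra q powr \<sigma> + bra (k - p - q) powr \<sigma>)"
proof -
  define r where "r = k - p - q"
  have "bra k \<le> 3 * (bra p + bra q + bra r)" unfolding r_def by (rule bra_le_sum3)
  also have "\<dots> \<le> 9 * Max {bra p, bra q, bra r}"
    by auto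
  finally have "bra k \<le> 9 * Max {bra p, bra q, bra r}" .
  then have "bra k powr \<sigma> \<le> (9 * Max {bra p, bra q, bra r}) powr \<sigma>"
    using assms by (intro powr_mono2) auto
  also have "\<dots> = 9 powr \<sigma> * Max {bra p, bra q, bra r} powr \<sigma>"
    by (rule powr_mult)
  also have "\<dots> \<le> 9 powr \<sigma> * (bra p powr \<sigma> + bra q powr \<sigma> + bra r powr \<sigma>)"
    by (intro mult_left_mono) (auto simp: max_def)
  finally show ?thesis unfolding r_def .
qed

text \<open>For fixed \<open>k\<close> any two of \<open>p\<close>, \<open>q\<close>,
  \<open>k - p - q\<close> determine the pair \<open>(p, q)\<close>. The injectivity hypothesis
  expresses this, and lets a sum over pairs be bounded by a product of one-dimensional sums for each
  choice of the two.\<close>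

lemma sum_pairs_le:
  fixes f :: "int \<Rightarrow> real"
  assumes "finite G" "inj_on (\<lambda>x. (g x, h x)) G" "\<And>k. 0 \<le> f k" "\<And>F. finite F \<Longrightarrow> sum f F \<le> S"
  shows "(\<Sum>x\<in>G. f (g x) * f (h x)) \<le> S\<^sup>2"
proof -
  have "(\<Sum>x\<in>G. f (g x) * f (h x)) = (\<Sum>(i,j)\<in>(\<lambda>x. (g x, h x)) ` G. f i * f j)"
    using assms by (subst sum.reindex) auto
  also have "\<dots> \<le> (\<Sum>(i,j)\<in>g ` G \<times> h ` G. f i * f j)"
    using assms by (intro sum_mono2) auto
  also have "\<dots> = sum f (g ` G) * sum f (h ` G)"
    by (simp add: sum_product sum.cartesian_product)
  also have "\<dots> \<le> S * S"
    using assms(1,3,4) assms(4)[of "{}"] by (intro mult_mono sum_nonneg) simp_all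
  finally show ?thesis by (simp add: power2_eq_square)
qed

definition tcon :: "real \<Rightarrow> real" where
  "tcon s = sqrt (9 powr (s - 1) * (3 * (bsum (s - 1))\<^sup>2))"

lemma tcon_nonneg: "0 \<le> tcon s"
  by (simp add: tcon_def)

text \<open>The power of \<open>bra k\<close> is distributed over the three inner frequencies, where
  it cancels one decaying factor; the two that remain are summed independently, which is possible
  because \<open>s - 1 > 1/2\<close>. The three resulting terms make up \<open>tcon\<close>,
  uniformly in \<open>k\<close>. This is the algebra property of \<open>H\<close> of order
  \<open>s - 1\<close>.\<close>

lemma kernel_bound:
  assumes "s > 3/2" "finite G"
  shows "L2_set (\<lambda>(p,q). bra k powr ((s-1)/2) * bra p powr (-(s-1)/2) * bra q powr (-(s-1)/2)
           * bra (k-p-q) powr (-(s-1)/2)) G \<le> tcon s"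
proof -
  define \<sigma> where "\<sigma> = s - 1"
  have \<sigma>: "\<sigma> > 1/2" using assms by (simp add: \<sigma>_def)
  let ?f = "\<lambda>k. bra k powr (- \<sigma>)"
  have sq: "(bra k powr (t/2))\<^sup>2 = bra k powr t" for k t
    by (simp add: power2_eq_square powr_add[symmetric])
  have "(\<Sum>x\<in>G. (case x of (p,q) \<Rightarrow> bra k powr (\<sigma>/2) * bra p powr (-\<sigma>/2) * bra q powr (-\<sigma>/2)
           * bra (k-p-q) powr (-\<sigma>/2))\<^sup>2)
      = (\<Sum>(p,q)\<in>G. bra k powr \<sigma> * (?f p * ?f q * ?f (k-p-q)))"
  proof (rule sum.cong[OF refl])
    fix x assume "x \<in> G"
    obtain p q where x: "x = (p,q)" by force
    show "(case x of (p,q) \<Rightarrow> bra k powr (\<sigma>/2) * bra p powr (-\<sigma>/2) * bra q powr (-\<sigma>/2)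
           * bra (k-p-q) powr (-\<sigma>/2))\<^sup>2 = (case x of (p,q) \<Rightarrow> bra k powr \<sigma> * (?f p * ?f q * ?f (k-p-q)))"
      unfolding x prod.case power_mult_distrib sq by (simp add: mult_ac)
  qed
  also have "\<dots> \<le> (\<Sum>(p,q)\<in>G. 9 powr \<sigma> * (?f q * ?f (k-p-q) + ?f p * ?f (k-p-q) + ?f p * ?f q))"
  proof (rule sum_mono, clarify)
    fix p q
    have c: "bra i powr \<sigma> * ?f i = 1" for i by (simp add: powr_minus)
    have "bra k powr \<sigma> * (?f p * ?f q * ?f (k-p-q))
       \<le> 9 powr \<sigma> * (bra p powr \<sigma> + bra q powr \<sigma> + bra (k - p - q) powr \<sigma>) * (?f p * ?f q * ?f (k-p-q))"
      using \<sigma> by (intro mult_right_mono bra_powr_le_sum3) auto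
    also have "\<dots> = 9 powr \<sigma> * ((bra p powr \<sigma> * ?f p) * (?f q * ?f (k-p-q))
        + (bra q powr \<sigma> * ?f q) * (?f p * ?f (k-p-q))
        + (bra (k-p-q) powr \<sigma> * ?f (k-p-q)) * (?f p * ?f q))"
      by (simp only: ring_distribs mult_ac)
    also have "\<dots> = 9 powr \<sigma> * (?f q * ?f (k-p-q) + ?f p * ?f (k-p-q) + ?f p * ?f q)"
      by (simp only: c mult_1)
    finally show "bra k powr \<sigma> * (?f p * ?f q * ?f (k-p-q))
      \<le> 9 powr \<sigma> * (?f q * ?f (k-p-q) + ?f p * ?f (k-p-q) + ?f p * ?f q)" .
  qed
  also have "\<dots> = 9 powr \<sigma> * ((\<Sum>x\<in>G. ?f (snd x) * ?f (k-fst x-snd x))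
      + (\<Sum>x\<in>G. ?f (fst x) * ?f (k-fst x-snd x)) + (\<Sum>x\<in>G. ?f (fst x) * ?f (snd x)))"
    by (simp only: case_prod_unfold sum_distrib_left sum.distrib[symmetric])
  also have "\<dots> \<le> 9 powr \<sigma> * ((bsum \<sigma>)\<^sup>2 + (bsum \<sigma>)\<^sup>2 + (bsum \<sigma>)\<^sup>2)"
  proof -
    note le = sum_pairs_le[OF assms(2), where f = ?f, OF _ _ sum_bra_le_bsum[OF \<sigma>]]
    show ?thesis
      by (intro mult_left_mono add_mono le) (auto simp: inj_on_def prod_eq_iff)
  qed
  finally show ?thesis
    unfolding L2_set_def tcon_def \<sigma>_def[symmetric] by (intro real_sqrt_le_mono) simp
qed

text \<open>Cauchy-Schwarz in \<open>(p, q)\<close> for each \<open>k\<close> separates the kernel,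
  controlled by \<open>kernel_bound\<close>, from the product of weighted coefficients, whose
  squares sum to a product of three norms. All sums are finite here, so that convergence of the
  trilinear series can be deduced from the bound.\<close>

lemma trilinear_finite:
  assumes s: "s > 3/2" and x: "hbd s x A" and y: "hbd s y B" and z: "hbd s z C"
    and K: "0 \<le> K"
    and m: "\<And>k p q. cmod (m k p q) \<le> K * sqrt (bra p * bra q * bra (k-p-q) / bra k)"
    and fin: "finite F" "finite G"
  shows "L2_set (\<lambda>k. bra k powr (s/2) * (\<Sum>(p,q)\<in>G. cmod (m k p q * x p * y q * z (k-p-q)))) F
     \<le> K * tcon s * A * B * C"
proof -
  define X where "X k = bra k powr (s/2) * cmod (x k)" for k
  define Y where "Y k = bra k powr (s/2) * cmod (y k)" for k
  define Z where "Z k = bra k powr (s/2) * cmod (z k)" for k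
  define \<kappa> where "\<kappa> k = (\<lambda>(p,q). bra k powr ((s-1)/2) * bra p powr (-(s-1)/2) * bra q powr (-(s-1)/2)
           * bra (k-p-q) powr (-(s-1)/2))" for k
  define P where "P k = (\<lambda>(p,q). X p * Y q * Z (k-p-q))" for k
  have pos: "0 \<le> X k" "0 \<le> Y k" "0 \<le> Z k" for k by (auto simp: X_def Y_def Z_def)
  have A: "0 \<le> A" "0 \<le> B" "0 \<le> C" using x y z hbd_nonneg by auto
  \<comment> \<open>The multiplier costs each input half a power of \<open>bra\<close> and gains
    half a power at the output; the estimate of order \<open>s\<close> thus reduces to the kernel of
    order \<open>s - 1\<close>.\<close>
  have weight: "bra k powr (s/2) * sqrt (bra p * bra q * bra r / bra k) =
      bra k powr ((s-1)/2) * bra p powr (-(s-1)/2) * bra q powr (-(s-1)/2) * bra r powr (-(s-1)/2)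
        * (bra p powr (s/2) * bra q powr (s/2) * bra r powr (s/2))" for k p q r
  proof -
    have a: "bra i powr (-(s-1)/2) * bra i powr (s/2) = sqrt (bra i)" for i
      by (simp add: powr_add[symmetric] powr_half_sqrt[symmetric] field_simps)
    have b: "bra k powr (s/2) / sqrt (bra k) = bra k powr ((s-1)/2)"
      by (simp add: powr_diff[symmetric] powr_half_sqrt[symmetric] field_simps)
    have "bra k powr (s/2) * sqrt (bra p * bra q * bra r / bra k) =
       bra k powr (s/2) / sqrt (bra k) * (sqrt (bra p) * sqrt (bra q) * sqrt (bra r))"
      by (simp add: real_sqrt_mult real_sqrt_divide)
    also have "\<dots> = bra k powr ((s-1)/2) * ((bra p powr (-(s-1)/2) * bra p powr (s/2))
       * (bra q powr (-(s-1)/2) * bra q powr (s/2)) * (bra r powr (-(s-1)/2) * bra r powr (s/2)))"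
      by (simp only: a b)
    finally show ?thesis by (simp only: mult_ac)
  qed
  have trm: "bra k powr (s/2) * cmod (m k p q * x p * y q * z (k-p-q)) \<le> K * (\<bar>\<kappa> k (p,q)\<bar> * \<bar>P k (p,q)\<bar>)" for k p q
  proof -
    have "bra k powr (s/2) * cmod (m k p q * x p * y q * z (k-p-q))
       = bra k powr (s/2) * cmod (m k p q) * (cmod (x p) * cmod (y q) * cmod (z (k-p-q)))"
      by (simp add: norm_mult mult_ac)
    also have "\<dots> \<le> bra k powr (s/2) * (K * sqrt (bra p * bra q * bra (k-p-q) / bra k)) * (cmod (x p) * cmod (y q) * cmod (z (k-p-q)))"
      by (intro mult_right_mono mult_left_mono m) auto
    also have "\<dots> = K * (bra k powr (s/2) * sqrt (bra p * bra q * bra (k-p-q) / bra k)) * (cmod (x p) * cmod (y q) * cmod (z (k-p-q)))"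
      by (simp only: mult_ac)
    also have "\<dots> = K * (\<kappa> k (p,q) * P k (p,q))"
      unfolding weight \<kappa>_def P_def X_def Y_def Z_def prod.case by (simp only: mult_ac)
    also have "\<dots> \<le> K * (\<bar>\<kappa> k (p,q)\<bar> * \<bar>P k (p,q)\<bar>)"
      using K by (intro mult_left_mono) (auto simp: abs_mult[symmetric])
    finally show ?thesis .
  qed
  have row: "bra k powr (s/2) * (\<Sum>(p,q)\<in>G. cmod (m k p q * x p * y q * z (k-p-q))) \<le> K * tcon s * L2_set (P k) G" for k
  proof -
    have "bra k powr (s/2) * (\<Sum>(p,q)\<in>G. cmod (m k p q * x p * y q * z (k-p-q)))
       \<le> (\<Sum>g\<in>G. K * (\<bar>\<kappa> k g\<bar> * \<bar>P k g\<bar>))"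
      unfolding sum_distrib_left by (rule sum_mono) (use trm in auto)
    also have "\<dots> = K * (\<Sum>g\<in>G. \<bar>\<kappa> k g\<bar> * \<bar>P k g\<bar>)" by (simp add: sum_distrib_left)
    also have "\<dots> \<le> K * (L2_set (\<kappa> k) G * L2_set (P k) G)"
      by (intro mult_left_mono L2_set_mult_ineq K)
    also have "\<dots> \<le> K * (tcon s * L2_set (P k) G)"
      using kernel_bound[OF s fin(2), of k] K unfolding \<kappa>_def
      by (intro mult_left_mono mult_right_mono) auto
    finally show ?thesis by (simp add: mult_ac)
  qed
  have sq: "(\<Sum>k\<in>F. \<Sum>g\<in>G. (P k g)\<^sup>2) \<le> A\<^sup>2 * B\<^sup>2 * C\<^sup>2"
  proof -
    \<comment> \<open>For fixed \<open>(p, q)\<close> the shift from \<open>k\<close> to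
      \<open>k - p - q\<close> is injective, so summing over \<open>k\<close> first uses up the
      third factor; then \<open>G\<close> may be enlarged to a product set.\<close>
    have "(\<Sum>k\<in>F. \<Sum>g\<in>G. (P k g)\<^sup>2) = (\<Sum>g\<in>G. \<Sum>k\<in>F. (P k g)\<^sup>2)" by (rule sum.swap)
    also have "\<dots> \<le> (\<Sum>g\<in>G. (X (fst g))\<^sup>2 * (Y (snd g))\<^sup>2 * C\<^sup>2)"
    proof (rule sum_mono, clarsimp)
      fix p q
      have "(\<Sum>k\<in>F. (P k (p,q))\<^sup>2) = (X p)\<^sup>2 * (Y q)\<^sup>2 * (\<Sum>k\<in>F. (Z (k-p-q))\<^sup>2)"
        by (simp add: P_def power_mult_distrib sum_distrib_left)
      also have "(\<Sum>k\<in>F. (Z (k-p-q))\<^sup>2) = (\<Sum>k\<in>(\<lambda>k. k-p-q) ` F. (Z k)\<^sup>2)"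
        by (subst sum.reindex) (auto simp: inj_on_def)
      also have "(X p)\<^sup>2 * (Y q)\<^sup>2 * \<dots> \<le> (X p)\<^sup>2 * (Y q)\<^sup>2 * C\<^sup>2"
        using hbd_sum_sq[OF z] fin by (intro mult_left_mono) (auto simp: Z_def)
      finally show "(\<Sum>k\<in>F. (P k (p,q))\<^sup>2) \<le> (X p)\<^sup>2 * (Y q)\<^sup>2 * C\<^sup>2" .
    qed
    also have "\<dots> \<le> (\<Sum>g\<in>fst ` G \<times> snd ` G. (X (fst g))\<^sup>2 * (Y (snd g))\<^sup>2 * C\<^sup>2)"
      using fin by (intro sum_mono2) (auto intro: rev_image_eqI)
    also have "\<dots> = (\<Sum>p\<in>fst ` G. (X p)\<^sup>2) * (\<Sum>q\<in>snd ` G. (Y q)\<^sup>2) * C\<^sup>2"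
      by (simp add: sum_product sum.cartesian_product case_prod_unfold flip: sum_distrib_right)
    also have "\<dots> \<le> A\<^sup>2 * B\<^sup>2 * C\<^sup>2"
      using hbd_sum_sq[OF x, of "fst ` G"] hbd_sum_sq[OF y, of "snd ` G"] fin
      unfolding X_def Y_def by (intro mult_right_mono mult_mono sum_nonneg) simp_all
    finally show ?thesis .
  qed
  have "L2_set (\<lambda>k. bra k powr (s/2) * (\<Sum>(p,q)\<in>G. cmod (m k p q * x p * y q * z (k-p-q)))) F
     \<le> L2_set (\<lambda>k. K * tcon s * L2_set (P k) G) F"
    by (rule L2_set_mono) (auto intro!: row mult_nonneg_nonneg sum_nonneg)
  also have "\<dots> = K * tcon s * L2_set (\<lambda>k. L2_set (P k) G) F"
    using K tcon_nonneg by (simp add: L2_set_right_distrib)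
  also have "L2_set (\<lambda>k. L2_set (P k) G) F = sqrt (\<Sum>k\<in>F. \<Sum>g\<in>G. (P k g)\<^sup>2)"
    unfolding L2_set_def by (simp add: sum_nonneg)
  also have "K * tcon s * \<dots> \<le> K * tcon s * sqrt (A\<^sup>2 * B\<^sup>2 * C\<^sup>2)"
    using sq K tcon_nonneg by (intro mult_left_mono real_sqrt_le_mono) auto
  also have "sqrt (A\<^sup>2 * B\<^sup>2 * C\<^sup>2) = A * B * C"
    using A by (simp add: real_sqrt_mult)
  finally show ?thesis by (simp add: mult_ac)
qed

text \<open>The output frequency is an argument of the multiplier, so that phases and factors
  \<open>1 / k\<close> acting outside a product can be absorbed into it.\<close>

definition tri :: "(int \<Rightarrow> int \<Rightarrow> int \<Rightarrow> complex) \<Rightarrow> (int \<Rightarrow> complex) \<Rightarrow> (int \<Rightarrow> complex) \<Rightarrow> (int \<Rightarrow> complex) \<Rightarrow> int \<Rightarrow> complex" where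
  "tri m x y z k = (\<Sum>\<^sub>\<infinity>(p,q)\<in>UNIV. m k p q * x p * y q * z (k-p-q))"

lemma tri_summable:
  assumes s: "s > 3/2" and x: "hbd s x A" and y: "hbd s y B" and z: "hbd s z C"
    and m: "\<And>k p q. cmod (m k p q) \<le> K * sqrt (bra p * bra q * bra (k-p-q) / bra k)"
  shows "(\<lambda>g. norm (case g of (p,q) \<Rightarrow> m k p q * x p * y q * z (k-p-q))) summable_on UNIV"
proof (rule nonneg_bdd_above_summable_on)
  \<comment> \<open>At \<open>k = p = q = 0\<close> all brackets are 1, so the multiplier bound
    itself gives the sign of \<open>K\<close>.\<close>
  have K: "0 \<le> K" using order_trans[OF norm_ge_zero m[of 0 0 0]] by simp
  have "bra k powr (s/2) * (\<Sum>g\<in>G. norm (case g of (p,q) \<Rightarrow> m k p q * x p * y q * z (k-p-q))) \<le> K * tcon s * A * B * C"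
    if "finite G" for G
    using trilinear_finite[OF s x y z K m, of "{k}" G] that
    by (simp add: case_prod_unfold)
  then show "bdd_above (sum (\<lambda>g. norm (case g of (p,q) \<Rightarrow> m k p q * x p * y q * z (k-p-q))) ` {F. F \<subseteq> UNIV \<and> finite F})"
    by (intro bdd_aboveI2[where M = "K * tcon s * A * B * C / bra k powr (s/2)"]) (auto simp: field_simps)
qed auto

text \<open>The sets \<open>F\<close> and \<open>G\<close> are independent in
  \<open>trilinear_finite\<close>; with \<open>F\<close> fixed, the limit along \<open>G\<close>
  passes through a finite expression.\<close>

lemma hbd_tri:
  assumes s: "s > 3/2" and x: "hbd s x A" and y: "hbd s y B" and z: "hbd s z C"
    and m: "\<And>k p q. cmod (m k p q) \<le> K * sqrt (bra p * bra q * bra (k-p-q) / bra k)"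
  shows "hbd s (tri m x y z) (K * tcon s * A * B * C)"
  unfolding hbd_def
proof (intro allI impI)
  fix F :: "int set" assume F: "finite F"
  have K: "0 \<le> K" using order_trans[OF norm_ge_zero m[of 0 0 0]] by simp
  have lim: "((\<lambda>G. \<Sum>(p,q)\<in>G. m k p q * x p * y q * z (k-p-q)) \<longlongrightarrow> tri m x y z k) (finite_subsets_at_top UNIV)" for k
    unfolding tri_def by (rule infsum_tendsto[OF abs_summable_summable[OF tri_summable[OF s x y z m]]])
  have "((\<lambda>G. L2_set (\<lambda>k. bra k powr (s/2) * cmod (\<Sum>(p,q)\<in>G. m k p q * x p * y q * z (k-p-q))) F)
     \<longlongrightarrow> L2_set (\<lambda>k. bra k powr (s/2) * cmod (tri m x y z k)) F) (finite_subsets_at_top UNIV)"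
    unfolding L2_set_def by (intro tendsto_real_sqrt tendsto_sum tendsto_power tendsto_mult tendsto_const tendsto_norm lim)
  then show "L2_set (\<lambda>k. bra k powr (s/2) * cmod (tri m x y z k)) F \<le> K * tcon s * A * B * C"
  proof (rule tendsto_upperbound)
    show "\<forall>\<^sub>F G in finite_subsets_at_top UNIV.
       L2_set (\<lambda>k. bra k powr (s/2) * cmod (\<Sum>(p,q)\<in>G. m k p q * x p * y q * z (k-p-q))) F \<le> K * tcon s * A * B * C"
    proof (rule eventually_finite_subsets_at_top_weakI)
      fix G :: "(int \<times> int) set" assume G: "finite G"
      have "L2_set (\<lambda>k. bra k powr (s/2) * cmod (\<Sum>(p,q)\<in>G. m k p q * x p * y q * z (k-p-q))) F
        \<le> L2_set (\<lambda>k. bra k powr (s/2) * (\<Sum>(p,q)\<in>G. cmod (m k p q * x p * y q * z (k-p-q)))) F"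
        unfolding case_prod_unfold by (intro L2_set_mono mult_left_mono norm_sum) simp_all
      also have "\<dots> \<le> K * tcon s * A * B * C"
        by (rule trilinear_finite[OF s x y z K m F G])
      finally show "L2_set (\<lambda>k. bra k powr (s/2) * cmod (\<Sum>(p,q)\<in>G. m k p q * x p * y q * z (k-p-q))) F \<le> K * tcon s * A * B * C" .
    qed
  qed auto
qed

subsection \<open>Differentiation of sequences and series\<close>

lemma vector_mean_value_bound:
  fixes f :: "real \<Rightarrow> 'b::real_normed_vector"
  assumes "convex S" "\<And>s. s \<in> S \<Longrightarrow> (f has_vector_derivative f' s) (at s within S)"
    "\<And>s. s \<in> S \<Longrightarrow> norm (f' s) \<le> B" "x \<in> S" "y \<in> S"
  shows "norm (f x - f y) \<le> B * \<bar>x - y\<bar>"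
proof -
  have "norm (f x - f y) \<le> B * norm (x - y)"
  proof (rule differentiable_bound[OF assms(1) _ _ assms(4,5)])
    fix s assume s: "s \<in> S"
    show "(f has_derivative (\<lambda>h. h *\<^sub>R f' s)) (at s within S)"
      using assms(2)[OF s] by (simp add: has_vector_derivative_def)
    show "onorm (\<lambda>h. h *\<^sub>R f' s) \<le> B"
      using assms(3)[OF s] by (intro onorm_le) (simp add: mult.commute[of B] mult_left_mono)
  qed
  then show ?thesis by simp
qed

text \<open>The mean value inequality is applied to the scalar function obtained by pairing with the
  increment itself, which avoids integrals with values in a sequence space.\<close>
lemma hbd_mvt:
  fixes x :: "real \<Rightarrow> int \<Rightarrow> complex"
  assumes t: "0 \<le> t"
    and der: "\<And>s k. s \<in> {0..t} \<Longrightarrow> ((\<lambda>s. x s k) has_vector_derivative x' s k) (at s within {0..t})"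
    and bd: "\<And>s. s \<in> {0..t} \<Longrightarrow> hbd g (x' s) B"
  shows "hbd g (\<lambda>k. x t k - x 0 k) (t * B)"
  unfolding hbd_def
proof (intro allI impI)
  fix F :: "int set" assume F: "finite F"
  define D where "D k = x t k - x 0 k" for k
  define w where "w k = bra k powr (g/2)" for k
  have w: "0 \<le> w k" for k by (simp add: w_def)
  define h where "h s = (\<Sum>k\<in>F. (w k)\<^sup>2 * Re (cnj (D k) * x s k))" for s
  define h' where "h' s = (\<Sum>k\<in>F. (w k)\<^sup>2 * Re (cnj (D k) * x' s k))" for s
  have h: "(h has_real_derivative h' s) (at s within {0..t})" if "s \<in> {0..t}" for s
    unfolding h_def h'_def has_real_derivative_iff_has_vector_derivative
    by (intro has_vector_derivative_sum has_vector_derivative_mult_right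
        bounded_linear.has_vector_derivative[OF bounded_linear_Re] der that)
  have "\<exists>\<xi>\<in>{0..t}. h t - h 0 = (\<lambda>y. h' \<xi> * y) (t - 0)"
    using h t by (intro mvt_very_simple) (auto simp: has_field_derivative_def)
  then obtain \<xi> where \<xi>: "\<xi> \<in> {0..t}" "h t - h 0 = h' \<xi> * t" by auto
  let ?L = "L2_set (\<lambda>k. w k * cmod (D k)) F"
  have "?L\<^sup>2 = (\<Sum>k\<in>F. (w k)\<^sup>2 * (cmod (D k))\<^sup>2)"
    by (simp add: L2_set_def sum_nonneg power_mult_distrib)
  also have "\<dots> = h t - h 0"
    unfolding h_def sum_subtractf[symmetric]
  proof (rule sum.cong[OF refl])
    fix k
    have "(cmod (D k))\<^sup>2 = Re (cnj (D k) * D k)"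
      by (simp add: cmod_power2) (simp add: power2_eq_square)
    also have "\<dots> = Re (cnj (D k) * x t k) - Re (cnj (D k) * x 0 k)"
      by (simp add: D_def algebra_simps)
    finally show "(w k)\<^sup>2 * (cmod (D k))\<^sup>2 = (w k)\<^sup>2 * Re (cnj (D k) * x t k) - (w k)\<^sup>2 * Re (cnj (D k) * x 0 k)"
      by (simp add: right_diff_distrib)
  qed
  also have "\<dots> = h' \<xi> * t" by (rule \<xi>)
  also have "h' \<xi> \<le> (\<Sum>k\<in>F. \<bar>w k * cmod (D k)\<bar> * \<bar>w k * cmod (x' \<xi> k)\<bar>)"
    unfolding h'_def
  proof (rule sum_mono)
    fix k
    have "Re (cnj (D k) * x' \<xi> k) \<le> cmod (cnj (D k) * x' \<xi> k)" by (rule complex_Re_le_cmod)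
    then have "(w k)\<^sup>2 * Re (cnj (D k) * x' \<xi> k) \<le> (w k)\<^sup>2 * (cmod (D k) * cmod (x' \<xi> k))"
      by (intro mult_left_mono) (auto simp: norm_mult)
    also have "\<dots> = \<bar>w k * cmod (D k)\<bar> * \<bar>w k * cmod (x' \<xi> k)\<bar>"
      using w by (simp add: power2_eq_square abs_mult)
    finally show "(w k)\<^sup>2 * Re (cnj (D k) * x' \<xi> k) \<le> \<bar>w k * cmod (D k)\<bar> * \<bar>w k * cmod (x' \<xi> k)\<bar>" .
  qed
  also have "\<dots> \<le> ?L * L2_set (\<lambda>k. w k * cmod (x' \<xi> k)) F" by (rule L2_set_mult_ineq)
  also have "\<dots> \<le> ?L * B"
    using hbdD[OF bd[OF \<xi>(1)] F] by (intro mult_left_mono) (auto simp: w_def)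
  finally have "?L\<^sup>2 \<le> ?L * B * t" using t by (simp add: mult_right_mono)
  moreover have "0 \<le> t * B" using t hbd_nonneg[OF bd[of 0]] by simp
  ultimately have "?L \<le> t * B"
    by (cases "?L = 0") (auto simp: power2_eq_square mult_ac less_le)
  then show "L2_set (\<lambda>k. bra k powr (g/2) * cmod (x t k - x 0 k)) F \<le> t * B"
    by (simp add: w_def D_def)
qed

text \<open>On a finite head the derivative is that of a finite sum; on the tail the mean value
  inequality bounds each remainder by \<open>2 * |y - t| * b j\<close>.\<close>

lemma has_vector_derivative_infsum:
  fixes f :: "'i \<Rightarrow> real \<Rightarrow> 'b::banach"
  assumes S: "convex S" "t \<in> S"
    and der: "\<And>j s. s \<in> S \<Longrightarrow> (f j has_vector_derivative f' j s) (at s within S)"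
    and bd: "\<And>j s. s \<in> S \<Longrightarrow> norm (f' j s) \<le> b j" and b: "b summable_on UNIV"
    and sm: "\<And>s. s \<in> S \<Longrightarrow> (\<lambda>j. f j s) summable_on UNIV"
  shows "((\<lambda>s. \<Sum>\<^sub>\<infinity>j\<in>UNIV. f j s) has_vector_derivative (\<Sum>\<^sub>\<infinity>j\<in>UNIV. f' j t)) (at t within S)"
  unfolding has_vector_derivative_def has_derivative_within_alt2
proof (intro conjI allI impI)
  show "bounded_linear (\<lambda>h. h *\<^sub>R (\<Sum>\<^sub>\<infinity>j. f' j t))" by (rule bounded_linear_scaleR_left)
  fix e :: real assume e: "e > 0"
  have b0: "0 \<le> b j" for j using order_trans[OF norm_ge_zero bd[OF S(2)]] .
  have sf': "(\<lambda>j. f' j t) summable_on A" for A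
    by (rule summable_on_subset_banach[OF abs_summable_summable[OF summable_on_comparison_test[OF b]]]) (use bd S in auto)
  \<comment> \<open>The tail remainder carries the factor \<open>2 * |y - t|\<close>, so
    \<open>e/4\<close> here leaves \<open>e/2\<close> for the head.\<close>
  obtain J where J: "finite J" "dist (sum b J) (infsum b UNIV) \<le> e / 4"
    using infsum_finite_approximation[OF b, of "e/4"] e by auto
  have tail: "infsum b (- J) \<le> e / 4"
  proof -
    have "infsum b UNIV = infsum b J + infsum b (- J)"
      using infsum_Un_disjoint[of b J "- J"] summable_on_subset_banach[OF b] by auto
    then show ?thesis using J by (simp add: dist_real_def)
  qed
  have bJ: "b summable_on (- J)" using b summable_on_subset_banach by blast
  have "((\<lambda>s. \<Sum>j\<in>J. f j s) has_vector_derivative (\<Sum>j\<in>J. f' j t)) (at t within S)"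
    using der S by (intro has_vector_derivative_sum) auto
  then have "\<forall>\<^sub>F y in at t within S. norm ((\<Sum>j\<in>J. f j y) - (\<Sum>j\<in>J. f j t) - (y - t) *\<^sub>R (\<Sum>j\<in>J. f' j t)) \<le> (e/2) * norm (y - t)"
    unfolding has_vector_derivative_def has_derivative_within_alt2 using e half_gt_zero by blast
  moreover have "\<forall>\<^sub>F y in at t within S. y \<in> S" by (auto simp: eventually_at_filter)
  ultimately show "\<forall>\<^sub>F y in at t within S. norm ((\<Sum>\<^sub>\<infinity>j. f j y) - (\<Sum>\<^sub>\<infinity>j. f j t) - (y - t) *\<^sub>R (\<Sum>\<^sub>\<infinity>j. f' j t)) \<le> e * norm (y - t)"
  proof eventually_elim
    fix y assume fin: "norm ((\<Sum>j\<in>J. f j y) - (\<Sum>j\<in>J. f j t) - (y - t) *\<^sub>R (\<Sum>j\<in>J. f' j t)) \<le> (e/2) * norm (y - t)"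
      and y: "y \<in> S"
    define r where "r j = f j y - f j t - (y - t) *\<^sub>R f' j t" for j
    have sfA: "(\<lambda>j. f j s) summable_on A" if "s \<in> S" for s A
      using sm[OF that] summable_on_subset_banach by blast
    have r_eq: "(\<Sum>\<^sub>\<infinity>j\<in>A. f j y) - (\<Sum>\<^sub>\<infinity>j\<in>A. f j t) - (y - t) *\<^sub>R (\<Sum>\<^sub>\<infinity>j\<in>A. f' j t) = infsum r A"
      and r_sum: "r summable_on A" for A
    proof -
      have "((\<lambda>j. f j y + - f j t + - ((y - t) *\<^sub>R f' j t)) has_sum
         ((\<Sum>\<^sub>\<infinity>j\<in>A. f j y) + - (\<Sum>\<^sub>\<infinity>j\<in>A. f j t) + - ((y - t) *\<^sub>R (\<Sum>\<^sub>\<infinity>j\<in>A. f' j t)))) A"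
        by (intro has_sum_add has_sum_uminus[THEN iffD2]; (subst minus_minus)?)
          (intro has_sum_scaleR has_sum_infsum sfA sf' y S)+
      then have *: "(r has_sum ((\<Sum>\<^sub>\<infinity>j\<in>A. f j y) - (\<Sum>\<^sub>\<infinity>j\<in>A. f j t) - ((y - t) *\<^sub>R (\<Sum>\<^sub>\<infinity>j\<in>A. f' j t)))) A"
        by (simp add: r_def[abs_def])
      show "(\<Sum>\<^sub>\<infinity>j\<in>A. f j y) - (\<Sum>\<^sub>\<infinity>j\<in>A. f j t) - (y - t) *\<^sub>R (\<Sum>\<^sub>\<infinity>j\<in>A. f' j t) = infsum r A"
        using * by (simp add: infsumI)
      show "r summable_on A" using * by (rule has_sum_imp_summable)
    qed
    have r_bd: "norm (r j) \<le> (2 * \<bar>y - t\<bar>) * b j" for j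
    proof -
      have "norm (f j y - f j t) \<le> b j * \<bar>y - t\<bar>"
        by (rule vector_mean_value_bound[OF S(1) der bd y S(2)])
      moreover have "norm ((y - t) *\<^sub>R f' j t) \<le> \<bar>y - t\<bar> * b j"
        using bd[OF S(2), of j] by (simp add: mult_left_mono)
      ultimately show ?thesis
        unfolding r_def using norm_triangle_ineq4[of "f j y - f j t" "(y - t) *\<^sub>R f' j t"] by (simp add: mult_ac)
    qed
    have "infsum r UNIV = infsum r J + infsum r (- J)"
      using infsum_Un_disjoint[of r J "- J"] r_sum by auto
    also have "norm \<dots> \<le> norm (infsum r J) + norm (infsum r (- J))" by (rule norm_triangle_ineq)
    also have "norm (infsum r J) \<le> (e/2) * norm (y - t)"
      using fin r_eq[of J] J by simp
    also have "norm (infsum r (- J)) \<le> (2 * \<bar>y - t\<bar>) * infsum b (- J)"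
      by (rule norm_infsum_le[OF has_sum_infsum[OF r_sum] has_sum_cmult_right[OF has_sum_infsum[OF bJ]] r_bd])
    also have "\<dots> \<le> (2 * \<bar>y - t\<bar>) * (e / 4)" using tail by (intro mult_left_mono) auto
    finally have "norm (infsum r UNIV) \<le> e * norm (y - t)" by (simp add: field_simps)
    then show "norm ((\<Sum>\<^sub>\<infinity>j. f j y) - (\<Sum>\<^sub>\<infinity>j. f j t) - (y - t) *\<^sub>R (\<Sum>\<^sub>\<infinity>j. f' j t)) \<le> e * norm (y - t)"
      by (simp only: r_eq)
  qed
qed

section \<open>Oscillating exponentials and their time integrals\<close>

definition osc :: "real \<Rightarrow> real \<Rightarrow> complex" where
  "osc t \<phi> = exp (\<i> * of_real (t * \<phi>))"

lemma norm_osc [simp]: "cmod (osc t \<phi>) = 1"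
  by (simp add: osc_def)

lemma osc_0 [simp]: "osc 0 \<phi> = 1" "osc t 0 = 1"
  by (simp_all add: osc_def)

lemma osc_add: "osc t (\<phi> + \<psi>) = osc t \<phi> * osc t \<psi>"
  by (simp add: osc_def exp_add[symmetric] algebra_simps)

lemma osc_minus: "osc t (- \<phi>) = cnj (osc t \<phi>)"
  by (simp add: osc_def exp_cnj)

lemma osc_has_vector_derivative:
  "((\<lambda>s. osc s \<phi>) has_vector_derivative \<i> * of_real \<phi> * osc t \<phi>) (at t within S)"
proof -
  have "((\<lambda>z. exp (\<i> * (z * of_real \<phi>))) has_field_derivative \<i> * of_real \<phi> * exp (\<i> * (of_real t * of_real \<phi>))) (at (of_real t))"
    by (auto intro!: derivative_eq_intros)
  from has_vector_derivative_real_field[OF this] show ?thesis by (simp add: osc_def)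
qed

lemma norm_osc_diff: "cmod (osc t \<phi> - osc t \<psi>) \<le> \<bar>t\<bar> * \<bar>\<phi> - \<psi>\<bar>"
proof -
  have "cmod (osc \<phi> t - osc \<psi> t) \<le> \<bar>t\<bar> * \<bar>\<phi> - \<psi>\<bar>"
    by (rule vector_mean_value_bound[OF convex_UNIV osc_has_vector_derivative]) (auto simp: norm_mult)
  then show ?thesis by (simp add: osc_def mult.commute)
qed

text \<open>\<open>oint t \<phi>\<close> is the integral of \<open>osc s \<phi>\<close> over \<open>0 \<le> s \<le> t\<close>.\<close>
definition oint :: "real \<Rightarrow> real \<Rightarrow> complex" where
  "oint t \<phi> = (if \<phi> = 0 then of_real t else (osc t \<phi> - 1) / (\<i> * of_real \<phi>))"

lemma oint_0 [simp]: "oint 0 \<phi> = 0" "oint t 0 = of_real t"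
  by (simp_all add: oint_def)

lemma oint_mult: "\<i> * of_real \<phi> * oint t \<phi> = osc t \<phi> - 1"
  by (simp add: oint_def)

lemma oint_has_vector_derivative: "((\<lambda>s. oint s \<phi>) has_vector_derivative osc t \<phi>) (at t within S)"
proof (cases "\<phi> = 0")
  case True
  then show ?thesis by (auto simp: oint_def intro!: derivative_eq_intros)
next
  case False
  have "((\<lambda>s. (osc s \<phi> - 1) * (1 / (\<i> * of_real \<phi>))) has_vector_derivative (\<i> * of_real \<phi> * osc t \<phi> - 0) * (1 / (\<i> * of_real \<phi>))) (at t within S)"
    by (intro has_vector_derivative_mult_left has_vector_derivative_diff osc_has_vector_derivative has_vector_derivative_const)
  then show ?thesis using False by (simp add: oint_def)
qed

lemma norm_oint_le: "0 \<le> t \<Longrightarrow> cmod (oint t \<phi>) \<le> t"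
  using vector_mean_value_bound[OF convex_UNIV oint_has_vector_derivative, of \<phi> 1 t 0] by simp

text \<open>Integrating \<open>norm_osc_diff\<close> in time gains the second factor
  \<open>t\<close>; this is the source of the second order in \<open>mbd_mrem\<close>.\<close>

lemma norm_oint_diff:
  assumes "0 \<le> t" shows "cmod (oint t \<phi> - oint t \<psi>) \<le> t\<^sup>2 * \<bar>\<phi> - \<psi>\<bar>"
proof -
  have "cmod ((oint t \<phi> - oint t \<psi>) - (oint 0 \<phi> - oint 0 \<psi>)) \<le> (t * \<bar>\<phi> - \<psi>\<bar>) * \<bar>t - 0\<bar>"
  proof (rule vector_mean_value_bound[where S = "{0..t}" and f = "\<lambda>t. oint t \<phi> - oint t \<psi>" and f' = "\<lambda>t. osc t \<phi> - osc t \<psi>"])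
    show "cmod (osc s \<phi> - osc s \<psi>) \<le> t * \<bar>\<phi> - \<psi>\<bar>" if "s \<in> {0..t}" for s
      by (rule order_trans[OF norm_osc_diff]) (use that in \<open>auto intro: mult_right_mono\<close>)
  qed (use assms in \<open>auto intro!: has_vector_derivative_diff oint_has_vector_derivative\<close>)
  then show ?thesis using assms by (simp add: power2_eq_square mult_ac)
qed

subsection \<open>Absolutely convergent Fourier series\<close>

definition ser :: "(int \<Rightarrow> complex) \<Rightarrow> real \<Rightarrow> complex" where
  "ser a x = (\<Sum>\<^sub>\<infinity>k\<in>UNIV. a k * exp (\<i> * of_int k * of_real x))"

lemma norm_exp_ikx [simp]: "cmod (exp (\<i> * of_int k * of_real x)) = 1" "cmod (exp (- (\<i> * of_int k * of_real x))) = 1"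
  by (simp_all add: norm_exp_eq_Re)

lemma ser_summable:
  assumes "(\<lambda>k. cmod (a k)) summable_on UNIV"
  shows "(\<lambda>k. a k * exp (\<i> * of_int k * of_real x)) summable_on UNIV"
  by (rule abs_summable_summable) (use assms in \<open>simp add: norm_mult\<close>)

lemma ser_continuous:
  assumes "(\<lambda>k. cmod (a k)) summable_on UNIV"
  shows "continuous_on S (ser a)"
proof -
  have "uniform_limit S (\<lambda>F x. \<Sum>k\<in>F. a k * exp (\<i> * of_int k * of_real x)) (\<lambda>x. ser a x) (finite_subsets_at_top UNIV)"
    unfolding ser_def by (rule Weierstrass_m_test_general[OF _ assms]) (simp add: norm_mult)
  then show ?thesis
    by (rule uniform_limit_theorem[rotated]) (auto intro!: always_eventually continuous_intros)
qed

lemma has_integral_exp_ikx: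
  "((\<lambda>x. exp (\<i> * of_int n * of_real x)) has_integral (if n = 0 then 2 * of_real pi else 0)) {0..2*pi}"
proof (cases "n = 0")
  case True
  then show ?thesis using has_integral_const_real[of "1::complex" 0 "2*pi"] by (simp add: scaleR_conv_of_real)
next
  case False
  have d: "((\<lambda>x. exp (\<i> * of_int n * of_real x) / (\<i> * of_int n)) has_vector_derivative exp (\<i> * of_int n * of_real x)) (at x within {0..2*pi})" for x
  proof -
    have "((\<lambda>z. exp (\<i> * of_int n * z) / (\<i> * of_int n)) has_field_derivative exp (\<i> * of_int n * of_real x)) (at (of_real x))"
      using False by (auto intro!: derivative_eq_intros)
    from has_vector_derivative_real_field[OF this] show ?thesis .
  qed
  have "((\<lambda>x. exp (\<i> * of_int n * of_real x)) has_integral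
      (exp (\<i> * of_int n * of_real (2*pi)) / (\<i> * of_int n) - exp (\<i> * of_int n * of_real 0) / (\<i> * of_int n))) {0..2*pi}"
    by (rule fundamental_theorem_of_calculus) (auto intro: d)
  moreover have "exp (\<i> * of_int n * of_real (2*pi)) = 1"
    using exp_integer_2pi[of "of_int n"] by (simp add: mult_ac)
  ultimately show ?thesis using False by simp
qed

text \<open>Uniform convergence permits integration term by term, and by orthogonality the integrals
  of the partial sums are constant as soon as the index set contains \<open>k\<close>.\<close>

lemma fcoef_ser:
  assumes "(\<lambda>k. cmod (a k)) summable_on UNIV"
  shows "fcoef (ser a) k = a k"
proof -
  let ?g = "\<lambda>j x. exp (- \<i> * of_int k * of_real x) * (a j * exp (\<i> * of_int j * of_real x))"
  have g: "?g j x = a j * exp (\<i> * of_int (j - k) * of_real x)" for j x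
    by (simp add: algebra_simps exp_diff exp_minus divide_inverse)
  have "uniform_limit {0..2*pi} (\<lambda>F x. \<Sum>j\<in>F. ?g j x) (\<lambda>x. \<Sum>\<^sub>\<infinity>j\<in>UNIV. ?g j x) (finite_subsets_at_top UNIV)"
    by (rule Weierstrass_m_test_general[OF _ assms]) (simp add: norm_mult)
  moreover have "(\<lambda>x. \<Sum>\<^sub>\<infinity>j\<in>UNIV. ?g j x) = (\<lambda>x. exp (- \<i> * of_int k * of_real x) * ser a x)"
    unfolding ser_def by (simp add: infsum_cmult_right')
  ultimately have u: "uniform_limit {0..2*pi} (\<lambda>F x. \<Sum>j\<in>F. ?g j x) (\<lambda>x. exp (- \<i> * of_int k * of_real x) * ser a x) (finite_subsets_at_top UNIV)"
    by simp
  have c: "continuous_on {0..2*pi} (\<lambda>x. \<Sum>j\<in>F. ?g j x)" for F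
    by (intro continuous_intros)
  obtain I J where I: "\<And>F. ((\<lambda>x. \<Sum>j\<in>F. ?g j x) has_integral I F) {0..2*pi}"
      and J: "((\<lambda>x. exp (- \<i> * of_int k * of_real x) * ser a x) has_integral J) {0..2*pi}"
      and lim: "(I \<longlongrightarrow> J) (finite_subsets_at_top UNIV)"
    by (rule uniform_limit_integral[OF u c]) auto
  have "I F = (\<Sum>j\<in>F. a j * (if j - k = 0 then 2 * of_real pi else 0))" if "finite F" for F
  proof -
    have "((\<lambda>x. \<Sum>j\<in>F. ?g j x) has_integral (\<Sum>j\<in>F. a j * (if j - k = 0 then 2 * of_real pi else 0))) {0..2*pi}"
      unfolding g by (intro has_integral_sum has_integral_mult_right has_integral_exp_ikx that)
    then show ?thesis using I has_integral_unique by blast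
  qed
  then have IF: "I F = a k * (2 * of_real pi)" if "finite F" "k \<in> F" for F
    using that by (simp add: if_distrib cong: if_cong)
  have "\<forall>\<^sub>F F in finite_subsets_at_top UNIV. I F = a k * (2 * of_real pi)"
    unfolding eventually_finite_subsets_at_top by (rule exI[of _ "{k}"]) (auto intro: IF)
  then have "(I \<longlongrightarrow> a k * (2 * of_real pi)) (finite_subsets_at_top UNIV)"
    by (rule tendsto_eventually)
  then have "J = a k * (2 * of_real pi)"
    using lim tendsto_unique[OF finite_subsets_at_top_neq_bot] by blast
  then show ?thesis
    unfolding fcoef_def using integral_unique[OF J] by simp
qed

lemma prod_has_sum:
  fixes a b :: "int \<Rightarrow> complex"
  assumes a: "(\<lambda>k. cmod (a k)) summable_on UNIV" and b: "(\<lambda>k. cmod (b k)) summable_on UNIV"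
  shows "(\<lambda>(i,j). cmod (a i * b j)) summable_on UNIV"
    and "((\<lambda>(i,j). a i * b j) has_sum infsum a UNIV * infsum b UNIV) UNIV"
proof -
  have "(\<lambda>(i,j). cmod (a i * b j)) summable_on UNIV \<times> UNIV"
  proof (rule summable_on_SigmaI)
    fix i
    show "((\<lambda>j. case (i,j) of (i,j) \<Rightarrow> cmod (a i * b j)) has_sum (cmod (a i) * (\<Sum>\<^sub>\<infinity>j\<in>UNIV. cmod (b j)))) UNIV"
      unfolding prod.case norm_mult by (intro has_sum_cmult_right has_sum_infsum b)
    show "(\<lambda>i. cmod (a i) * (\<Sum>\<^sub>\<infinity>j\<in>UNIV. cmod (b j))) summable_on UNIV"
      by (intro summable_on_cmult_left a)
  qed auto
  then show *: "(\<lambda>(i,j). cmod (a i * b j)) summable_on UNIV" by simp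
  then have s: "(\<lambda>(i,j). a i * b j) summable_on UNIV \<times> UNIV"
    using abs_summable_summable[of "\<lambda>(i,j). a i * b j" UNIV] by (simp add: case_prod_unfold)
  have "infsum (\<lambda>(i,j). a i * b j) (UNIV \<times> UNIV) = (\<Sum>\<^sub>\<infinity>i\<in>UNIV. \<Sum>\<^sub>\<infinity>j\<in>UNIV. a i * b j)"
    using infsum_Sigma'_banach[OF s] by simp
  also have "\<dots> = infsum a UNIV * infsum b UNIV"
    by (simp add: infsum_cmult_right' infsum_cmult_left')
  finally show "((\<lambda>(i,j). a i * b j) has_sum infsum a UNIV * infsum b UNIV) UNIV"
    using has_sum_infsum[OF s] by simp
qed

definition conv :: "(int \<Rightarrow> complex) \<Rightarrow> (int \<Rightarrow> complex) \<Rightarrow> int \<Rightarrow> complex" where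
  "conv a b k = (\<Sum>\<^sub>\<infinity>j\<in>UNIV. a j * b (k - j))"

lemma conv_pairs_summable:
  fixes a b :: "int \<Rightarrow> complex"
  assumes "(\<lambda>k. cmod (a k)) summable_on UNIV" "(\<lambda>k. cmod (b k)) summable_on UNIV"
  shows "(\<lambda>(k,j). cmod (a j * b (k - j))) summable_on UNIV \<times> UNIV"
proof -
  have "bij_betw (\<lambda>(k,j). (j, k - j)) (UNIV \<times> UNIV :: (int \<times> int) set) UNIV"
    by (rule bij_betw_byWitness[of _ "\<lambda>(i,j). (i + j, i)"]) auto
  from summable_on_reindex_bij_betw[OF this, of "\<lambda>(i,j). cmod (a i * b j)"]
  show ?thesis using prod_has_sum(1)[OF assms] by (simp add: case_prod_unfold)
qed

lemma conv_summable:
  fixes a b :: "int \<Rightarrow> complex"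
  assumes "(\<lambda>k. cmod (a k)) summable_on UNIV" "(\<lambda>k. cmod (b k)) summable_on UNIV"
  shows "(\<lambda>j. a j * b (k - j)) summable_on UNIV" "(\<lambda>j. cmod (a j * b (k - j))) summable_on UNIV"
proof -
  show *: "(\<lambda>j. cmod (a j * b (k - j))) summable_on UNIV"
    using summable_on_SigmaD1[OF conv_pairs_summable[OF assms], of k] by simp
  then show "(\<lambda>j. a j * b (k - j)) summable_on UNIV" by (rule abs_summable_summable)
qed

lemma conv_abs_summable:
  assumes "(\<lambda>k. cmod (a k)) summable_on UNIV" "(\<lambda>k. cmod (b k)) summable_on UNIV"
  shows "(\<lambda>k. cmod (conv a b k)) summable_on UNIV"
proof (rule summable_on_comparison_test)
  show "(\<lambda>k. \<Sum>\<^sub>\<infinity>j\<in>UNIV. cmod (a j * b (k - j))) summable_on UNIV"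
    using summable_on_Sigma_banach[OF conv_pairs_summable[OF assms]] by simp
  show "cmod (conv a b k) \<le> (\<Sum>\<^sub>\<infinity>j\<in>UNIV. cmod (a j * b (k - j)))" for k
    unfolding conv_def by (rule norm_infsum_bound[OF conv_summable(2)[OF assms]])
qed auto

lemma ser_mult:
  assumes a: "(\<lambda>k. cmod (a k)) summable_on UNIV" and b: "(\<lambda>k. cmod (b k)) summable_on UNIV"
  shows "ser a x * ser b x = ser (conv a b) x"
proof -
  define e where "e k = exp (\<i> * of_int k * of_real x)" for k :: int
  have e: "e i * e j = e (i + j)" for i j
    by (simp add: e_def exp_add[symmetric] algebra_simps)
  have ae: "(\<lambda>k. cmod (a k * e k)) summable_on UNIV" and be: "(\<lambda>k. cmod (b k * e k)) summable_on UNIV"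
    using a b by (simp_all add: e_def norm_mult)
  have "((\<lambda>(i,j). a i * e i * (b j * e j)) has_sum ser a x * ser b x) UNIV"
    using prod_has_sum(2)[OF ae be] unfolding ser_def e_def by simp
  moreover have "((\<lambda>(k,j). a j * e j * (b (k - j) * e (k - j))) has_sum ser a x * ser b x) (UNIV \<times> UNIV)
     \<longleftrightarrow> ((\<lambda>(i,j). a i * e i * (b j * e j)) has_sum ser a x * ser b x) UNIV"
    by (rule has_sum_reindex_bij_witness[of _ "\<lambda>(i,j). (i + j, i)" "\<lambda>(k,j). (j, k - j)"]) auto
  ultimately have hs: "((\<lambda>(k,j). a j * e j * (b (k - j) * e (k - j))) has_sum ser a x * ser b x) (UNIV \<times> UNIV)"
    by simp
  have t: "a j * e j * (b (k - j) * e (k - j)) = a j * b (k - j) * e k" for j k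
    using e[of j "k - j"] by (simp add: mult_ac)
  have "(\<Sum>\<^sub>\<infinity>k\<in>UNIV. \<Sum>\<^sub>\<infinity>j\<in>UNIV. a j * e j * (b (k - j) * e (k - j))) = ser a x * ser b x"
    using infsum_Sigma'_banach[OF has_sum_imp_summable[OF hs]] infsumI[OF hs] by simp
  moreover have "ser (conv a b) x = (\<Sum>\<^sub>\<infinity>k\<in>UNIV. \<Sum>\<^sub>\<infinity>j\<in>UNIV. a j * b (k - j) * e k)"
    unfolding ser_def conv_def e_def by (simp only: infsum_cmult_left')
  ultimately show ?thesis by (simp only: t)
qed

lemma ser_add:
  assumes "(\<lambda>k. cmod (a k)) summable_on UNIV" "(\<lambda>k. cmod (b k)) summable_on UNIV"
  shows "ser (\<lambda>k. a k + b k) x = ser a x + ser b x"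
  unfolding ser_def distrib_right by (intro infsum_add ser_summable assms)

lemma ser_cmult: "ser (\<lambda>k. c * a k) x = c * ser a x"
  unfolding ser_def by (simp add: infsum_cmult_right' mult.assoc)

lemma ser_cnj: "ser (rcnj a) x = cnj (ser a x)"
proof -
  have "ser (rcnj a) x = (\<Sum>\<^sub>\<infinity>k\<in>UNIV. cnj (a k * exp (\<i> * of_int k * of_real x)))"
    unfolding ser_def
    by (rule infsum_reindex_bij_witness[of _ uminus uminus]) (auto simp: rcnj_def exp_cnj)
  then show ?thesis unfolding infsum_cnj by (simp only: ser_def)
qed

section \<open>Functions represented almost everywhere by an absolutely convergent Fourier
  series\<close>

text \<open>Membership in the Wiener algebra, with \<open>a\<close> as the coefficients. Equality
  holds off a null set of one period only, since coefficients determine an integrable function no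
  better than that. The operations occurring in \<open>Psi\<close> preserve the relation, so it
  carries the scheme over to sequences.\<close>

definition wien :: "(real \<Rightarrow> complex) \<Rightarrow> (int \<Rightarrow> complex) \<Rightarrow> bool" where
  "wien f a \<longleftrightarrow> (\<lambda>k. cmod (a k)) summable_on UNIV \<and>
     (\<exists>N. negligible N \<and> (\<forall>x\<in>{0..2*pi} - N. f x = ser a x))"

lemma wien_summable: "wien f a \<Longrightarrow> (\<lambda>k. cmod (a k)) summable_on UNIV"
  by (simp add: wien_def)

lemma wien_ser: "(\<lambda>k. cmod (a k)) summable_on UNIV \<Longrightarrow> wien (ser a) a"
  unfolding wien_def by (auto intro: exI[of _ "{}"])

lemma wien_fcoef:
  assumes "wien f a" shows "fcoef f = a"
proof
  fix k
  obtain N where N: "negligible N" "\<And>x. x \<in> {0..2*pi} - N \<Longrightarrow> f x = ser a x"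
    using assms by (auto simp: wien_def)
  have "fcoef f k = fcoef (ser a) k"
    unfolding fcoef_def using integral_spike[OF N(1), of "{0..2*pi}" "\<lambda>x. exp (- \<i> * of_int k * of_real x) * f x"
      "\<lambda>x. exp (- \<i> * of_int k * of_real x) * ser a x"] N(2) by simp
  then show "fcoef f k = a k" using fcoef_ser wien_summable[OF assms] by simp
qed

lemma wien_absolutely_integrable:
  assumes "wien f a" shows "f absolutely_integrable_on {0..2*pi}"
proof -
  obtain N where N: "negligible N" "\<And>x. x \<in> {0..2*pi} - N \<Longrightarrow> f x = ser a x"
    using assms by (auto simp: wien_def)
  have "ser a absolutely_integrable_on {0..2*pi}"
    by (intro absolutely_integrable_continuous_real ser_continuous wien_summable[OF assms])
  then show ?thesis
    using absolutely_integrable_spike[OF _ N(1)] N(2) by metis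
qed

text \<open>One argument for all pointwise operations; the unary ones take \<open>f\<close> in both
  places.\<close>

lemma wien_binop:
  assumes "wien f a" "wien g b" "(\<lambda>k. cmod (c k)) summable_on UNIV"
    "\<And>x. h (ser a x) (ser b x) = ser c x"
  shows "wien (\<lambda>x. h (f x) (g x)) c"
proof -
  obtain N where N: "negligible N" "\<And>x. x \<in> {0..2*pi} - N \<Longrightarrow> f x = ser a x"
    using assms by (auto simp: wien_def)
  obtain N' where N': "negligible N'" "\<And>x. x \<in> {0..2*pi} - N' \<Longrightarrow> g x = ser b x"
    using assms by (auto simp: wien_def)
  show ?thesis unfolding wien_def
    using assms N N' by (intro conjI exI[of _ "N \<union> N'"]) (auto simp: negligible_Un)
qed

lemma wien_mult: "wien f a \<Longrightarrow> wien g b \<Longrightarrow> wien (\<lambda>x. f x * g x) (conv a b)"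
  by (rule wien_binop) (auto simp: ser_mult conv_abs_summable wien_summable)

lemma wien_add:
  assumes "wien f a" "wien g b" shows "wien (\<lambda>x. f x + g x) (\<lambda>k. a k + b k)"
proof (rule wien_binop[OF assms])
  note s = assms[THEN wien_summable]
  show "(\<lambda>k. cmod (a k + b k)) summable_on UNIV"
    by (rule summable_on_comparison_test[OF summable_on_add[OF s]]) (auto intro: norm_triangle_ineq)
  show "ser a x + ser b x = ser (\<lambda>k. a k + b k) x" for x
    using ser_add[OF s] by simp
qed

lemma wien_cmult: "wien f a \<Longrightarrow> wien (\<lambda>x. c * f x) (\<lambda>k. c * a k)"
  using wien_binop[of f a f a "\<lambda>k. c * a k" "\<lambda>u v. c * u"] summable_on_cmult_right[OF wien_summable, of f a "cmod c"]
  by (simp add: ser_cmult norm_mult)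

lemma wien_cnjf:
  assumes "wien f a" shows "wien (cnjf f) (rcnj a)"
  unfolding cnjf_def
proof (rule wien_binop[OF assms assms])
  have "(\<lambda>k. cmod (rcnj a k)) summable_on UNIV \<longleftrightarrow> (\<lambda>k. cmod (a k)) summable_on UNIV"
    by (rule summable_on_reindex_bij_witness[of _ uminus uminus]) (auto simp: rcnj_def)
  then show "(\<lambda>k. cmod (rcnj a k)) summable_on UNIV" using wien_summable[OF assms] by simp
qed (simp add: ser_cnj)

lemma wien_const: "wien (\<lambda>x. c) (\<lambda>k. if k = 0 then c else 0)"
proof -
  have "ser (\<lambda>k. if k = 0 then c else 0) x = c" for x
    unfolding ser_def by (subst infsum_cong_neutral[where T = "{0}" and g = "\<lambda>k. c"]) auto
  moreover have "(\<lambda>k::int. cmod (if k = 0 then c else 0)) summable_on UNIV"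
    by (subst summable_on_cong_neutral[where T = "{0}" and g = "\<lambda>k. cmod c"]) auto
  ultimately show ?thesis unfolding wien_def by (auto intro: exI[of _ "{}"])
qed

lemma wien_fmult:
  assumes "wien f a" "(\<lambda>k. cmod (m k * a k)) summable_on UNIV"
  shows "wien (fmult m f) (\<lambda>k. m k * a k)"
  using wien_ser[OF assms(2)] wien_fcoef[OF assms(1)] by (simp add: fmult_def ser_def[abs_def])

lemma wien_fmult_bounded:
  assumes "wien f a" "\<And>k. cmod (m k) \<le> B"
  shows "wien (fmult m f) (\<lambda>k. m k * a k)"
proof (rule wien_fmult[OF assms(1)])
  show "(\<lambda>k. cmod (m k * a k)) summable_on UNIV"
    by (rule summable_on_comparison_test[OF summable_on_cmult_right[OF wien_summable[OF assms(1)], of B]])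
      (auto simp: norm_mult intro: mult_right_mono assms)
qed

lemma wien_abs2: "wien f a \<Longrightarrow> wien (abs2 f) (conv (rcnj a) a)"
  using wien_mult[OF wien_cnjf, of f a f a]
  unfolding abs2_def complex_norm_square by (simp add: cnjf_def mult.commute)

subsection \<open>Uniqueness of Fourier coefficients\<close>

inductive trigp :: "(real \<Rightarrow> complex) \<Rightarrow> bool" where
  base: "trigp (\<lambda>x. c * exp (\<i> * of_int k * of_real x))"
| add: "trigp f \<Longrightarrow> trigp g \<Longrightarrow> trigp (\<lambda>x. f x + g x)"

lemma trigp_mult_base: "trigp f \<Longrightarrow> trigp (\<lambda>x. f x * (d * exp (\<i> * of_int l * of_real x)))"
proof (induction rule: trigp.induct)
  case (base c k)
  have "(\<lambda>x. c * exp (\<i> * of_int k * of_real x) * (d * exp (\<i> * of_int l * of_real x)))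
    = (\<lambda>x. (c * d) * exp (\<i> * of_int (k + l) * of_real x))"
    by (rule ext) (simp add: algebra_simps exp_add)
  then show ?case by (simp only: trigp.base)
next
  case (add f g)
  show ?case unfolding distrib_right by (rule trigp.add[OF add.IH])
qed

lemma trigp_mult: "trigp g \<Longrightarrow> trigp f \<Longrightarrow> trigp (\<lambda>x. f x * g x)"
proof (induction rule: trigp.induct)
  case (base c k)
  then show ?case by (rule trigp_mult_base)
next
  case (add f g)
  then show ?case by (auto simp: distrib_left intro: trigp.add)
qed

text \<open>Stone-Weierstrass supplies real polynomials in the coordinates of the plane. On the
  circle a real linear functional is a combination of \<open>cis x\<close> and its conjugate, and
  products of trigonometric polynomials are again such.\<close>

lemma trigp_polynomial:
  fixes p :: "complex \<Rightarrow> real"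
  assumes "real_polynomial_function p"
  shows "trigp (\<lambda>x. of_real (p (cis x)))"
  using assms
proof (induction rule: real_polynomial_function.induct)
  case (linear f)
  interpret f: bounded_linear f by fact
  have "of_real (f (cis x)) = (of_real (f 1) / 2 + of_real (f \<i>) / (2 * \<i>)) * exp (\<i> * of_int 1 * of_real x)
     + (of_real (f 1) / 2 - of_real (f \<i>) / (2 * \<i>)) * exp (\<i> * of_int (-1) * of_real x)" for x
  proof -
    have "f (cis x) = f (cos x *\<^sub>R 1 + sin x *\<^sub>R \<i>)"
      by (rule arg_cong[where f = f]) (simp add: complex_eq_iff)
    also have "\<dots> = cos x * f 1 + sin x * f \<i>" by (simp add: f.add f.scaleR)
    finally have "of_real (f (cis x)) = of_real (f 1) * cos (of_real x) + of_real (f \<i>) * sin (of_real x :: complex)"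
      by (simp add: cos_of_real sin_of_real mult.commute)
    also have "\<dots> = of_real (f 1) / 2 * (exp (\<i> * of_real x) + exp (- (\<i> * of_real x)))
        + of_real (f \<i>) / (2 * \<i>) * (exp (\<i> * of_real x) - exp (- (\<i> * of_real x)))"
      by (simp add: cos_exp_eq sin_exp_eq)
    finally show ?thesis by (simp only: ring_distribs) simp
  qed
  then show ?case by (simp only: trigp.intros)
next
  case (const c)
  show ?case using trigp.base[of "of_real c" 0] by simp
next
  case (add f g)
  then show ?case using trigp.add by (simp add: of_real_add)
next
  case (mult f g)
  then show ?case using trigp_mult by (simp add: of_real_mult)
qed

lemma absolutely_integrable_mult_continuous:
  fixes f :: "real \<Rightarrow> complex"
  assumes "f absolutely_integrable_on {a..b}" "continuous_on {a..b} g"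
  shows "(\<lambda>x. g x * f x) absolutely_integrable_on {a..b}"
proof (rule absolutely_integrable_bounded_measurable_product[where h = "(*)", OF _ _ _ _ assms(1)])
  show "bilinear ((*) :: complex \<Rightarrow> complex \<Rightarrow> complex)"
    by (rule bilinear_times)
  show "g \<in> borel_measurable (lebesgue_on {a..b})"
    using assms(2) by (intro continuous_imp_measurable_on_sets_lebesgue) auto
  show "bounded (g ` {a..b})"
    using assms(2) by (intro compact_imp_bounded compact_continuous_image) auto
qed auto

lemma trigp_continuous: "trigp g \<Longrightarrow> continuous_on S g"
  by (induction rule: trigp.induct) (auto intro!: continuous_intros)

lemma integral_trigp_zero:
  assumes f: "f absolutely_integrable_on {0..2*pi}" and z: "\<And>k. fcoef f k = 0" and g: "trigp g"
  shows "integral {0..2*pi} (\<lambda>x. g x * f x) = 0"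
  using g
proof (induction rule: trigp.induct)
  case (base c k)
  have "integral {0..2*pi} (\<lambda>x. exp (- \<i> * of_int (-k) * of_real x) * f x) = 0"
    using z[of "-k"] by (simp add: fcoef_def)
  then show ?case by (simp add: mult.assoc)
next
  case (add g h)
  have "(\<lambda>x. g x * f x) integrable_on {0..2*pi}" "(\<lambda>x. h x * f x) integrable_on {0..2*pi}"
    using absolutely_integrable_mult_continuous[OF f trigp_continuous] add.hyps
    by (auto intro: set_lebesgue_integral_eq_integral(1))
  then show ?case using add.IH by (simp add: distrib_right integral_add)
qed

text \<open>The test function lives on the circle, which identifies the endpoints of the period:
  there it is a uniform limit of trigonometric polynomials, against each of which \<open>f\<close>
  integrates to zero.\<close>

lemma integral_circle_zero:
  fixes \<phi> :: "complex \<Rightarrow> real"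
  assumes f: "f absolutely_integrable_on {0..2*pi}" and z: "\<And>k. fcoef f k = 0"
    and \<phi>: "continuous_on (sphere 0 1) \<phi>"
  shows "integral {0..2*pi} (\<lambda>x. of_real (\<phi> (cis x)) * f x) = 0"
proof -
  define I where "I = integral {0..2*pi} (\<lambda>x. norm (f x))"
  have fn: "(\<lambda>x. norm (f x)) integrable_on {0..2*pi}"
    using f by (simp add: absolutely_integrable_on_def)
  have I0: "0 \<le> I" unfolding I_def by (rule integral_nonneg[OF fn]) auto
  have cp: "continuous_on {0..2*pi} (\<lambda>x. complex_of_real (\<phi> (cis x)))"
    by (intro continuous_intros continuous_on_compose2[OF \<phi>]) auto
  have "norm (integral {0..2*pi} (\<lambda>x. of_real (\<phi> (cis x)) * f x)) \<le> e" if "e > 0" for e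
  proof -
    \<comment> \<open>The \<open>+ 1\<close> keeps the quotient meaningful when
      \<open>I = 0\<close>.\<close>
    define d where "d = e / (I + 1)"
    have d: "d > 0" using that I0 by (simp add: d_def)
    obtain p where p: "real_polynomial_function p" "\<And>x. x \<in> sphere 0 1 \<Longrightarrow> \<bar>\<phi> x - p x\<bar> < d"
      using Stone_Weierstrass_real_polynomial_function[OF compact_sphere \<phi> d] by blast
    note tp = trigp_polynomial[OF p(1)]
    have i1: "(\<lambda>x. of_real (\<phi> (cis x)) * f x) integrable_on {0..2*pi}"
      using absolutely_integrable_mult_continuous[OF f cp] by (rule set_lebesgue_integral_eq_integral(1))
    have i2: "(\<lambda>x. of_real (p (cis x)) * f x) integrable_on {0..2*pi}"
      using absolutely_integrable_mult_continuous[OF f trigp_continuous[OF tp]] by (rule set_lebesgue_integral_eq_integral(1))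
    have "integral {0..2*pi} (\<lambda>x. of_real (\<phi> (cis x)) * f x)
       = integral {0..2*pi} (\<lambda>x. of_real (\<phi> (cis x)) * f x - of_real (p (cis x)) * f x)"
      using integral_diff[OF i1 i2] integral_trigp_zero[OF f z tp] by simp
    also have "norm \<dots> \<le> integral {0..2*pi} (\<lambda>x. d * norm (f x))"
    proof (rule integral_norm_bound_integral)
      show "(\<lambda>x. of_real (\<phi> (cis x)) * f x - of_real (p (cis x)) * f x) integrable_on {0..2*pi}"
        by (rule integrable_diff[OF i1 i2])
      show "(\<lambda>x. d * norm (f x)) integrable_on {0..2*pi}" using fn by (rule integrable_on_mult_right)
      fix x
      have "norm (complex_of_real (\<phi> (cis x) - p (cis x)) * f x) \<le> d * norm (f x)"
        unfolding norm_mult norm_of_real using p(2)[of "cis x"] by (intro mult_right_mono) auto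
      then show "norm (of_real (\<phi> (cis x)) * f x - of_real (p (cis x)) * f x) \<le> d * norm (f x)"
        by (simp add: left_diff_distrib)
    qed
    also have "\<dots> = d * I" by (simp add: I_def)
    also have "\<dots> \<le> e" using that I0 by (simp add: d_def field_simps)
    finally show ?thesis .
  qed
  then have "norm (integral {0..2*pi} (\<lambda>x. of_real (\<phi> (cis x)) * f x)) \<le> 0"
    by (rule field_le_epsilon) auto
  then show ?thesis by simp
qed

text \<open>Applied to \<open>y = x - c\<close>, where \<open>c\<close> is the centre of an arc of
  half-length \<delta>. The upper bound on |y| excludes points that re-enter the arc after a full
  turn; it holds because the arc lies inside one period.\<close>

lemma cos_le_cos_outside:
  assumes "0 \<le> \<delta>" "\<delta> \<le> \<bar>y\<bar>" "\<bar>y\<bar> \<le> 2*pi - \<delta>"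
  shows "cos y \<le> cos \<delta>"
proof (cases "\<bar>y\<bar> \<le> pi")
  case True
  then show ?thesis using assms cos_monotone_0_pi_le[of \<delta> "\<bar>y\<bar>"] by simp
next
  case False
  have "cos y = cos (2*pi - \<bar>y\<bar>)" by (simp add: cos_diff)
  also have "\<dots> \<le> cos \<delta>" using assms False by (intro cos_monotone_0_pi_le) auto
  finally show ?thesis .
qed

text \<open>The indicator of an arc is a pointwise limit of the functions
  \<open>min 1 (max 0 (n (cos (x - c) - cos \<delta>)))\<close>.\<close>
lemma integral_interval_zero:
  assumes f: "f absolutely_integrable_on {0..2*pi}" and z: "\<And>k. fcoef f k = 0"
    and ab: "0 \<le> a" "a < b" "b \<le> 2*pi"
  shows "integral {a..b} f = 0"
proof -
  define c where "c = (a + b) / 2"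
  define \<delta> where "\<delta> = (b - a) / 2"
  define \<phi> where "\<phi> n w = min 1 (max 0 (real n * (Re (w * cis (- c)) - cos \<delta>)))" for n w
  have \<phi>: "\<phi> n (cis x) = min 1 (max 0 (real n * (cos (x - c) - cos \<delta>)))" for n x
    by (simp add: \<phi>_def cis_mult)
  have cont: "continuous_on (sphere 0 1) (\<phi> n)" for n
    unfolding \<phi>_def by (intro continuous_intros)
  have I0: "integral {0..2*pi} (\<lambda>x. of_real (\<phi> n (cis x)) * f x) = 0" for n
    by (rule integral_circle_zero[OF f z cont])
  let ?g = "\<lambda>x. if x \<in> {a<..<b} then f x else 0"
  have "(\<lambda>n. integral {0..2*pi} (\<lambda>x. of_real (\<phi> n (cis x)) * f x)) \<longlonglongrightarrow> integral {0..2*pi} ?g"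
  proof (rule dominated_convergence(2))
    show "(\<lambda>x. of_real (\<phi> n (cis x)) * f x) integrable_on {0..2*pi}" for n
    proof (rule set_lebesgue_integral_eq_integral(1), rule absolutely_integrable_mult_continuous[OF f])
      show "continuous_on {0..2*pi} (\<lambda>x. complex_of_real (\<phi> n (cis x)))"
        unfolding \<phi> by (intro continuous_intros)
    qed
    show "(\<lambda>x. norm (f x)) integrable_on {0..2*pi}"
      using f by (simp add: absolutely_integrable_on_def)
    show "norm (of_real (\<phi> n (cis x)) * f x) \<le> norm (f x)" for n x
      unfolding norm_mult \<phi> using mult_right_mono[of "\<bar>min 1 (max 0 (real n * (cos (x - c) - cos \<delta>)))\<bar>" 1 "norm (f x)"] by simp
    fix x assume x: "x \<in> {0..2*pi}"
    have "(\<lambda>n. \<phi> n (cis x)) \<longlonglongrightarrow> (if x \<in> {a<..<b} then 1 else 0)"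
    proof (cases "x \<in> {a<..<b}")
      case True
      have "\<bar>x - c\<bar> < \<delta>" using True by (auto simp: c_def \<delta>_def abs_less_iff field_simps)
      moreover have "\<delta> \<le> pi" using ab by (simp add: \<delta>_def)
      ultimately have "cos \<delta> < cos \<bar>x - c\<bar>" by (intro cos_monotone_0_pi) auto
      then have h: "0 < cos (x - c) - cos \<delta>" by simp
      then obtain m :: nat where m: "1 < real m * (cos (x - c) - cos \<delta>)"
        using reals_Archimedean3 by blast
      have "\<phi> n (cis x) = 1" if "n \<ge> m" for n
      proof -
        have "real m * (cos (x - c) - cos \<delta>) \<le> real n * (cos (x - c) - cos \<delta>)"
          using that h by (intro mult_right_mono) auto
        then show ?thesis using m by (simp add: \<phi>)
      qed
      then have "\<forall>\<^sub>F n in sequentially. \<phi> n (cis x) = 1" by (auto simp: eventually_sequentially)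
      then show ?thesis using True by (simp add: tendsto_eventually)
    next
      case False
      have "\<delta> \<le> \<bar>x - c\<bar>" "\<bar>x - c\<bar> \<le> 2*pi - \<delta>" "0 \<le> \<delta>"
        using False x ab by (auto simp: c_def \<delta>_def abs_le_iff abs_if field_simps split: if_splits)
      then have "cos (x - c) - cos \<delta> \<le> 0" using cos_le_cos_outside by fastforce
      then have "\<phi> n (cis x) = 0" for n
        unfolding \<phi> by (simp add: max_absorb1 mult_nonneg_nonpos)
      then show ?thesis unfolding if_not_P[OF False] by simp
    qed
    then have "(\<lambda>n. of_real (\<phi> n (cis x)) * f x) \<longlonglongrightarrow> of_real (if x \<in> {a<..<b} then 1 else 0) * f x"
      by (intro tendsto_intros)
    moreover have eq: "of_real (if x \<in> {a<..<b} then 1 else 0) * f x = ?g x" by auto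
    ultimately show "(\<lambda>n. of_real (\<phi> n (cis x)) * f x) \<longlonglongrightarrow> ?g x" by (simp only: eq)
  qed
  then have "integral {0..2*pi} ?g = 0" unfolding I0 using LIMSEQ_unique tendsto_const by blast
  moreover have "integral {0..2*pi} ?g = integral {a<..<b} f"
  proof -
    have "{a<..<b} \<subseteq> {0..2*pi}" using ab by auto
    then show ?thesis by (subst integral_restrict_Int) (simp add: Int_absorb2)
  qed
  ultimately show ?thesis using integral_open_interval_real[of a b f] by simp
qed

text \<open>The averages of \<open>f\<close> over intervals starting at \<open>x\<close> vanish, and
  by Lebesgue differentiation they converge to \<open>f x\<close> for almost every \<open>x\<close>.
  The point \<open>2*pi\<close> joins the null set because the period leaves no room to its
  right.\<close>

lemma fourier_uniqueness:
  assumes f: "f absolutely_integrable_on {0..2*pi}" and z: "\<And>k. fcoef f k = 0"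
  shows "\<exists>N. negligible N \<and> (\<forall>x\<in>{0..2*pi} - N. f x = 0)"
proof -
  define g where "g x = (if x \<in> {0..2*pi} then f x else 0)" for x
  have "g integrable_on UNIV"
    unfolding g_def by (subst integrable_restrict_UNIV) (rule set_lebesgue_integral_eq_integral(1)[OF f])
  then have "g integrable_on cbox a b" for a b
    using integrable_on_subcbox by blast
  then obtain N where N: "negligible N"
    "\<And>x e. \<lbrakk>x \<notin> N; 0 < e\<rbrakk> \<Longrightarrow> \<exists>d>0. \<forall>h. 0 < h \<and> h < d \<longrightarrow>
        norm(integral (cbox x (x + h *\<^sub>R One)) g /\<^sub>R h ^ DIM(real) - g x) < e"
    using integrable_ccontinuous_explicit by metis
  have "f x = 0" if x: "x \<in> {0..2*pi} - (N \<union> {2*pi})" for x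
  proof -
    have "norm (g x) \<le> e" if e: "e > 0" for e
    proof -
      obtain d where d: "d > 0" "\<And>h. 0 < h \<Longrightarrow> h < d \<Longrightarrow> norm(integral (cbox x (x + h *\<^sub>R One)) g /\<^sub>R h ^ DIM(real) - g x) < e"
        using N(2)[of x e] x e by blast
      define h where "h = min (d/2) (2*pi - x)"
      have h: "0 < h" "h < d" "x + h \<le> 2*pi" using x d by (auto simp: h_def min_def)
      have "integral {x..x+h} g = integral {x..x+h} f"
        using x h by (intro integral_cong) (auto simp: g_def)
      also have "\<dots> = 0" using x h by (intro integral_interval_zero[OF f z]) auto
      finally show ?thesis using d(2)[OF h(1,2)] by simp
    qed
    then have "norm (g x) \<le> 0" by (rule field_le_epsilon) auto
    then show ?thesis using x by (simp add: g_def)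
  qed
  moreover have "negligible (N \<union> {2*pi})" using N(1) by (simp add: negligible_Un)
  ultimately show ?thesis by blast
qed

text \<open>The function minus its own Fourier series has vanishing coefficients. Through this an
  element of \<open>Hs\<close> becomes an absolutely convergent series.\<close>

lemma wien_of_summable:
  assumes f: "f absolutely_integrable_on {0..2*pi}" and s: "(\<lambda>k. cmod (fcoef f k)) summable_on UNIV"
  shows "wien f (fcoef f)"
proof -
  let ?s = "ser (fcoef f)"
  have sa: "?s absolutely_integrable_on {0..2*pi}"
    by (rule wien_absolutely_integrable[OF wien_ser[OF s]])
  have "fcoef (\<lambda>x. f x - ?s x) k = 0" for k
  proof -
    have e: "continuous_on {0..2*pi} (\<lambda>x. exp (- \<i> * of_int k * of_real x))" by (intro continuous_intros)
    have "integral {0..2*pi} (\<lambda>x. exp (- \<i> * of_int k * of_real x) * (f x - ?s x))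
      = integral {0..2*pi} (\<lambda>x. exp (- \<i> * of_int k * of_real x) * f x) - integral {0..2*pi} (\<lambda>x. exp (- \<i> * of_int k * of_real x) * ?s x)"
      unfolding right_diff_distrib
      by (intro integral_diff set_lebesgue_integral_eq_integral(1) absolutely_integrable_mult_continuous[OF _ e] f sa)
    then have "fcoef (\<lambda>x. f x - ?s x) k = fcoef f k - fcoef ?s k"
      by (simp add: fcoef_def right_diff_distrib)
    then show ?thesis using fcoef_ser[OF s] by simp
  qed
  moreover have "(\<lambda>x. f x - ?s x) absolutely_integrable_on {0..2*pi}"
    using f sa by (rule set_integral_diff(1))
  ultimately obtain N where "negligible N" "\<forall>x\<in>{0..2*pi} - N. f x - ?s x = 0"
    using fourier_uniqueness by blast
  then show ?thesis unfolding wien_def using s by auto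
qed

section \<open>Passage between \<open>Hs\<close>, \<open>Hnorm\<close> and \<open>hbd\<close>, which
  omits the factor \<open>2*pi\<close>\<close>

lemma Hs_summable_bra:
  "((\<lambda>k. (bra k powr (s/2) * cmod (a k))\<^sup>2)) = (\<lambda>k. (1 + (real_of_int k)^2) powr s * (cmod (a k))^2)"
  by (rule ext) (simp add: bra_def power_mult_distrib power2_eq_square powr_add[symmetric])

lemma Hs_hbd:
  assumes "Hs s f" shows "hbd s (fcoef f) (Hnorm s f / sqrt (2*pi))"
  unfolding hbd_def
proof (intro allI impI)
  fix F :: "int set" assume F: "finite F"
  have "(\<Sum>k\<in>F. (bra k powr (s/2) * cmod (fcoef f k))\<^sup>2) \<le> (\<Sum>\<^sub>\<infinity>k\<in>UNIV. (bra k powr (s/2) * cmod (fcoef f k))\<^sup>2)"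
    using assms F by (intro finite_sum_le_infsum) (auto simp: Hs_summable_bra Hs_def)
  then have "L2_set (\<lambda>k. bra k powr (s/2) * cmod (fcoef f k)) F \<le> sqrt (\<Sum>\<^sub>\<infinity>k\<in>UNIV. (1 + (real_of_int k)^2) powr s * (cmod (fcoef f k))^2)"
    by (simp add: L2_set_def Hs_summable_bra)
  also have "\<dots> = Hnorm s f / sqrt (2*pi)"
    by (simp add: Hnorm_def real_sqrt_mult)
  finally show "L2_set (\<lambda>k. bra k powr (s/2) * cmod (fcoef f k)) F \<le> Hnorm s f / sqrt (2*pi)" .
qed

lemma hbd_summable_sq:
  assumes "hbd s a B"
  shows "(\<lambda>k. (1 + (real_of_int k)^2) powr s * (cmod (a k))^2) summable_on UNIV"
    "(\<Sum>\<^sub>\<infinity>k\<in>UNIV. (1 + (real_of_int k)^2) powr s * (cmod (a k))^2) \<le> B\<^sup>2"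
proof -
  show *: "(\<lambda>k. (1 + (real_of_int k)^2) powr s * (cmod (a k))^2) summable_on UNIV"
    unfolding Hs_summable_bra[symmetric]
    by (rule nonneg_bdd_above_summable_on) (use hbd_sum_sq[OF assms] in \<open>auto intro!: bdd_aboveI2\<close>)
  show "(\<Sum>\<^sub>\<infinity>k\<in>UNIV. (1 + (real_of_int k)^2) powr s * (cmod (a k))^2) \<le> B\<^sup>2"
    using * unfolding Hs_summable_bra[symmetric]
    by (rule infsum_le_finite_sums) (use hbd_sum_sq[OF assms] in auto)
qed

lemma hbd_Hnorm:
  assumes "hbd s (fcoef f) B" shows "Hnorm s f \<le> sqrt (2*pi) * B"
proof -
  have "Hnorm s f \<le> sqrt (2*pi * B\<^sup>2)"
    unfolding Hnorm_def using hbd_summable_sq(2)[OF assms] by (intro real_sqrt_le_mono mult_left_mono) auto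
  then show ?thesis using hbd_nonneg[OF assms] by (simp add: real_sqrt_mult)
qed

lemma Hs_wien: "s > 3/2 \<Longrightarrow> Hs s f \<Longrightarrow> wien f (fcoef f)"
  by (rule wien_of_summable) (auto simp: Hs_def intro: hbd_abs_summable[OF _ Hs_hbd])

subsection \<open>Algebra of trilinear sums\<close>

lemma tri_scale: "c k * tri m x y z k = tri (\<lambda>k p q. c k * m k p q) x y z k"
  unfolding tri_def infsum_cmult_right'[symmetric] by (simp add: case_prod_unfold mult.assoc)

lemma tri_swap12: "tri m x y z k = tri (\<lambda>k p q. m k q p) y x z k"
  unfolding tri_def
  by (rule infsum_reindex_bij_witness[of _ prod.swap prod.swap]) (auto simp: mult_ac algebra_simps)

lemma tri_swap23: "tri m x y z k = tri (\<lambda>k p q. m k p (k-p-q)) x z y k"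
  unfolding tri_def
  by (rule infsum_reindex_bij_witness[of _ "\<lambda>(p,q). (p, k-p-q)" "\<lambda>(p,q). (p, k-p-q)"]) (auto simp: mult_ac)

text \<open>A non-summable family has \<open>infsum\<close> equal to 0, so sums of trilinear forms
  may be combined only after this has been checked for each of them.\<close>

definition tsum :: "(int \<Rightarrow> int \<Rightarrow> int \<Rightarrow> complex) \<Rightarrow> (int \<Rightarrow> complex) \<Rightarrow> (int \<Rightarrow> complex) \<Rightarrow> (int \<Rightarrow> complex) \<Rightarrow> int \<Rightarrow> bool" where
  "tsum m x y z k \<longleftrightarrow> (\<lambda>(p,q). m k p q * x p * y q * z (k-p-q)) summable_on UNIV"

lemma tri_add:
  assumes "tsum m x y z k" "tsum m' x y z k"
  shows "tri m x y z k + tri m' x y z k = tri (\<lambda>k p q. m k p q + m' k p q) x y z k"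
    and "tsum (\<lambda>k p q. m k p q + m' k p q) x y z k"
  using infsum_add[OF assms[unfolded tsum_def]] summable_on_add[OF assms[unfolded tsum_def]]
  by (simp_all add: tri_def tsum_def case_prod_unfold ring_distribs)

lemma tri_cong: "(\<And>p q. m k p q = m' k p q) \<Longrightarrow> tri m x y z k = tri m' x y z k"
  by (simp add: tri_def)

text \<open>The third factor is bounded by its l1 norm and the other two are summed freely. No
  Sobolev bound enters, so this serves every sequence that comes from \<open>wien\<close>.\<close>

lemma tsum_bounded:
  assumes x: "(\<lambda>k. cmod (x k)) summable_on UNIV" and y: "(\<lambda>k. cmod (y k)) summable_on UNIV"
    and z: "(\<lambda>k. cmod (z k)) summable_on UNIV" and m: "\<And>p q. cmod (m k p q) \<le> B"
  shows "tsum m x y z k"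
proof -
  have zb: "cmod (z j) \<le> (\<Sum>\<^sub>\<infinity>k\<in>UNIV. cmod (z k))" for j
    using finite_sum_le_infsum[OF z, of "{j}"] by simp
  have "(\<lambda>g. cmod (case g of (p,q) \<Rightarrow> m k p q * x p * y q * z (k-p-q))) summable_on UNIV"
  proof (rule summable_on_comparison_test)
    show "(\<lambda>g. (B * (\<Sum>\<^sub>\<infinity>k\<in>UNIV. cmod (z k))) * (case g of (p,q) \<Rightarrow> cmod (x p * y q))) summable_on UNIV"
      by (intro summable_on_cmult_right prod_has_sum x y)
    fix g :: "int \<times> int"
    obtain p q where g: "g = (p,q)" by force
    have "cmod (m k p q * x p * y q * z (k-p-q)) = cmod (m k p q) * cmod (z (k-p-q)) * cmod (x p * y q)"
      by (simp add: norm_mult mult_ac)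
    also have "\<dots> \<le> (B * (\<Sum>\<^sub>\<infinity>k\<in>UNIV. cmod (z k))) * cmod (x p * y q)"
      using m[of p q] zb order_trans[OF norm_ge_zero m[of p q]] by (intro mult_right_mono mult_mono) auto
    finally show "cmod (case g of (p,q) \<Rightarrow> m k p q * x p * y q * z (k-p-q)) \<le> (B * (\<Sum>\<^sub>\<infinity>k\<in>UNIV. cmod (z k))) * (case g of (p,q) \<Rightarrow> cmod (x p * y q))"
      by (simp add: g)
  qed auto
  then show ?thesis unfolding tsum_def by (rule abs_summable_summable)
qed

text \<open>The inner multiplier sees the frequency \<open>k - p\<close> of the inner pair; Fubini,
  justified by \<open>tsum_bounded\<close>, merges the two convolutions.\<close>

lemma conv_conv_tri:
  assumes x: "(\<lambda>k. cmod (x k)) summable_on UNIV" and y: "(\<lambda>k. cmod (y k)) summable_on UNIV"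
    and z: "(\<lambda>k. cmod (z k)) summable_on UNIV" and m: "\<And>j. cmod (m j) \<le> B"
  shows "conv x (\<lambda>j. m j * conv y z j) k = tri (\<lambda>k p q. m (k-p)) x y z k"
proof -
  have "tsum (\<lambda>k p q. m (k-p)) x y z k" by (rule tsum_bounded[OF x y z m])
  then have s: "(\<lambda>(p,q). m (k-p) * x p * y q * z (k-p-q)) summable_on UNIV \<times> UNIV" by (simp add: tsum_def)
  have "tri (\<lambda>k p q. m (k-p)) x y z k = (\<Sum>\<^sub>\<infinity>p\<in>UNIV. \<Sum>\<^sub>\<infinity>q\<in>UNIV. m (k-p) * x p * y q * z (k-p-q))"
    using infsum_Sigma'_banach[OF s] by (simp add: tri_def)
  also have "\<dots> = (\<Sum>\<^sub>\<infinity>p\<in>UNIV. x p * (m (k-p) * conv y z (k-p)))"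
    unfolding conv_def infsum_cmult_right'[symmetric] by (simp add: mult_ac)
  finally show ?thesis by (simp add: conv_def)
qed

subsection \<open>Fourier coefficients of one step of the scheme\<close>

text \<open>Here \<open>k - q\<close> is the \<open>p + r\<close> of the overview. The factored form
  is the one that cancels against \<open>msym (k - q)\<close>; \<open>phi_alt\<close> is the form
  that the free flow produces.\<close>

definition phi :: "int \<Rightarrow> int \<Rightarrow> int \<Rightarrow> real" where
  "phi k p q = 2 * of_int (p + q) * of_int (k - q)"

lemma phi_alt: "phi k p q = (of_int k)\<^sup>2 + (of_int p)\<^sup>2 - (of_int q)\<^sup>2 - (of_int (k-p-q))\<^sup>2"
  by (simp add: phi_def power2_eq_square algebra_simps)

text \<open>The symbol of \<open>Sop (- t)\<close>. Its conjugate is the symbol of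
  \<open>Sop t\<close>, so multiplication by \<open>ek t k\<close> removes the free flow.\<close>

definition ek :: "real \<Rightarrow> int \<Rightarrow> complex" where
  "ek t k = osc t ((of_int k)\<^sup>2)"

lemma norm_ek [simp]: "cmod (ek t k) = 1"
  by (simp add: ek_def)

lemma ek_cnj [simp]: "ek t k * cnj (ek t k) = 1" "cnj (ek t k) * ek t k = 1"
  by (simp_all add: complex_norm_square[symmetric] mult.commute[of "cnj _"])

lemma ek_uminus [simp]: "ek t (- k) = ek t k"
  by (simp add: ek_def)

lemma ek_zero [simp]: "ek t 0 = 1" "ek 0 k = 1"
  by (simp_all add: ek_def)

lemma osc_phi: "ek t k * ek t p * cnj (ek t q) * cnj (ek t (k-p-q)) = osc t (phi k p q)"
  unfolding phi_alt ek_def osc_minus[symmetric] osc_add[symmetric] by (simp add: algebra_simps)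

lemma osc_two: "ek t k * (ek t p * cnj (ek t (k-p))) = osc t (2 * of_int k * of_int p)"
  unfolding ek_def osc_minus[symmetric] osc_add[symmetric] by (simp add: power2_eq_square algebra_simps)

lemma Sop_symbol: "exp (- \<i> * of_real t * of_int (k^2)) = cnj (ek t k)"
  by (simp add: ek_def osc_def exp_cnj mult_ac)

lemma cnj_ek_uminus [simp]: "cnj (ek (- t) k) = ek t k"
  by (simp add: ek_def osc_def exp_cnj)

lemma wien_Sop:
  assumes "wien f a"
  shows "wien (Sop t f) (\<lambda>k. cnj (ek t k) * a k)" "wien (Sop (-t) f) (\<lambda>k. ek t k * a k)"
  using wien_fmult_bounded[OF assms, of "\<lambda>k. cnj (ek t k)" 1] wien_fmult_bounded[OF assms, of "ek t" 1]
  unfolding Sop_def Sop_symbol by simp_all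

lemma norm_msym_le: "cmod (msym k) \<le> 1"
proof (cases "k = 0")
  case False
  then have "1 \<le> \<bar>k\<bar>" by simp
  then have "1 \<le> \<bar>real_of_int k\<bar>" by linarith
  then show ?thesis using False by (simp add: msym_def norm_divide norm_mult)
qed (simp add: msym_def)

lemma wien_dinv: "wien f a \<Longrightarrow> wien (dinv f) (\<lambda>k. msym k * a k)"
  unfolding dinv_def by (rule wien_fmult_bounded[OF _ norm_msym_le])

lemma wien_cubic:
  assumes "wien f a" shows "wien (\<lambda>x. abs2 f x * f x) (tri (\<lambda>k p q. 1) (rcnj a) a a)"
proof -
  note s = wien_summable[OF assms] wien_summable[OF wien_cnjf[OF assms]]
  have "wien (\<lambda>x. cnjf f x * (f x * f x)) (conv (rcnj a) (conv a a))"
    by (intro wien_mult wien_cnjf assms)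
  moreover have "(\<lambda>x. cnjf f x * (f x * f x)) = (\<lambda>x. abs2 f x * f x)"
    unfolding abs2_def complex_norm_square by (simp add: cnjf_def mult_ac)
  moreover have "conv (rcnj a) (conv a a) = tri (\<lambda>k p q. 1) (rcnj a) a a"
    using conv_conv_tri[OF s(2) s(1) s(1), of "\<lambda>_. 1" 1] by auto
  ultimately show ?thesis by simp
qed

definition theta :: "complex \<Rightarrow> complex \<Rightarrow> int \<Rightarrow> complex" where
  "theta M P k = - 2 * M - 2 * P * msym k"

lemma norm_theta_le: "cmod (theta M P k) \<le> 2 * (cmod M + cmod P)"
proof -
  have "cmod (theta M P k) \<le> cmod (- 2 * M) + cmod (2 * P * msym k)"
    unfolding theta_def by (rule norm_triangle_ineq4)
  also have "\<dots> \<le> 2 * cmod M + 2 * cmod P * 1"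
    using norm_msym_le[of k] by (intro add_mono) (auto simp: norm_mult mult_left_le)
  finally show ?thesis by simp
qed

text \<open>The cubic terms of \<open>Psi\<close> after untwisting: the zero mode, the two terms
  with \<open>dinv2\<close>, the two with nested \<open>dinv\<close>. Each \<open>- 1\<close> comes
  from the partner in which the free flow acts on the whole product, and \<open>k - q\<close> is the
  frequency of the inner factor \<open>abs2\<close>.\<close>

definition mpsi :: "real \<Rightarrow> int \<Rightarrow> int \<Rightarrow> int \<Rightarrow> complex" where
  "mpsi t k p q = (if k = 0 then - (\<i> * of_real t) else 0)
     - (1/2) * (msym k)\<^sup>2 * (osc t (2 * of_int k * of_int p) - 1)
     + msym k * msym (k - q) * (osc t (phi k p q) - 1)"

text \<open>\<open>psic t M P a\<close> is the sequence of Fourier coefficients of \<open>Psi\<close> untwisted by the free flow.\<close>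
definition psic :: "real \<Rightarrow> complex \<Rightarrow> complex \<Rightarrow> (int \<Rightarrow> complex) \<Rightarrow> int \<Rightarrow> complex" where
  "psic t M P a k = exp (\<i> * of_real t * theta M P k) * a k
      + (if k = 0 then 2 * \<i> * of_real t * M * a 0 else 0) + tri (mpsi t) (rcnj a) a a k"

lemma rcnj_cnj_ek: "rcnj (\<lambda>k. cnj (ek t k) * a k) = (\<lambda>k. ek t k * rcnj a k)"
  by (simp add: rcnj_def fun_eq_iff)

text \<open>Multiplying by \<open>ek t k\<close> collects the phases of the separate factors into
  those of \<open>osc_two\<close> and \<open>osc_phi\<close>. Since \<open>wien\<close> is both
  hypothesis and conclusion, the statement can be iterated along the scheme.\<close>

lemma wien_Psi:
  assumes w: "wien f a"
  shows "wien (Psi t u0 f) (\<lambda>k. cnj (ek t k) * psic t (M0 u0) (P0 u0) a k)"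
proof -
  define M P where "M = M0 u0" and "P = P0 u0"
  let ?e = "ek t" and ?c = "rcnj a" and ?S = "\<lambda>k. cnj (ek t k) * a k"
  note wc = wien_cnjf[OF w]
  note sa = wien_summable[OF w] and sc = wien_summable[OF wc]
  note sS = wien_summable[OF wien_Sop(1)[OF w, of t]] and sSc = wien_summable[OF wien_Sop(2)[OF wc, of t]]
  define N where "N = tri (\<lambda>k p q. 1) ?c a a"
  define T4 where "T4 = tri (\<lambda>k p q. ?e p * cnj (?e (k-p))) ?c a a"
  define T6 where "T6 = tri (\<lambda>k p q. msym (k-q) * (?e p * cnj (?e q) * cnj (?e (k-p-q)))) ?c a a"
  define T7 where "T7 = tri (\<lambda>k p q. msym (k-q)) ?c a a"
  have t1: "wien (Eop t u0 f) (\<lambda>k. exp (\<i> * of_real t * theta M P k) * cnj (?e k) * a k)"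
  proof -
    have sym: "exp (\<i> * of_real t * (- 2 * M0 u0 - 2 * P0 u0 * msym k - of_int (k^2))) = exp (\<i> * of_real t * theta M P k) * cnj (?e k)" for k
      unfolding theta_def M_def P_def Sop_symbol[symmetric] exp_add[symmetric] by (simp add: algebra_simps)
    have bd: "cmod (exp (\<i> * of_real t * theta M P k) * cnj (?e k)) \<le> exp (\<bar>t\<bar> * (2 * (cmod M + cmod P)))" for k
    proof -
      have "cmod (exp (\<i> * of_real t * theta M P k)) \<le> exp (cmod (\<i> * of_real t * theta M P k))" by (rule norm_exp)
      also have "\<dots> \<le> exp (\<bar>t\<bar> * (2 * (cmod M + cmod P)))"
        using norm_theta_le by (simp add: norm_mult mult_left_mono)
      finally show ?thesis by (simp add: norm_mult)
    qed
    show ?thesis unfolding Eop_def sym by (rule wien_fmult_bounded[OF w bd])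
  qed
  have t2: "Pi0 (\<lambda>y. abs2 f y * f y) = N 0"
    unfolding Pi0_def N_def using wien_fcoef[OF wien_cubic[OF w]] by simp
  have t3: "Pi0 f = a 0" unfolding Pi0_def using wien_fcoef[OF w] by simp
  have t4: "wien (dinv2 (\<lambda>y. Sop (-t) (cnjf f) y * Sop t (\<lambda>z. (f z)^2) y)) (\<lambda>k. msym k * (msym k * T4 k))"
  proof -
    have "wien (\<lambda>z. (f z)^2) (conv a a)" using wien_mult[OF w w] by (simp add: power2_eq_square)
    then have "wien (\<lambda>y. Sop (-t) (cnjf f) y * Sop t (\<lambda>z. (f z)^2) y) (conv (\<lambda>k. ?e k * ?c k) (\<lambda>k. cnj (?e k) * conv a a k))"
      by (intro wien_mult wien_Sop wc)
    moreover have "conv (\<lambda>k. ?e k * ?c k) (\<lambda>k. cnj (?e k) * conv a a k) = T4"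
    proof
      fix k
      have "conv (\<lambda>k. ?e k * ?c k) (\<lambda>k. cnj (?e k) * conv a a k) k = tri (\<lambda>k p q. cnj (?e (k-p))) (\<lambda>k. ?e k * ?c k) a a k"
        by (rule conv_conv_tri[OF sSc sa sa, of _ 1]) simp
      then show "conv (\<lambda>k. ?e k * ?c k) (\<lambda>k. cnj (?e k) * conv a a k) k = T4 k"
        by (simp add: T4_def tri_def mult_ac)
    qed
    ultimately show ?thesis unfolding dinv2_def by (intro wien_dinv) simp
  qed
  have t5: "wien (Sop t (dinv2 (\<lambda>y. abs2 f y * f y))) (\<lambda>k. cnj (?e k) * (msym k * (msym k * N k)))"
    unfolding dinv2_def N_def by (intro wien_Sop wien_dinv wien_cubic w)
  have t6: "wien (dinv (\<lambda>y. Sop t f y * dinv (abs2 (Sop t f)) y)) (\<lambda>k. msym k * T6 k)"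
  proof -
    have "wien (\<lambda>y. Sop t f y * dinv (abs2 (Sop t f)) y) (conv ?S (\<lambda>k. msym k * conv (rcnj ?S) ?S k))"
      by (intro wien_mult wien_dinv wien_abs2 wien_Sop w)
    moreover have "conv ?S (\<lambda>k. msym k * conv (rcnj ?S) ?S k) = T6"
    proof
      fix k
      have "conv ?S (\<lambda>k. msym k * conv (rcnj ?S) ?S k) k = tri (\<lambda>k p q. msym (k-p)) ?S (\<lambda>k. ?e k * ?c k) ?S k"
        unfolding rcnj_cnj_ek by (rule conv_conv_tri[OF sS sSc sS norm_msym_le])
      \<comment> \<open>The product has an unconjugated factor in front; exchanging the first two
        slots restores the convention that \<open>p\<close> belongs to the conjugate.\<close>
      also have "\<dots> = tri (\<lambda>k p q. msym (k-q)) (\<lambda>k. ?e k * ?c k) ?S ?S k" by (rule tri_swap12)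
      finally show "conv ?S (\<lambda>k. msym k * conv (rcnj ?S) ?S k) k = T6 k"
        by (simp add: T6_def tri_def mult_ac)
    qed
    ultimately show ?thesis by (intro wien_dinv) simp
  qed
  have t7: "wien (Sop t (dinv (\<lambda>y. f y * dinv (abs2 f) y))) (\<lambda>k. cnj (?e k) * (msym k * T7 k))"
  proof -
    have "wien (\<lambda>y. f y * dinv (abs2 f) y) (conv a (\<lambda>k. msym k * conv (rcnj a) a k))"
      by (intro wien_mult wien_dinv wien_abs2 w)
    moreover have "conv a (\<lambda>k. msym k * conv (rcnj a) a k) = T7"
    proof
      fix k
      have "conv a (\<lambda>k. msym k * conv (rcnj a) a k) k = tri (\<lambda>k p q. msym (k-p)) a ?c a k"
        by (rule conv_conv_tri[OF sa sc sa norm_msym_le])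
      also have "\<dots> = T7 k" unfolding T7_def by (rule tri_swap12)
      finally show "conv a (\<lambda>k. msym k * conv (rcnj a) a k) k = T7 k" .
    qed
    ultimately show ?thesis by (intro wien_Sop wien_dinv) simp
  qed
  \<comment> \<open>The zero-mode terms of \<open>Psi\<close> are constant functions, hence
    sequences supported at \<open>k = 0\<close>, where \<open>ek t 0 = 1\<close> leaves them
    unchanged.\<close>
  let ?d = "\<lambda>c k. if k = (0::int) then c else (0::complex)"
  have "wien (\<lambda>x. Eop t u0 f x + (- \<i> * of_real t * N 0) + (2 * \<i> * of_real t * M * a 0)
     + (- (1/2)) * dinv2 (\<lambda>y. Sop (-t) (cnjf f) y * Sop t (\<lambda>z. (f z)^2) y) x
     + (1/2) * Sop t (dinv2 (\<lambda>y. abs2 f y * f y)) x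
     + dinv (\<lambda>y. Sop t f y * dinv (abs2 (Sop t f)) y) x
     + (- 1) * Sop t (dinv (\<lambda>y. f y * dinv (abs2 f) y)) x)
    (\<lambda>k. exp (\<i> * of_real t * theta M P k) * cnj (?e k) * a k + ?d (- \<i> * of_real t * N 0) k + ?d (2 * \<i> * of_real t * M * a 0) k
     + (- (1/2)) * (msym k * (msym k * T4 k)) + (1/2) * (cnj (?e k) * (msym k * (msym k * N k)))
     + msym k * T6 k + (- 1) * (cnj (?e k) * (msym k * T7 k)))"
    by (intro wien_add wien_cmult wien_const t1 t4 t5 t6 t7)
  moreover have "(\<lambda>x. Eop t u0 f x + (- \<i> * of_real t * N 0) + (2 * \<i> * of_real t * M * a 0)
     + (- (1/2)) * dinv2 (\<lambda>y. Sop (-t) (cnjf f) y * Sop t (\<lambda>z. (f z)^2) y) x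
     + (1/2) * Sop t (dinv2 (\<lambda>y. abs2 f y * f y)) x
     + dinv (\<lambda>y. Sop t f y * dinv (abs2 (Sop t f)) y) x
     + (- 1) * Sop t (dinv (\<lambda>y. f y * dinv (abs2 f) y)) x) = Psi t u0 f"
    unfolding Psi_def t2 t3 M_def by (rule ext) simp
  moreover have "exp (\<i> * of_real t * theta M P k) * cnj (?e k) * a k + ?d (- \<i> * of_real t * N 0) k + ?d (2 * \<i> * of_real t * M * a 0) k
     + (- (1/2)) * (msym k * (msym k * T4 k)) + (1/2) * (cnj (?e k) * (msym k * (msym k * N k)))
     + msym k * T6 k + (- 1) * (cnj (?e k) * (msym k * T7 k)) = cnj (?e k) * psic t M P a k" for k
  proof -
    define d where "d k = (if k = (0::int) then - \<i> * of_real t else 0)" for k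
    have tb: "tsum m ?c a a k" if "\<And>p q. cmod (m k p q) \<le> B" for m B
      using that by (intro tsum_bounded[where B = B and k = k] sc sa)
    define n4 where "n4 k p q = - (1/2) * (msym k)\<^sup>2 * osc t (2 * of_int k * of_int p)" for k p q :: int
    define n5 where "n5 k p q = (1/2) * (msym k)\<^sup>2" for k p q :: int
    define n6 where "n6 k p q = msym k * msym (k-q) * osc t (phi k p q)" for k p q :: int
    define n7 where "n7 k p q = - msym k * msym (k-q)" for k p q :: int
    have e4: "?e k * (- (1/2) * (msym k * (msym k * T4 k))) = tri n4 ?c a a k"
    proof -
      have "?e k * (- (1/2) * (msym k * (msym k * T4 k))) = (- (1/2) * (msym k)\<^sup>2 * ?e k) * T4 k"
        by (simp add: power2_eq_square)
      also have "\<dots> = tri (\<lambda>k p q. (- (1/2) * (msym k)\<^sup>2 * ?e k) * (?e p * cnj (?e (k-p)))) ?c a a k"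
        unfolding T4_def by (rule tri_scale)
      also have "\<dots> = tri n4 ?c a a k"
        by (rule tri_cong) (unfold n4_def osc_two[symmetric], simp only: mult_ac)
      finally show ?thesis .
    qed
    have e5: "(1/2) * (msym k * (msym k * N k)) = tri n5 ?c a a k"
      using tri_scale[of "\<lambda>k. (1/2) * (msym k)\<^sup>2" k "\<lambda>k p q. 1" ?c a a]
      by (simp add: N_def n5_def[abs_def] power2_eq_square mult.assoc)
    have e6: "?e k * (msym k * T6 k) = tri n6 ?c a a k"
    proof -
      have "?e k * (msym k * T6 k) = (?e k * msym k) * T6 k" by simp
      also have "\<dots> = tri (\<lambda>k p q. (?e k * msym k) * (msym (k-q) * (?e p * cnj (?e q) * cnj (?e (k-p-q))))) ?c a a k"
        unfolding T6_def by (rule tri_scale)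
      also have "\<dots> = tri n6 ?c a a k"
        by (rule tri_cong) (simp only: n6_def osc_phi[symmetric] mult_ac)
      finally show ?thesis .
    qed
    have e7: "- (msym k * T7 k) = tri n7 ?c a a k"
      using tri_scale[of "\<lambda>k. - msym k" k "\<lambda>k p q. msym (k-q)" ?c a a]
      by (simp add: T7_def n7_def[abs_def])
    have e2: "d k * N k = tri (\<lambda>k p q. d k) ?c a a k"
      using tri_scale[of d k "\<lambda>k p q. 1" ?c a a] by (simp add: N_def)
    have msq: "cmod ((msym k)\<^sup>2) \<le> 1" "cmod (msym k * msym j) \<le> 1" for k j
      using norm_msym_le[of k] norm_msym_le[of j] by (auto simp: norm_mult norm_power power_le_one mult_le_one)
    have s2: "tsum (\<lambda>k p q. d k) ?c a a k" by (rule tb[of _ "cmod (d k)"]) simp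
    have s4: "tsum n4 ?c a a k" by (rule tb[of _ 1]) (use msq(1)[of k] in \<open>simp add: n4_def norm_mult\<close>)
    have s5: "tsum n5 ?c a a k" by (rule tb[of _ 1]) (use msq(1)[of k] in \<open>simp add: n5_def norm_mult\<close>)
    have s6: "tsum n6 ?c a a k" by (rule tb[of _ 1]) (use msq(2)[of k] in \<open>simp add: n6_def norm_mult\<close>)
    have s7: "tsum n7 ?c a a k" by (rule tb[of _ 1]) (use msq(2)[of k] in \<open>simp add: n7_def norm_mult\<close>)
    have "d k * N k + tri n4 ?c a a k + tri n5 ?c a a k + tri n6 ?c a a k + tri n7 ?c a a k
       = tri (\<lambda>k p q. d k + n4 k p q + n5 k p q + n6 k p q + n7 k p q) ?c a a k"
      unfolding e2 by (simp add: tri_add s2 s4 s5 s6 s7)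
    also have "\<dots> = tri (mpsi t) ?c a a k"
      by (rule tri_cong) (simp add: mpsi_def d_def n4_def n5_def n6_def n7_def algebra_simps)
    finally have tri: "tri (mpsi t) ?c a a k = d k * N k + ?e k * (- (1/2) * (msym k * (msym k * T4 k)))
        + (1/2) * (msym k * (msym k * N k)) + ?e k * (msym k * T6 k) - (msym k * T7 k)"
      unfolding e4 e5 e6 e7[symmetric] by simp
    have c: "cnj (?e k) * (?e k * z) = z" for z
      by (simp add: mult.assoc[symmetric])
    show ?thesis
      unfolding psic_def tri ring_distribs right_diff_distrib c
      by (cases "k = 0") (simp_all add: d_def mult_ac)
  qed
  ultimately show ?thesis by (simp only: M_def P_def)
qed

subsection \<open>Multiplier bounds\<close>

definition mbd :: "(int \<Rightarrow> int \<Rightarrow> int \<Rightarrow> complex) \<Rightarrow> real \<Rightarrow> bool" where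
  "mbd m K \<longleftrightarrow> (\<forall>k p q. cmod (m k p q) \<le> K * sqrt (bra p * bra q * bra (k-p-q) / bra k))"

lemma mbdD: "mbd m K \<Longrightarrow> cmod (m k p q) \<le> K * sqrt (bra p * bra q * bra (k-p-q) / bra k)"
  by (simp add: mbd_def)

text \<open>One inner bracket is at least \<open>bra k / 9\<close> and the others are at least 1.
  Hence bounded multipliers are admissible, at the cost of \<open>3 = sqrt 9\<close>.\<close>

lemma mu_ge_1: "1 \<le> 3 * sqrt (bra p * bra q * bra (k-p-q) / bra k)"
proof -
  define r where "r = k - p - q"
  have "bra k \<le> 3 * (bra p + bra q + bra r)" unfolding r_def by (rule bra_le_sum3)
  also have "\<dots> \<le> 9 * (bra p * bra q * bra r)"
  proof -
    have 1: "1 \<le> bra i * bra j" for i j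
      using mult_mono[of 1 "bra i" 1 "bra j"] by simp
    have "bra p \<le> bra p * bra q * bra r" "bra q \<le> bra p * bra q * bra r" "bra r \<le> bra p * bra q * bra r"
      using mult_left_mono[OF 1[of q r] bra_nonneg[of p]] mult_left_mono[OF 1[of p r] bra_nonneg[of q]] mult_left_mono[OF 1[of p q] bra_nonneg[of r]]
      by (simp_all only: mult_ac mult_1)
    then show ?thesis unfolding distrib_left by linarith
  qed
  finally have "1 \<le> 9 * (bra p * bra q * bra r / bra k)" by (simp add: field_simps)
  then have "sqrt 1 \<le> sqrt (9 * (bra p * bra q * bra r / bra k))" by (rule real_sqrt_le_mono)
  also have "\<dots> = 3 * sqrt (bra p * bra q * bra r / bra k)" by (subst real_sqrt_mult) simp
  finally show ?thesis by (simp add: r_def)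
qed

lemma mbd_bounded:
  assumes "\<And>k p q. cmod (m k p q) \<le> c" shows "mbd m (3 * c)"
  unfolding mbd_def
proof (intro allI)
  fix k p q
  have c: "0 \<le> c" using order_trans[OF norm_ge_zero assms] .
  have "cmod (m k p q) \<le> c * 1" using assms by simp
  also have "\<dots> \<le> c * (3 * sqrt (bra p * bra q * bra (k-p-q) / bra k))" by (rule mult_left_mono[OF mu_ge_1 c])
  finally show "cmod (m k p q) \<le> 3 * c * sqrt (bra p * bra q * bra (k-p-q) / bra k)" by simp
qed

text \<open>The shape of the consistency error. The factor \<open>sqrt 2\<close> pays for replacing
  |k| by \<open>sqrt (bra k)\<close> when \<open>k\<close> is nonzero; at \<open>k = 0\<close> the
  output bracket is 1.\<close>

lemma mbd_ratio:
  fixes m :: "int \<Rightarrow> int \<Rightarrow> int \<Rightarrow> complex"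
  assumes "0 \<le> c" "\<And>k p q. k = 0 \<Longrightarrow> cmod (m k p q) \<le> c * (\<bar>of_int q\<bar> * \<bar>of_int (k-p-q)\<bar>)"
    "\<And>k p q. k \<noteq> 0 \<Longrightarrow> cmod (m k p q) \<le> c * (\<bar>of_int p\<bar> * \<bar>of_int q\<bar> * \<bar>of_int (k-p-q)\<bar> / \<bar>of_int k\<bar>)"
  shows "mbd m (sqrt 2 * c)"
  unfolding mbd_def
proof (intro allI)
  fix k p q :: int
  let ?r = "k - p - q"
  have mu: "sqrt (bra p * bra q * bra ?r / bra k) = sqrt (bra p) * sqrt (bra q) * sqrt (bra ?r) / sqrt (bra k)"
    by (simp add: real_sqrt_mult real_sqrt_divide)
  show "cmod (m k p q) \<le> sqrt 2 * c * sqrt (bra p * bra q * bra ?r / bra k)"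
  proof (cases "k = 0")
    case True
    have "cmod (m k p q) \<le> c * (\<bar>of_int q\<bar> * \<bar>of_int ?r\<bar>)" by (rule assms(2)[OF True])
    also have "\<dots> \<le> c * (sqrt (bra p) * sqrt (bra q) * sqrt (bra ?r))"
    proof (rule mult_left_mono[OF _ assms(1)])
      have "\<bar>real_of_int q\<bar> * \<bar>real_of_int ?r\<bar> \<le> sqrt (bra q) * sqrt (bra ?r)"
        by (intro mult_mono abs_le_sqrt_bra) auto
      also have "\<dots> \<le> sqrt (bra p) * (sqrt (bra q) * sqrt (bra ?r))"
        using mult_right_mono[of 1 "sqrt (bra p)" "sqrt (bra q) * sqrt (bra ?r)"] by simp
      finally show "\<bar>real_of_int q\<bar> * \<bar>real_of_int ?r\<bar> \<le> sqrt (bra p) * sqrt (bra q) * sqrt (bra ?r)" by (simp add: mult_ac)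
    qed
    also have "\<dots> = 1 * (c * sqrt (bra p * bra q * bra ?r / bra k))" unfolding mu using True by simp
    also have "\<dots> \<le> sqrt 2 * (c * sqrt (bra p * bra q * bra ?r / bra k))"
      using assms(1) by (intro mult_right_mono) (auto intro!: mult_nonneg_nonneg)
    finally show ?thesis by simp
  next
    case False
    have k: "0 < \<bar>real_of_int k\<bar>" using False by simp
    have "cmod (m k p q) \<le> c * (\<bar>of_int p\<bar> * \<bar>of_int q\<bar> * \<bar>of_int ?r\<bar> / \<bar>of_int k\<bar>)" by (rule assms(3)[OF False])
    also have "\<dots> \<le> c * (sqrt (bra p) * sqrt (bra q) * sqrt (bra ?r) * (sqrt 2 / sqrt (bra k)))"
    proof (rule mult_left_mono[OF _ assms(1)])
      have "1 / \<bar>real_of_int k\<bar> \<le> sqrt 2 / sqrt (bra k)"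
        using sqrt_bra_le[OF False] k by (simp add: field_simps)
      then have "(\<bar>real_of_int p\<bar> * \<bar>of_int q\<bar> * \<bar>of_int ?r\<bar>) * (1 / \<bar>of_int k\<bar>) \<le> (sqrt (bra p) * sqrt (bra q) * sqrt (bra ?r)) * (sqrt 2 / sqrt (bra k))"
        by (intro mult_mono abs_le_sqrt_bra) auto
      then show "\<bar>real_of_int p\<bar> * \<bar>of_int q\<bar> * \<bar>of_int ?r\<bar> / \<bar>of_int k\<bar> \<le> sqrt (bra p) * sqrt (bra q) * sqrt (bra ?r) * (sqrt 2 / sqrt (bra k))"
        by simp
    qed
    also have "\<dots> = sqrt 2 * c * sqrt (bra p * bra q * bra ?r / bra k)" unfolding mu by simp
    finally show ?thesis .
  qed
qed

text \<open>The shape of the multipliers of the scheme itself. The constant is \<open>2\<close>, for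
  the two numerators, times \<open>3/2\<close>, a bound for \<open>sqrt 2\<close>; it agrees with
  the \<open>3\<close> of \<open>mu_ge_1\<close>, which treats \<open>k = 0\<close>.\<close>

lemma mbd_ratio1:
  fixes m :: "int \<Rightarrow> int \<Rightarrow> int \<Rightarrow> complex"
  assumes "0 \<le> c" "\<And>k p q. k = 0 \<Longrightarrow> cmod (m k p q) \<le> c"
    "\<And>k p q. k \<noteq> 0 \<Longrightarrow> cmod (m k p q) \<le> c * ((\<bar>of_int p\<bar> + \<bar>of_int q\<bar>) / \<bar>of_int k\<bar>)"
  shows "mbd m (3 * c)"
  unfolding mbd_def
proof (intro allI)
  fix k p q :: int
  let ?r = "k - p - q"
  have mu: "sqrt (bra p * bra q * bra ?r / bra k) = sqrt (bra p) * sqrt (bra q) * sqrt (bra ?r) / sqrt (bra k)"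
    by (simp add: real_sqrt_mult real_sqrt_divide)
  show "cmod (m k p q) \<le> 3 * c * sqrt (bra p * bra q * bra ?r / bra k)"
  proof (cases "k = 0")
    case True
    have "cmod (m k p q) \<le> c * 1" using assms(2)[OF True] by simp
    also have "\<dots> \<le> c * (3 * sqrt (bra p * bra q * bra ?r / bra k))" by (rule mult_left_mono[OF mu_ge_1 assms(1)])
    finally show ?thesis by simp
  next
    case False
    have k: "0 < \<bar>real_of_int k\<bar>" using False by simp
    have one: "1 \<le> sqrt (bra i)" for i by simp
    have le: "sqrt (bra p) \<le> sqrt (bra p) * sqrt (bra q) * sqrt (bra ?r)" "sqrt (bra q) \<le> sqrt (bra p) * sqrt (bra q) * sqrt (bra ?r)"
    proof -
      have "1 * 1 \<le> sqrt (bra i) * sqrt (bra j)" for i j by (rule mult_mono) auto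
      then have "sqrt (bra p) * 1 \<le> sqrt (bra p) * (sqrt (bra q) * sqrt (bra ?r))" "sqrt (bra q) * 1 \<le> sqrt (bra q) * (sqrt (bra p) * sqrt (bra ?r))"
        by (intro mult_left_mono; simp)+
      then show "sqrt (bra p) \<le> sqrt (bra p) * sqrt (bra q) * sqrt (bra ?r)" "sqrt (bra q) \<le> sqrt (bra p) * sqrt (bra q) * sqrt (bra ?r)"
        by (simp_all only: mult_ac mult_1_right mult_1)
    qed
    have "cmod (m k p q) \<le> c * ((\<bar>of_int p\<bar> + \<bar>of_int q\<bar>) / \<bar>of_int k\<bar>)" by (rule assms(3)[OF False])
    also have "\<dots> \<le> c * ((2 * (sqrt (bra p) * sqrt (bra q) * sqrt (bra ?r))) * (3/2 / sqrt (bra k)))"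
    proof (rule mult_left_mono[OF _ assms(1)])
      have "sqrt 2 \<le> (3/2::real)" by (rule real_le_lsqrt) (auto simp: power2_eq_square)
      then have "sqrt (bra k) \<le> 3/2 * \<bar>real_of_int k\<bar>"
        using sqrt_bra_le[OF False] mult_right_mono[of "sqrt 2" "3/2" "\<bar>real_of_int k\<bar>"] by linarith
      then have "1 / \<bar>real_of_int k\<bar> \<le> 3/2 / sqrt (bra k)"
        using k by (simp add: field_simps)
      moreover have "\<bar>real_of_int p\<bar> + \<bar>of_int q\<bar> \<le> 2 * (sqrt (bra p) * sqrt (bra q) * sqrt (bra ?r))"
        using le abs_le_sqrt_bra[of p] abs_le_sqrt_bra[of q] by linarith
      ultimately have "(\<bar>real_of_int p\<bar> + \<bar>of_int q\<bar>) * (1 / \<bar>of_int k\<bar>) \<le> (2 * (sqrt (bra p) * sqrt (bra q) * sqrt (bra ?r))) * (3/2 / sqrt (bra k))"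
        by (intro mult_mono) auto
      then show "(\<bar>real_of_int p\<bar> + \<bar>of_int q\<bar>) / \<bar>of_int k\<bar> \<le> (2 * (sqrt (bra p) * sqrt (bra q) * sqrt (bra ?r))) * (3/2 / sqrt (bra k))"
        by simp
    qed
    also have "\<dots> = 3 * c * sqrt (bra p * bra q * bra ?r / bra k)" unfolding mu by simp
    finally show ?thesis .
  qed
qed

text \<open>By \<open>oint_mult\<close> each \<open>osc - 1\<close> contains its phase as a factor,
  which cancels one denominator: the inverse derivatives of the scheme are exact time integrals. At
  \<open>q = k\<close> the convention \<open>msym 0 = 0\<close> deletes a term that the integral
  would have; this resonant gap is what \<open>theta\<close> has to fill.\<close>

lemma mpsi_eq:
  assumes "k \<noteq> 0"
  shows "mpsi t k p q = \<i> * (of_int p / of_int k) * oint t (2 * of_int k * of_int p)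
     - (if q = k then 0 else \<i> * (2 * of_int (p + q) / of_int k) * oint t (phi k p q))"
proof -
  have k: "of_int k \<noteq> (0::complex)" using assms by simp
  have 1: "(1/2) * (msym k)\<^sup>2 * (osc t (2 * of_int k * of_int p) - 1) = - (\<i> * (of_int p / of_int k) * oint t (2 * of_int k * of_int p))"
    unfolding oint_mult[symmetric] using k assms by (simp add: msym_def power2_eq_square field_simps)
  have 2: "msym k * msym (k - q) * (osc t (phi k p q) - 1) = - (if q = k then 0 else \<i> * (2 * of_int (p + q) / of_int k) * oint t (phi k p q))"
  proof (cases "q = k")
    case False
    then have kq: "of_int k - of_int q \<noteq> (0::complex)" by (simp flip: of_int_diff)
    show ?thesis
      unfolding oint_mult[symmetric] using k kq assms False by (simp add: msym_def phi_def field_simps)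
  qed (simp add: msym_def)
  show ?thesis unfolding mpsi_def 1 2 using assms by simp
qed

text \<open>Expressed through \<open>oint\<close> the multipliers are of size \<open>t\<close> and
  not merely bounded, which makes the cubic part a perturbation of order \<open>t\<close> in the
  stability estimate. The inner \<open>3\<close> bounds the numerator
  \<open>3 |p| + 2 |q|\<close>.\<close>

lemma mbd_mpsi:
  assumes "0 \<le> t" shows "mbd (mpsi t) (9 * t)"
proof -
  have "mbd (mpsi t) (3 * (3 * t))"
  proof (rule mbd_ratio1)
    fix k p q :: int assume "k = 0"
    then show "cmod (mpsi t k p q) \<le> 3 * t" using assms by (simp add: mpsi_def msym_def norm_mult)
  next
    fix k p q :: int assume k: "k \<noteq> 0"
    have "cmod (mpsi t k p q) \<le> cmod (\<i> * (of_int p / of_int k) * oint t (2 * of_int k * of_int p))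
       + cmod (if q = k then 0 else \<i> * (2 * of_int (p + q) / of_int k) * oint t (phi k p q))"
      unfolding mpsi_eq[OF k] by (rule norm_triangle_ineq4)
    also have "cmod (\<i> * (of_int p / of_int k) * oint t (2 * of_int k * of_int p)) \<le> \<bar>of_int p\<bar> / \<bar>of_int k\<bar> * t"
      using norm_oint_le[OF assms] by (simp add: norm_mult norm_divide divide_right_mono mult_left_mono)
    also have "cmod (if q = k then 0 else \<i> * (2 * of_int (p + q) / of_int k) * oint t (phi k p q))
       \<le> cmod (\<i> * (2 * of_int (p + q) / of_int k) * oint t (phi k p q))"
      by simp
    also have "\<dots> = 2 * \<bar>of_int (p + q)\<bar> / \<bar>of_int k\<bar> * cmod (oint t (phi k p q))"
      unfolding norm_mult norm_divide norm_of_int by simp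
    also have "\<dots> \<le> 2 * (\<bar>of_int p\<bar> + \<bar>of_int q\<bar>) / \<bar>of_int k\<bar> * t"
      using norm_oint_le[OF assms] by (intro mult_mono divide_right_mono) auto
    finally have "cmod (mpsi t k p q) \<le> \<bar>of_int p\<bar> / \<bar>of_int k\<bar> * t + 2 * (\<bar>of_int p\<bar> + \<bar>of_int q\<bar>) / \<bar>of_int k\<bar> * t" by simp
    also have "\<dots> = (t / \<bar>of_int k\<bar>) * (3 * \<bar>of_int p\<bar> + 2 * \<bar>of_int q\<bar>)" by (simp add: add_divide_distrib algebra_simps)
    also have "\<dots> \<le> (t / \<bar>of_int k\<bar>) * (3 * (\<bar>of_int p\<bar> + \<bar>of_int q\<bar>))"
      using assms by (intro mult_left_mono) auto
    also have "\<dots> = 3 * t * ((\<bar>of_int p\<bar> + \<bar>of_int q\<bar>) / \<bar>of_int k\<bar>)" by simp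
    finally show "cmod (mpsi t k p q) \<le> 3 * t * ((\<bar>of_int p\<bar> + \<bar>of_int q\<bar>) / \<bar>of_int k\<bar>)" .
  qed (use assms in auto)
  then show ?thesis by simp
qed

lemma tsum_mbd:
  assumes "s > 3/2" "hbd s x A" "hbd s y B" "hbd s z C" "mbd m K"
  shows "tsum m x y z k"
  unfolding tsum_def by (rule abs_summable_summable[OF tri_summable[OF assms(1-4) mbdD[OF assms(5)]]])

lemma hbd_tri_mbd:
  assumes "s > 3/2" "hbd s x A" "hbd s y B" "hbd s z C" "mbd m K"
  shows "hbd s (tri m x y z) (K * tcon s * A * B * C)"
  by (rule hbd_tri[OF assms(1-4) mbdD[OF assms(5)]])

text \<open>Telescoping: the three slots are changed one at a time, and each change costs
  \<open>K * tcon s * R\<^sup>2 * D\<close>.\<close>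

lemma tri_diff:
  assumes s: "s > 3/2" and a: "hbd s a R" and b: "hbd s b R" and d: "hbd s (\<lambda>k. a k - b k) D" and m: "mbd m K"
  shows "hbd s (\<lambda>k. tri m (rcnj a) a a k - tri m (rcnj b) b b k) (3 * K * tcon s * R\<^sup>2 * D)"
proof -
  let ?d = "\<lambda>k. a k - b k"
  have rd: "rcnj ?d k = rcnj a k - rcnj b k" for k by (simp add: rcnj_def)
  note h = hbd_rcnj[OF a] hbd_rcnj[OF b] hbd_rcnj[OF d] a b d
  have "tri m (rcnj a) a a k - tri m (rcnj b) b b k
     = tri m (rcnj ?d) a a k + tri m (rcnj b) ?d a k + tri m (rcnj b) b ?d k" for k
  proof -
    have t: "(\<lambda>(p,q). m k p q * x p * y q * z (k-p-q)) summable_on UNIV" if "hbd s x A" "hbd s y B" "hbd s z C" for x y z A B C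
      using tsum_mbd[OF s that m] by (simp add: tsum_def)
    have "tri m (rcnj ?d) a a k + tri m (rcnj b) ?d a k + tri m (rcnj b) b ?d k + tri m (rcnj b) b b k
      = (\<Sum>\<^sub>\<infinity>g\<in>UNIV. (case g of (p,q) \<Rightarrow> m k p q * rcnj ?d p * a q * a (k-p-q)) + (case g of (p,q) \<Rightarrow> m k p q * rcnj b p * ?d q * a (k-p-q))
          + (case g of (p,q) \<Rightarrow> m k p q * rcnj b p * b q * ?d (k-p-q)) + (case g of (p,q) \<Rightarrow> m k p q * rcnj b p * b q * b (k-p-q)))"
      unfolding tri_def
      by (subst infsum_add, (intro summable_on_add t[OF h(3) h(4) h(4)] t[OF h(2) h(6) h(4)] t[OF h(2) h(5) h(6)] t[OF h(2) h(5) h(5)])+)+ (rule refl)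
    also have "\<dots> = tri m (rcnj a) a a k"
      unfolding tri_def by (rule infsum_cong) (auto simp: rd algebra_simps)
    finally show ?thesis by (simp only: diff_eq_eq)
  qed
  moreover have "hbd s (\<lambda>k. tri m (rcnj ?d) a a k + tri m (rcnj b) ?d a k + tri m (rcnj b) b ?d k)
     (K * tcon s * D * R * R + K * tcon s * R * D * R + K * tcon s * R * R * D)"
    by (intro hbd_add hbd_tri_mbd[OF s _ _ _ m] h)
  ultimately show ?thesis by (simp add: power2_eq_square algebra_simps)
qed

text \<open>The exponential multiplier is estimated by \<open>exp (t * Q)\<close> for arbitrary
  complex \<open>M\<close> and \<open>P\<close>; the second \<open>Q\<close> comes from the
  zero-mode correction, and \<open>27\<close> is the \<open>3\<close> of \<open>tri_diff\<close>
  times the \<open>9\<close> of \<open>mbd_mpsi\<close>.\<close>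

lemma psic_stable:
  assumes s: "s > 3/2" and t: "0 \<le> t" and a: "hbd s a R" and b: "hbd s b R" and d: "hbd s (\<lambda>k. a k - b k) D"
    and Q: "2 * (cmod M + cmod P) \<le> Q"
  shows "hbd s (\<lambda>k. psic t M P a k - psic t M P b k) ((exp (t * Q) + t * (Q + 27 * tcon s * R\<^sup>2)) * D)"
proof -
  have "hbd s (\<lambda>k. exp (\<i> * of_real t * theta M P k) * (a k - b k)) (exp (t * Q) * D)"
  proof (rule hbd_scale[OF d])
    fix k
    have "cmod (exp (\<i> * of_real t * theta M P k)) \<le> exp (cmod (\<i> * of_real t * theta M P k))" by (rule norm_exp)
    also have "\<dots> \<le> exp (t * Q)"
      using order_trans[OF norm_theta_le Q] t by (simp add: norm_mult mult_left_mono)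
    finally show "cmod (exp (\<i> * of_real t * theta M P k) * (a k - b k)) \<le> exp (t * Q) * cmod (a k - b k)"
      unfolding norm_mult by (rule mult_right_mono) auto
  qed simp
  moreover have "hbd s (\<lambda>k. if k = 0 then 2 * \<i> * of_real t * M * (a 0 - b 0) else 0) (t * Q * D)"
  proof (rule hbd_scale[OF d])
    have Q': "2 * cmod M \<le> Q" by (rule order_trans[OF _ Q]) simp
    then show "0 \<le> t * Q" using t norm_ge_zero[of M] by (intro mult_nonneg_nonneg) linarith+
    fix k
    have "2 * t * cmod M * cmod (a 0 - b 0) \<le> t * Q * cmod (a 0 - b 0)"
      using mult_left_mono[OF Q' t] by (intro mult_right_mono) auto
    then show "cmod (if k = 0 then 2 * \<i> * of_real t * M * (a 0 - b 0) else 0) \<le> t * Q * cmod (a k - b k)"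
      using t \<open>0 \<le> t * Q\<close> by (auto simp: norm_mult)
  qed
  moreover have "hbd s (\<lambda>k. tri (mpsi t) (rcnj a) a a k - tri (mpsi t) (rcnj b) b b k) (3 * (9 * t) * tcon s * R\<^sup>2 * D)"
    by (rule tri_diff[OF s a b d mbd_mpsi[OF t]])
  ultimately have "hbd s (\<lambda>k. exp (\<i> * of_real t * theta M P k) * (a k - b k) + (if k = 0 then 2 * \<i> * of_real t * M * (a 0 - b 0) else 0)
     + (tri (mpsi t) (rcnj a) a a k - tri (mpsi t) (rcnj b) b b k)) (exp (t * Q) * D + t * Q * D + 3 * (9 * t) * tcon s * R\<^sup>2 * D)"
    by (intro hbd_add)
  moreover have "exp (\<i> * of_real t * theta M P k) * (a k - b k) + (if k = 0 then 2 * \<i> * of_real t * M * (a 0 - b 0) else 0)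
     + (tri (mpsi t) (rcnj a) a a k - tri (mpsi t) (rcnj b) b b k) = psic t M P a k - psic t M P b k" for k
    by (simp add: psic_def algebra_simps)
  moreover have "exp (t * Q) * D + t * Q * D + 3 * (9 * t) * tcon s * R\<^sup>2 * D = (exp (t * Q) + t * (Q + 27 * tcon s * R\<^sup>2)) * D"
    by (simp add: algebra_simps)
  ultimately show ?thesis by (simp only:)
qed

subsection \<open>Mass and momentum\<close>

text \<open>The zeroth coefficient of the convolution for |u|^2, kept in the form in which the
  resonant terms of the trilinear sum produce it. As a number it is the square sum of the
  coefficients.\<close>

definition Mf :: "(int \<Rightarrow> complex) \<Rightarrow> complex" where
  "Mf a = (\<Sum>\<^sub>\<infinity>p\<in>UNIV. rcnj a p * a (- p))"

definition Pf :: "(int \<Rightarrow> complex) \<Rightarrow> complex" where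
  "Pf a = (\<Sum>\<^sub>\<infinity>p\<in>UNIV. \<i> * of_int p * rcnj a p * a (- p))"

text \<open>One factor is summed absolutely with its weight, the other is bounded by
  \<open>R\<close>. The admissible weight reaches \<open>sqrt (bra p)\<close>, so mass and momentum
  are treated together.\<close>

lemma weighted_pair_summable:
  assumes s: "s > 3/2" and a: "hbd s a R" and w: "\<And>p. cmod (w p) \<le> sqrt (bra p)"
  shows "(\<lambda>p. w p * rcnj a p * a (- p)) summable_on UNIV"
    and "cmod (\<Sum>\<^sub>\<infinity>p\<in>UNIV. w p * rcnj a p * a (- p)) \<le> sqrt (bsum (s - 1)) * R\<^sup>2"
proof -
  have R: "0 \<le> R" using hbd_nonneg[OF a] .
  have aR: "cmod (a j) \<le> R" for j
  proof -
    have "1 * cmod (a j) \<le> bra j powr (s/2) * cmod (a j)"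
      using s by (intro mult_right_mono ge_one_powr_ge_zero) auto
    then show ?thesis using hbd_coeff[OF a, of j] by simp
  qed
  have le: "cmod (w p * rcnj a p * a (- p)) \<le> (sqrt (bra p) * cmod (rcnj a p)) * R" for p
    unfolding norm_mult by (intro mult_mono w aR) auto
  have sm: "(\<lambda>p. (sqrt (bra p) * cmod (rcnj a p)) * R) summable_on UNIV"
    by (intro summable_on_cmult_left hbd_abs_summable_weighted[OF s hbd_rcnj[OF a]])
  have ab: "(\<lambda>p. cmod (w p * rcnj a p * a (- p))) summable_on UNIV"
    by (rule summable_on_comparison_test[OF sm le]) auto
  then show *: "(\<lambda>p. w p * rcnj a p * a (- p)) summable_on UNIV" by (rule abs_summable_summable)
  have "cmod (\<Sum>\<^sub>\<infinity>p\<in>UNIV. w p * rcnj a p * a (- p)) \<le> (\<Sum>\<^sub>\<infinity>p\<in>UNIV. (sqrt (bra p) * cmod (rcnj a p)) * R)"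
    by (rule norm_infsum_le[OF has_sum_infsum[OF *] has_sum_infsum[OF sm] le])
  also have "\<dots> \<le> (sqrt (bsum (s - 1)) * R) * R"
    unfolding infsum_cmult_left'
    by (intro mult_right_mono R infsum_le_finite_sums hbd_abs_summable_weighted[OF s hbd_rcnj[OF a]] hbd_sum_weighted[OF s hbd_rcnj[OF a]])
  finally show "cmod (\<Sum>\<^sub>\<infinity>p\<in>UNIV. w p * rcnj a p * a (- p)) \<le> sqrt (bsum (s - 1)) * R\<^sup>2"
    by (simp add: power2_eq_square mult_ac)
qed

lemma norm_Mf_Pf:
  assumes "s > 3/2" "hbd s a R"
  shows "cmod (Mf a) \<le> sqrt (bsum (s - 1)) * R\<^sup>2" "cmod (Pf a) \<le> sqrt (bsum (s - 1)) * R\<^sup>2"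
  using weighted_pair_summable(2)[OF assms, of "\<lambda>_. 1"] weighted_pair_summable(2)[OF assms, of "\<lambda>p. \<i> * of_int p"]
    abs_le_sqrt_bra by (simp_all add: Mf_def Pf_def norm_mult)

lemma M0_eq_Mf: "wien f a \<Longrightarrow> M0 f = Mf a"
  using wien_fcoef[OF wien_abs2, of f a] by (simp add: M0_def Pi0_def conv_def Mf_def)

lemma P0_eq_Pf:
  assumes s: "s > 3/2" and a: "hbd s a R" and w: "wien f a"
  shows "P0 f = Pf a"
proof -
  have "(\<lambda>k. cmod (\<i> * of_int k * rcnj a k)) summable_on UNIV"
    by (rule summable_on_comparison_test[OF hbd_abs_summable_weighted[OF s hbd_rcnj[OF a]]])
      (auto simp: norm_mult intro!: mult_right_mono abs_le_sqrt_bra)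
  then have "wien (dx (cnjf f)) (\<lambda>k. \<i> * of_int k * rcnj a k)"
    unfolding dx_def by (rule wien_fmult[OF wien_cnjf[OF w]])
  from wien_fcoef[OF wien_mult[OF w this]]
  have "P0 f = (\<Sum>\<^sub>\<infinity>j\<in>UNIV. a j * (\<i> * of_int (0 - j) * rcnj a (0 - j)))"
    by (simp add: P0_def Pi0_def conv_def)
  also have "\<dots> = Pf a"
    unfolding Pf_def by (rule infsum_reindex_bij_witness[of _ uminus uminus]) auto
  finally show ?thesis .
qed

subsection \<open>Consistency of the multipliers\<close>

text \<open>On \<open>q = k\<close> the third frequency is \<open>- p\<close>, so the double sum
  collapses to a line. There the weight is \<open>2 (p + k) / k = 2 + 2 p / k\<close>: the constant
  yields the mass, and \<open>p / k\<close>, which is \<open>msym k\<close> times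
  \<open>\<i> * p\<close>, yields the momentum.\<close>

lemma tri_resonant:
  assumes s: "s > 3/2" and a: "hbd s a R" and k: "k \<noteq> 0"
  shows "tri (\<lambda>k p q. if q = k then c * (2 * of_int (p + q) / of_int k) else 0) (rcnj a) a a k
     = - (c * theta (Mf a) (Pf a) k * a k)"
proof -
  let ?m = "\<lambda>k p q. if q = k then c * (2 * of_int (p + q) / of_int k) else 0"
  have k': "of_int k \<noteq> (0::complex)" using k by simp
  have "tri ?m (rcnj a) a a k = (\<Sum>\<^sub>\<infinity>(p,q)\<in>range (\<lambda>p. (p,k)). ?m k p q * rcnj a p * a q * a (k-p-q))"
    unfolding tri_def by (rule infsum_cong_neutral) (auto simp: image_iff)
  also have "\<dots> = (\<Sum>\<^sub>\<infinity>p\<in>UNIV. ?m k p k * rcnj a p * a k * a (k-p-k))"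
    by (subst infsum_reindex) (auto simp: inj_on_def o_def)
  also have "\<dots> = (\<Sum>\<^sub>\<infinity>p\<in>UNIV. (c * a k * 2) * (1 * rcnj a p * a (- p)) + (c * a k * (2 * msym k)) * (\<i> * of_int p * rcnj a p * a (- p)))"
  proof (rule infsum_cong)
    fix p
    show "?m k p k * rcnj a p * a k * a (k-p-k) = (c * a k * 2) * (1 * rcnj a p * a (- p)) + (c * a k * (2 * msym k)) * (\<i> * of_int p * rcnj a p * a (- p))"
      using k k' by (simp add: msym_def field_simps)
  qed
  also have "\<dots> = (\<Sum>\<^sub>\<infinity>p\<in>UNIV. (c * a k * 2) * (1 * rcnj a p * a (- p))) + (\<Sum>\<^sub>\<infinity>p\<in>UNIV. (c * a k * (2 * msym k)) * (\<i> * of_int p * rcnj a p * a (- p)))"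
    by (intro infsum_add summable_on_cmult_right weighted_pair_summable[OF s a]) (auto simp: norm_mult abs_le_sqrt_bra)
  also have "\<dots> = (c * a k * 2) * Mf a + (c * a k * (2 * msym k)) * Pf a"
    unfolding infsum_cmult_right' by (simp add: Mf_def Pf_def)
  finally show ?thesis by (simp add: theta_def algebra_simps)
qed

definition mrem :: "real \<Rightarrow> int \<Rightarrow> int \<Rightarrow> int \<Rightarrow> complex" where
  "mrem t k p q = (if k = 0 then \<i> * (oint t (phi k p q) - of_real t)
     else \<i> * (of_int p / of_int k) * (oint t (2 * of_int k * of_int p) - oint t (phi k p q)))"

lemma mbd_mrem:
  assumes "0 \<le> t" shows "mbd (mrem t) (sqrt 2 * (2 * t\<^sup>2))"
proof (rule mbd_ratio)
  fix k p q :: int assume k: "k = 0"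
  have "cmod (mrem t k p q) = cmod (oint t (phi k p q) - oint t 0)" using k by (simp add: mrem_def norm_mult)
  also have "\<dots> \<le> t\<^sup>2 * \<bar>phi k p q - 0\<bar>" by (rule norm_oint_diff[OF assms])
  also have "phi k p q - 0 = 2 * (of_int q * of_int (k - p - q))" using k by (simp add: phi_def algebra_simps)
  finally show "cmod (mrem t k p q) \<le> 2 * t\<^sup>2 * (\<bar>of_int q\<bar> * \<bar>of_int (k-p-q)\<bar>)" by (simp add: abs_mult)
next
  fix k p q :: int assume k: "k \<noteq> 0"
  have "cmod (mrem t k p q) = \<bar>of_int p\<bar> / \<bar>of_int k\<bar> * cmod (oint t (2 * of_int k * of_int p) - oint t (phi k p q))"
    using k by (simp add: mrem_def norm_mult norm_divide)
  also have "\<dots> \<le> \<bar>of_int p\<bar> / \<bar>of_int k\<bar> * (t\<^sup>2 * \<bar>2 * of_int k * of_int p - phi k p q\<bar>)"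
    by (intro mult_left_mono norm_oint_diff assms) auto
  also have "2 * of_int k * of_int p - phi k p q = - (2 * (of_int q * of_int (k - p - q)))"
    by (simp add: phi_def algebra_simps)
  finally show "cmod (mrem t k p q) \<le> 2 * t\<^sup>2 * (\<bar>of_int p\<bar> * \<bar>of_int q\<bar> * \<bar>of_int (k-p-q)\<bar> / \<bar>of_int k\<bar>)"
    by (simp add: abs_mult mult_ac del: of_int_diff)
qed simp

lemma mbd_oint: "0 \<le> t \<Longrightarrow> mbd (\<lambda>k p q. oint t (phi k p q)) (3 * t)"
  by (rule mbd_bounded) (rule norm_oint_le)

lemma mbd_osc: "mbd (\<lambda>k p q. osc t (phi k p q)) 3"
  using mbd_bounded[of "\<lambda>k p q. osc t (phi k p q)" 1] by simp

lemma mbd_one: "mbd (\<lambda>k p q. 1) 3"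
  using mbd_bounded[of "\<lambda>k p q. 1" 1] by simp

lemma tsum_cong: "(\<And>p q. m k p q = m' k p q) \<Longrightarrow> tsum m x y z k = tsum m' x y z k"
  by (simp add: tsum_def)

lemma tsum_scale: "tsum m x y z k \<Longrightarrow> tsum (\<lambda>k p q. c k * m k p q) x y z k"
  unfolding tsum_def using summable_on_cmult_right[of "\<lambda>(p,q). m k p q * x p * y q * z (k-p-q)" UNIV "c k"]
  by (simp add: case_prod_unfold mult.assoc)

text \<open>The symmetry \<open>q \<leftrightarrow> k - p - q\<close> turns \<open>2 (p + q) / k\<close> into \<open>1 + p / k\<close>, so that the
  multipliers of the scheme add up to the exact one except for the factor \<open>p / k\<close>, where
  the phase is replaced by \<open>2 k p\<close>.\<close>
lemma tri_symmetrize: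
  assumes s: "s > 3/2" and a: "hbd s a R" and t: "0 \<le> t"
  shows "tri (\<lambda>k p q. if k = 0 then 0 else (2 * of_int (p + q) / of_int k) * oint t (phi k p q)) (rcnj a) a a k
       = tri (\<lambda>k p q. if k = 0 then 0 else (1 + of_int p / of_int k) * oint t (phi k p q)) (rcnj a) a a k"
    and "tsum (\<lambda>k p q. if k = 0 then 0 else (2 * of_int (p + q) / of_int k) * oint t (phi k p q)) (rcnj a) a a k"
    and "tsum (\<lambda>k p q. if k = 0 then 0 else (1 + of_int p / of_int k) * oint t (phi k p q)) (rcnj a) a a k"
proof -
  define m1 where "m1 k p q = (if k = 0 then 0 else (2 * of_int (p + q) / of_int k) * oint t (phi k p q))" for k p q :: int
  define m2 where "m2 k p q = m1 k p (k-p-q)" for k p q :: int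
  define m3 where "m3 k p q = (if k = 0 then 0 else (1 + of_int p / of_int k) * oint t (phi k p q))" for k p q :: int
  note ca = hbd_rcnj[OF a]
  have "mbd m1 (3 * (2 * t))"
  proof (rule mbd_ratio1)
    fix k p q :: int assume k: "k \<noteq> 0"
    have "cmod (m1 k p q) = 2 * \<bar>of_int (p + q)\<bar> / \<bar>of_int k\<bar> * cmod (oint t (phi k p q))"
      unfolding m1_def using k by (simp add: norm_mult norm_divide flip: of_int_add)
    also have "\<dots> \<le> 2 * (\<bar>of_int p\<bar> + \<bar>of_int q\<bar>) / \<bar>of_int k\<bar> * t"
      using norm_oint_le[OF t] by (intro mult_mono divide_right_mono) auto
    finally show "cmod (m1 k p q) \<le> 2 * t * ((\<bar>of_int p\<bar> + \<bar>of_int q\<bar>) / \<bar>of_int k\<bar>)" by (simp add: algebra_simps)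
  qed (use t in \<open>auto simp: m1_def\<close>)
  then have s1: "tsum m1 (rcnj a) a a k" by (rule tsum_mbd[OF s ca a a])
  have eq: "tri m1 (rcnj a) a a k = tri m2 (rcnj a) a a k"
    unfolding m2_def by (rule tri_swap23)
  have s2: "tsum m2 (rcnj a) a a k"
  proof -
    have "tsum m2 (rcnj a) a a k = tsum m1 (rcnj a) a a k" unfolding tsum_def m2_def
      by (rule summable_on_reindex_bij_witness[of _ "\<lambda>(p,q). (p, k-p-q)" "\<lambda>(p,q). (p, k-p-q)"]) (auto simp: mult_ac)
    then show ?thesis using s1 by simp
  qed
  have phi_sym: "phi k p (k-p-q) = phi k p q" for p q by (simp add: phi_alt)
  have avg: "m1 k p q + m2 k p q = 2 * m3 k p q" for p q
  proof (cases "k = 0")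
    case False
    then have "2 * of_int (p + q) / of_int k + 2 * of_int (p + (k-p-q)) / of_int k = 2 * (1 + of_int p / (of_int k :: complex))"
      by (simp add: field_simps)
    then show ?thesis using False
      unfolding m2_def m1_def m3_def phi_sym by (simp only: if_False distrib_right[symmetric] mult.assoc[symmetric])
  qed (simp add: m1_def m2_def m3_def)
  have "2 * tri m1 (rcnj a) a a k = tri m1 (rcnj a) a a k + tri m2 (rcnj a) a a k" using eq by simp
  also have "\<dots> = tri (\<lambda>k p q. m1 k p q + m2 k p q) (rcnj a) a a k" by (rule tri_add(1)[OF s1 s2])
  also have "\<dots> = tri (\<lambda>k p q. 2 * m3 k p q) (rcnj a) a a k"
    by (rule tri_cong) (rule avg)
  also have "\<dots> = 2 * tri m3 (rcnj a) a a k" by (rule tri_scale[symmetric])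
  finally show "tri m1 (rcnj a) a a k = tri m3 (rcnj a) a a k" by simp
  show "tsum m1 (rcnj a) a a k" by (rule s1)
  have "tsum (\<lambda>k p q. (1/2) * (m1 k p q + m2 k p q)) (rcnj a) a a k"
    by (rule tsum_scale[OF tri_add(2)[OF s1 s2]])
  also have "?this = tsum m3 (rcnj a) a a k"
    by (rule tsum_cong) (simp add: avg)
  finally show "tsum m3 (rcnj a) a a k" .
qed

text \<open>The left side is the step minus its first Duhamel iterate
  \<open>a - \<i> * tri oint\<close>. The resonant terms absent from \<open>mpsi\<close> equal the
  first-order part of the exponential, so only the second-order remainder of the exponential and
  \<open>mrem\<close> survive.\<close>

lemma psic_expansion:
  assumes s: "s > 3/2" and a: "hbd s a R" and t: "0 \<le> t"
  shows "psic t (Mf a) (Pf a) a k + \<i> * tri (\<lambda>k p q. oint t (phi k p q)) (rcnj a) a a k - a k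
     = (exp (\<i> * of_real t * theta (Mf a) (Pf a) k) - 1 - \<i> * of_real t * theta (Mf a) (Pf a) k) * a k
       + tri (mrem t) (rcnj a) a a k"
proof -
  define th where "th = theta (Mf a) (Pf a) k"
  note ca = hbd_rcnj[OF a]
  note ts = tsum_mbd[OF s ca a a]
  have so: "tsum (\<lambda>k p q. \<i> * oint t (phi k p q)) (rcnj a) a a k" by (rule tsum_scale[OF ts[OF mbd_oint[OF t]]])
  have io: "\<i> * tri (\<lambda>k p q. oint t (phi k p q)) (rcnj a) a a k = tri (\<lambda>k p q. \<i> * oint t (phi k p q)) (rcnj a) a a k"
    by (rule tri_scale)
  have sum: "tri (mpsi t) (rcnj a) a a k + \<i> * tri (\<lambda>k p q. oint t (phi k p q)) (rcnj a) a a k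
      = tri (\<lambda>k p q. mpsi t k p q + \<i> * oint t (phi k p q)) (rcnj a) a a k"
    and ssum: "tsum (\<lambda>k p q. mpsi t k p q + \<i> * oint t (phi k p q)) (rcnj a) a a k"
    unfolding io by (rule tri_add[OF ts[OF mbd_mpsi[OF t]] so])+
  show ?thesis
  proof (cases "k = 0")
    case True
    have "tri (\<lambda>k p q. mpsi t k p q + \<i> * oint t (phi k p q)) (rcnj a) a a k = tri (mrem t) (rcnj a) a a k"
      by (rule tri_cong) (simp add: mpsi_def mrem_def True msym_def algebra_simps)
    \<comment> \<open>At \<open>k = 0\<close> the value of \<open>theta\<close> is
      \<open>- 2 M\<close>, so the term \<open>2 \<i> t M a 0\<close> of the scheme cancels the
      first-order part of the exponential: the zero mode has no resonant gap to fill.\<close>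
    then show ?thesis
      using sum True by (simp add: psic_def theta_def msym_def algebra_simps)
  next
    case False
    define m1 where "m1 k p q = (if k = 0 then 0 else (2 * of_int (p + q) / of_int k) * oint t (phi k p q))" for k p q :: int
    define m3 where "m3 k p q = (if k = 0 then 0 else (1 + of_int p / of_int k) * oint t (phi k p q))" for k p q :: int
    define mr where "mr k p q = (if q = k then complex_of_real t * (2 * of_int (p + q) / of_int k) else 0)" for k p q :: int
    have m13: "tri m1 (rcnj a) a a k = tri m3 (rcnj a) a a k" and s1: "tsum m1 (rcnj a) a a k" and s3: "tsum m3 (rcnj a) a a k"
      using tri_symmetrize[OF s a t, of k] unfolding m1_def[abs_def] m3_def[abs_def] by simp_all
    have res: "tri mr (rcnj a) a a k = - (of_real t * th * a k)"
      unfolding mr_def[abs_def] th_def by (rule tri_resonant[OF s a False])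
    \<comment> \<open>At \<open>q = k\<close> the phase vanishes and \<open>oint\<close> equals
      \<open>t\<close>; there \<open>m1\<close> has a term that \<open>mpsi\<close> lacks, and
      \<open>mr\<close> accounts for it.\<close>
    have key: "(mpsi t k p q + \<i> * oint t (phi k p q)) + \<i> * m1 k p q = mrem t k p q + \<i> * m3 k p q + \<i> * mr k p q" for p q
    proof (cases "q = k")
      case True
      then have "oint t (phi k p q) = of_real t" by (simp add: phi_def)
      then show ?thesis using False True unfolding mpsi_eq[OF False] by (simp add: m1_def m3_def mr_def mrem_def algebra_simps)
    next
      case f: False
      then show ?thesis using False unfolding mpsi_eq[OF False] by (simp add: m1_def m3_def mr_def mrem_def algebra_simps)
    qed
    have s1': "tsum (\<lambda>k p q. \<i> * m1 k p q) (rcnj a) a a k" by (rule tsum_scale[OF s1])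
    have sr: "tsum (mrem t) (rcnj a) a a k" by (rule ts[OF mbd_mrem[OF t]])
    have s3': "tsum (\<lambda>k p q. \<i> * m3 k p q) (rcnj a) a a k" by (rule tsum_scale[OF s3])
    have "mbd mr (3 * (2 * t))"
    proof (rule mbd_ratio1)
      fix k p q :: int assume k: "k \<noteq> 0"
      have "cmod (mr k p q) \<le> t * (2 * \<bar>of_int (p + q)\<bar> / \<bar>of_int k\<bar>)"
        unfolding mr_def using t by (simp add: norm_mult norm_divide flip: of_int_add)
      also have "\<dots> \<le> t * (2 * (\<bar>of_int p\<bar> + \<bar>of_int q\<bar>) / \<bar>of_int k\<bar>)"
        using t by (intro mult_left_mono divide_right_mono) auto
      finally show "cmod (mr k p q) \<le> 2 * t * ((\<bar>of_int p\<bar> + \<bar>of_int q\<bar>) / \<bar>of_int k\<bar>)" by (simp add: algebra_simps)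
    qed (use t in \<open>auto simp: mr_def\<close>)
    then have sm': "tsum (\<lambda>k p q. \<i> * mr k p q) (rcnj a) a a k" by (intro tsum_scale ts)
    have "tri (\<lambda>k p q. mpsi t k p q + \<i> * oint t (phi k p q)) (rcnj a) a a k + tri (\<lambda>k p q. \<i> * m1 k p q) (rcnj a) a a k
       = tri (\<lambda>k p q. mpsi t k p q + \<i> * oint t (phi k p q) + \<i> * m1 k p q) (rcnj a) a a k"
      by (rule tri_add(1)[OF ssum s1'])
    also have "\<dots> = tri (\<lambda>k p q. mrem t k p q + \<i> * m3 k p q + \<i> * mr k p q) (rcnj a) a a k"
      by (rule tri_cong) (rule key)
    also have "\<dots> = tri (mrem t) (rcnj a) a a k + tri (\<lambda>k p q. \<i> * m3 k p q) (rcnj a) a a k + tri (\<lambda>k p q. \<i> * mr k p q) (rcnj a) a a k"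
      unfolding tri_add(1)[OF sr s3'] by (rule tri_add(1)[OF tri_add(2)[OF sr s3'] sm', symmetric])
    finally have "tri (\<lambda>k p q. mpsi t k p q + \<i> * oint t (phi k p q)) (rcnj a) a a k = tri (mrem t) (rcnj a) a a k - \<i> * of_real t * th * a k"
      unfolding tri_scale[symmetric] m13 res by simp
    with sum have "tri (mpsi t) (rcnj a) a a k = tri (mrem t) (rcnj a) a a k - \<i> * of_real t * th * a k
        - \<i> * tri (\<lambda>k p q. oint t (phi k p q)) (rcnj a) a a k"
      by (simp only: eq_diff_eq)
    then show ?thesis
      using False by (simp add: psic_def th_def algebra_simps)
  qed
qed

text \<open>Both terms of \<open>psic_expansion\<close> are of second order: the first by Taylor's
  formula for the exponential, the second by \<open>mbd_mrem\<close>. The restriction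
  \<open>t \<le> 1\<close> keeps the Taylor constant at \<open>exp Q\<close>.\<close>

lemma psic_local:
  assumes s: "s > 3/2" and a: "hbd s a R" and t: "0 \<le> t" "t \<le> 1"
    and Q: "2 * (cmod (Mf a) + cmod (Pf a)) \<le> Q"
  shows "hbd s (\<lambda>k. psic t (Mf a) (Pf a) a k + \<i> * tri (\<lambda>k p q. oint t (phi k p q)) (rcnj a) a a k - a k)
    (t\<^sup>2 * (exp Q * Q\<^sup>2 * R + 2 * sqrt 2 * tcon s * R * R * R))"
proof -
  note ca = hbd_rcnj[OF a]
  have Q0: "0 \<le> Q" by (rule order_trans[OF _ Q]) simp
  have "hbd s (\<lambda>k. (exp (\<i> * of_real t * theta (Mf a) (Pf a) k) - 1 - \<i> * of_real t * theta (Mf a) (Pf a) k) * a k)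
    (t\<^sup>2 * (exp Q * Q\<^sup>2) * R)"
  proof (rule hbd_scale[OF a])
    fix k
    define z where "z = \<i> * of_real t * theta (Mf a) (Pf a) k"
    have th: "cmod (theta (Mf a) (Pf a) k) \<le> Q" by (rule order_trans[OF norm_theta_le Q])
    then have z: "cmod z \<le> t * Q" using t by (simp add: z_def norm_mult mult_left_mono)
    have zQ: "cmod z \<le> Q" using z mult_right_mono[OF t(2) Q0] by simp
    have "cmod (exp z - (\<Sum>i\<le>1. z ^ i / fact i)) \<le> exp (cmod z) * (cmod z ^ Suc 1) / fact 1" by (rule Taylor_exp_field)
    then have "cmod (exp z - 1 - z) \<le> exp (cmod z) * (cmod z)\<^sup>2"
      by (simp add: power2_eq_square diff_diff_eq)
    also have "\<dots> \<le> exp Q * (t * Q)\<^sup>2"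
      using z zQ by (intro mult_mono power_mono) auto
    finally have "cmod (exp z - 1 - z) \<le> t\<^sup>2 * (exp Q * Q\<^sup>2)" by (simp add: power_mult_distrib mult_ac)
    then show "cmod ((exp (\<i> * of_real t * theta (Mf a) (Pf a) k) - 1 - \<i> * of_real t * theta (Mf a) (Pf a) k) * a k)
       \<le> t\<^sup>2 * (exp Q * Q\<^sup>2) * cmod (a k)"
      unfolding norm_mult z_def[symmetric] by (rule mult_right_mono) auto
  qed auto
  moreover have "hbd s (tri (mrem t) (rcnj a) a a) (sqrt 2 * (2 * t\<^sup>2) * tcon s * R * R * R)"
    by (rule hbd_tri_mbd[OF s ca a a mbd_mrem[OF t(1)]])
  ultimately have "hbd s (\<lambda>k. (exp (\<i> * of_real t * theta (Mf a) (Pf a) k) - 1 - \<i> * of_real t * theta (Mf a) (Pf a) k) * a k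
      + tri (mrem t) (rcnj a) a a k) (t\<^sup>2 * (exp Q * Q\<^sup>2) * R + sqrt 2 * (2 * t\<^sup>2) * tcon s * R * R * R)"
    by (rule hbd_add)
  moreover have "t\<^sup>2 * (exp Q * Q\<^sup>2) * R + sqrt 2 * (2 * t\<^sup>2) * tcon s * R * R * R = t\<^sup>2 * (exp Q * Q\<^sup>2 * R + 2 * sqrt 2 * tcon s * R * R * R)"
    by (simp add: algebra_simps)
  ultimately show ?thesis unfolding psic_expansion[OF s a t(1)] by (simp only:)
qed

subsection \<open>Conservation laws\<close>

text \<open>The quadruple sum is invariant under the exchanges \<open>k \<leftrightarrow> - p\<close> and \<open>q \<leftrightarrow> k - p - q\<close>, and
  conjugated by exchanging the two pairs; an additive weight therefore gives a real value.\<close>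
lemma quartic_real:
  fixes \<omega> :: "int \<Rightarrow> real"
  assumes s: "s > 3/2" and a: "hbd s a R" and w: "\<And>k. \<bar>\<omega> k\<bar> \<le> sqrt (bra k)"
    and add: "\<And>i j k l. i + j = k + l \<Longrightarrow> \<omega> i + \<omega> j = \<omega> k + \<omega> l"
  shows "cnj (\<Sum>\<^sub>\<infinity>k\<in>UNIV. of_real (\<omega> k) * cnj (a k) * tri (\<lambda>k p q. 1) (rcnj a) a a k)
     = (\<Sum>\<^sub>\<infinity>k\<in>UNIV. of_real (\<omega> k) * cnj (a k) * tri (\<lambda>k p q. 1) (rcnj a) a a k)"
proof -
  define G where "G = (\<lambda>(k, p, q). cnj (a k) * rcnj a p * a q * a (k-p-q))"
  define H where "H g = of_real (\<omega> (fst g)) * G g" for g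
  \<comment> \<open>The moduli satisfy the same \<open>hbd\<close> bound as \<open>a\<close>, so the
    trilinear estimate applied to them yields absolute convergence of the whole sum over
    \<open>(k, p, q)\<close>, which the exchanges of summation below require.\<close>
  define b where "b k = complex_of_real (cmod (a k))" for k
  have b: "hbd s b R" by (rule hbd_cong_cmod[OF a]) (simp add: b_def)
  have nb: "cmod (tri (\<lambda>k p q. 1) (rcnj b) b b k) \<le> 3 * tcon s * R * R * R" for k
  proof -
    have "bra k powr (s/2) * cmod (tri (\<lambda>k p q. 1) (rcnj b) b b k) \<le> 3 * tcon s * R * R * R"
      by (rule hbd_coeff[OF hbd_tri_mbd[OF s hbd_rcnj[OF b] b b mbd_one]])
    moreover have "1 * cmod (tri (\<lambda>k p q. 1) (rcnj b) b b k) \<le> bra k powr (s/2) * cmod (tri (\<lambda>k p q. 1) (rcnj b) b b k)"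
      using s by (intro mult_right_mono ge_one_powr_ge_zero) auto
    ultimately show ?thesis by simp
  qed
  have row: "((\<lambda>g. cmod (H (k, g))) has_sum (\<bar>\<omega> k\<bar> * cmod (a k) * cmod (tri (\<lambda>k p q. 1) (rcnj b) b b k))) UNIV" for k
  proof -
    have sm: "(\<lambda>g. norm (case g of (p,q) \<Rightarrow> 1 * rcnj b p * b q * b (k-p-q))) summable_on UNIV"
      by (rule tri_summable[OF s hbd_rcnj[OF b] b b mbdD[OF mbd_one]])
    have eq: "(case g of (p,q) \<Rightarrow> 1 * rcnj b p * b q * b (k-p-q)) = of_real (norm (case g of (p,q) \<Rightarrow> 1 * rcnj b p * b q * b (k-p-q)))" for g :: "int \<times> int"
      by (cases g) (simp add: b_def rcnj_def norm_mult)
    have "tri (\<lambda>k p q. 1) (rcnj b) b b k = of_real (\<Sum>\<^sub>\<infinity>g\<in>UNIV. norm (case g of (p,q) \<Rightarrow> 1 * rcnj b p * b q * b (k-p-q)))"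
      unfolding tri_def by (rule trans[OF infsum_cong[OF eq] infsumI[OF has_sum_of_real[OF has_sum_infsum[OF sm]]]])
    then have n: "cmod (tri (\<lambda>k p q. 1) (rcnj b) b b k) = (\<Sum>\<^sub>\<infinity>g\<in>UNIV. norm (case g of (p,q) \<Rightarrow> 1 * rcnj b p * b q * b (k-p-q)))"
      by (simp add: infsum_nonneg)
    have "((\<lambda>g. (\<bar>\<omega> k\<bar> * cmod (a k)) * norm (case g of (p,q) \<Rightarrow> 1 * rcnj b p * b q * b (k-p-q))) has_sum
        (\<bar>\<omega> k\<bar> * cmod (a k)) * cmod (tri (\<lambda>k p q. 1) (rcnj b) b b k)) UNIV"
      unfolding n by (rule has_sum_cmult_right[OF has_sum_infsum[OF sm]])
    moreover have "(\<bar>\<omega> k\<bar> * cmod (a k)) * norm (case g of (p,q) \<Rightarrow> 1 * rcnj b p * b q * b (k-p-q)) = cmod (H (k, g))" for g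
      by (cases g) (simp add: H_def G_def norm_mult b_def rcnj_def)
    ultimately show ?thesis by simp
  qed
  have "(\<lambda>g. cmod (H g)) summable_on UNIV \<times> UNIV"
  proof (rule summable_on_SigmaI)
    show "((\<lambda>y. cmod (H (x, y))) has_sum \<bar>\<omega> x\<bar> * cmod (a x) * cmod (tri (\<lambda>k p q. 1) (rcnj b) b b x)) UNIV" for x
      by (rule row)
    show "(\<lambda>k. \<bar>\<omega> k\<bar> * cmod (a k) * cmod (tri (\<lambda>k p q. 1) (rcnj b) b b k)) summable_on UNIV"
      by (rule summable_on_comparison_test[OF summable_on_cmult_left[OF hbd_abs_summable_weighted[OF s a], of "3 * tcon s * R * R * R"]])
        (auto intro!: mult_mono w nb)
  qed auto
  then have sH: "H summable_on UNIV \<times> UNIV" by (rule abs_summable_summable)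
  define X where "X = infsum H UNIV"
  have X: "(H has_sum X) UNIV" using has_sum_infsum[OF sH] by (simp add: X_def)
  have X_eq: "X = (\<Sum>\<^sub>\<infinity>k\<in>UNIV. of_real (\<omega> k) * cnj (a k) * tri (\<lambda>k p q. 1) (rcnj a) a a k)"
  proof -
    have "X = (\<Sum>\<^sub>\<infinity>k\<in>UNIV. \<Sum>\<^sub>\<infinity>g\<in>UNIV. H (k, g))"
      using infsum_Sigma_banach[OF sH] by (simp add: X_def)
    also have "\<dots> = (\<Sum>\<^sub>\<infinity>k\<in>UNIV. of_real (\<omega> k) * cnj (a k) * tri (\<lambda>k p q. 1) (rcnj a) a a k)"
      unfolding tri_def infsum_cmult_right'[symmetric]
      by (intro infsum_cong) (auto simp: H_def G_def case_prod_unfold mult_ac)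
    finally show ?thesis .
  qed
  have X1: "((\<lambda>(k,p,q). of_real (\<omega> (-p)) * G (k,p,q)) has_sum X) UNIV"
  proof -
    have "((\<lambda>(k,p,q). of_real (\<omega> (-p)) * G (k,p,q)) has_sum X) UNIV = (H has_sum X) UNIV"
      by (rule has_sum_reindex_bij_witness[of _ "\<lambda>(k,p,q). (-p,-k,q)" "\<lambda>(k,p,q). (-p,-k,q)"])
        (auto simp: H_def G_def rcnj_def mult_ac algebra_simps)
    then show ?thesis using X by simp
  qed
  have X2: "((\<lambda>(k,p,q). of_real (\<omega> q) * G (k,p,q)) has_sum cnj X) UNIV"
  proof -
    have "((\<lambda>(k,p,q). cnj (of_real (\<omega> q) * G (k,p,q))) has_sum X) UNIV = (H has_sum X) UNIV"
      by (rule has_sum_reindex_bij_witness[of _ "\<lambda>(k,p,q). (q,-(k-p-q),k)" "\<lambda>(k,p,q). (q,-(k-p-q),k)"])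
        (auto simp: H_def G_def rcnj_def mult_ac algebra_simps)
    then have "((\<lambda>(k,p,q). cnj (of_real (\<omega> q) * G (k,p,q))) has_sum X) UNIV" using X by simp
    then have "((\<lambda>g. cnj (case g of (k,p,q) \<Rightarrow> of_real (\<omega> q) * G (k,p,q))) has_sum cnj (cnj X)) UNIV"
      by (simp add: case_prod_unfold)
    then show ?thesis by (simp only: has_sum_cnj_iff)
  qed
  have X3: "((\<lambda>(k,p,q). of_real (\<omega> (k-p-q)) * G (k,p,q)) has_sum cnj X) UNIV"
  proof -
    have "((\<lambda>(k,p,q). of_real (\<omega> (k-p-q)) * G (k,p,q)) has_sum cnj X) UNIV = ((\<lambda>(k,p,q). of_real (\<omega> q) * G (k,p,q)) has_sum cnj X) UNIV"
      by (rule has_sum_reindex_bij_witness[of _ "\<lambda>(k,p,q). (k,p,k-p-q)" "\<lambda>(k,p,q). (k,p,k-p-q)"])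
        (auto simp: G_def mult_ac)
    then show ?thesis using X2 by simp
  qed
  have A: "((\<lambda>g. H g + (case g of (k,p,q) \<Rightarrow> of_real (\<omega> (-p)) * G (k,p,q))) has_sum X + X) UNIV"
    by (rule has_sum_add[OF X X1])
  have B: "((\<lambda>g. (case g of (k,p,q) \<Rightarrow> of_real (\<omega> q) * G (k,p,q)) + (case g of (k,p,q) \<Rightarrow> of_real (\<omega> (k-p-q)) * G (k,p,q))) has_sum cnj X + cnj X) UNIV"
    by (rule has_sum_add[OF X2 X3])
  have C: "H g + (case g of (k,p,q) \<Rightarrow> of_real (\<omega> (-p)) * G (k,p,q))
     = (case g of (k,p,q) \<Rightarrow> of_real (\<omega> q) * G (k,p,q)) + (case g of (k,p,q) \<Rightarrow> of_real (\<omega> (k-p-q)) * G (k,p,q))" for g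
  proof -
    obtain k p q where g: "g = (k,p,q)" by (cases g) auto
    have "\<omega> k + \<omega> (-p) = \<omega> q + \<omega> (k-p-q)" by (rule add) simp
    then have "complex_of_real (\<omega> k) + of_real (\<omega> (-p)) = of_real (\<omega> q) + of_real (\<omega> (k-p-q))"
      by (simp flip: of_real_add)
    then show ?thesis unfolding g H_def prod.case fst_conv distrib_right[symmetric] by (simp only:)
  qed
  have "X + X = cnj X + cnj X" by (rule has_sum_unique[OF A[unfolded C] B])
  then have "cnj X = X" by simp
  then show ?thesis unfolding X_eq[symmetric] .
qed

definition nls_seq :: "real \<Rightarrow> real \<Rightarrow> real \<Rightarrow> (real \<Rightarrow> int \<Rightarrow> complex) \<Rightarrow> bool" where
  "nls_seq s T R a \<longleftrightarrow> (\<forall>t\<in>{0..T}. hbd s (a t) R) \<and>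
     (\<forall>k. \<forall>t\<in>{0..T}. ((\<lambda>r. a r k) has_vector_derivative
        (- \<i> * of_int (k^2) * a t k - \<i> * tri (\<lambda>k p q. 1) (rcnj (a t)) (a t) (a t) k)) (at t within {0..T}))"

text \<open>In the derivative of the weighted square sum the dispersive terms cancel, and the cubic
  ones leave \<open>- \<i>\<close> times the quartic sum minus its conjugate, which vanishes by
  \<open>quartic_real\<close>.\<close>

lemma conservation:
  fixes \<omega> :: "int \<Rightarrow> real"
  assumes s: "s > 3/2" and sol: "nls_seq s T R a" and w: "\<And>k. \<bar>\<omega> k\<bar> \<le> sqrt (bra k)"
    and add: "\<And>i j k l. i + j = k + l \<Longrightarrow> \<omega> i + \<omega> j = \<omega> k + \<omega> l" and t: "t \<in> {0..T}"
  shows "(\<Sum>\<^sub>\<infinity>k\<in>UNIV. of_real (\<omega> k) * (cnj (a t k) * a t k)) = (\<Sum>\<^sub>\<infinity>k\<in>UNIV. of_real (\<omega> k) * (cnj (a 0 k) * a 0 k))"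
proof -
  define N where "N t = tri (\<lambda>k p q. 1) (rcnj (a t)) (a t) (a t)" for t
  have h: "hbd s (a t) R" if "t \<in> {0..T}" for t using sol that by (simp add: nls_seq_def)
  have R: "0 \<le> R" using hbd_nonneg[OF h[OF t]] .
  have der: "((\<lambda>r. a r k) has_vector_derivative (- \<i> * of_int (k^2) * a t k - \<i> * N t k)) (at t within {0..T})" if "t \<in> {0..T}" for t k
    using sol that unfolding nls_seq_def N_def by blast
  define f' where "f' k t = of_real (\<omega> k) * (- \<i> * (cnj (a t k) * N t k - cnj (cnj (a t k) * N t k)))" for k t
  define Cn where "Cn = 3 * tcon s * R * R * R"
  have Cn: "0 \<le> Cn" unfolding Cn_def using R tcon_nonneg by simp
  have aN: "bra k powr (s/2) * cmod (a t k) \<le> R" "bra k powr (s/2) * cmod (N t k) \<le> Cn" if "t \<in> {0..T}" for t k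
  proof -
    show "bra k powr (s/2) * cmod (a t k) \<le> R" by (rule hbd_coeff[OF h[OF that]])
    show "bra k powr (s/2) * cmod (N t k) \<le> Cn" unfolding N_def Cn_def
      by (rule hbd_coeff[OF hbd_tri_mbd[OF s hbd_rcnj[OF h[OF that]] h[OF that] h[OF that] mbd_one]])
  qed
  have "((\<lambda>t. \<Sum>\<^sub>\<infinity>k\<in>UNIV. of_real (\<omega> k) * (cnj (a t k) * a t k)) has_vector_derivative (\<Sum>\<^sub>\<infinity>k\<in>UNIV. f' k t)) (at t within {0..T})"
    if t: "t \<in> {0..T}" for t
  \<comment> \<open>The solution and its cubic term both lie in \<open>H^s\<close>, which gives
    decay \<open>bra k powr (- s)\<close>, and the weight costs half a power; the exponent
    \<open>s - 1/2\<close> exceeds 1, hence the majorant is summable.\<close>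
  proof (rule has_vector_derivative_infsum[where b = "\<lambda>k. bra k powr (- (s - 1/2)) * (2 * R * Cn)"])
    fix k t assume t: "t \<in> {0..T}"
    have "((\<lambda>r. of_real (\<omega> k) * (cnj (a r k) * a r k)) has_vector_derivative
       of_real (\<omega> k) * (cnj (a t k) * (- \<i> * of_int (k^2) * a t k - \<i> * N t k) + cnj (- \<i> * of_int (k^2) * a t k - \<i> * N t k) * a t k)) (at t within {0..T})"
      by (intro has_vector_derivative_mult_right has_vector_derivative_mult der[OF t] bounded_linear.has_vector_derivative[OF bounded_linear_cnj der[OF t]])
    moreover have "of_real (\<omega> k) * (cnj (a t k) * (- \<i> * of_int (k^2) * a t k - \<i> * N t k) + cnj (- \<i> * of_int (k^2) * a t k - \<i> * N t k) * a t k) = f' k t"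
      by (simp add: f'_def algebra_simps)
    ultimately show "((\<lambda>r. of_real (\<omega> k) * (cnj (a r k) * a r k)) has_vector_derivative f' k t) (at t within {0..T})" by simp
    have "cmod (f' k t) \<le> \<bar>\<omega> k\<bar> * (2 * (cmod (a t k) * cmod (N t k)))"
    proof -
      have "cmod (cnj (a t k) * N t k - cnj (cnj (a t k) * N t k)) \<le> cmod (cnj (a t k) * N t k) + cmod (cnj (cnj (a t k) * N t k))"
        by (rule norm_triangle_ineq4)
      also have "\<dots> = 2 * (cmod (a t k) * cmod (N t k))" by (simp add: norm_mult)
      finally show ?thesis unfolding f'_def norm_mult by (simp add: mult_left_mono)
    qed
    also have "\<dots> \<le> sqrt (bra k) * (2 * (cmod (a t k) * cmod (N t k)))" by (intro mult_right_mono w) auto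
    also have "\<dots> = bra k powr (- (s - 1/2)) * (2 * ((bra k powr (s/2) * cmod (a t k)) * (bra k powr (s/2) * cmod (N t k))))"
    proof -
      have "sqrt (bra k) = bra k powr (- (s - 1/2)) * (bra k powr (s/2) * bra k powr (s/2))"
        by (simp add: powr_add[symmetric] powr_half_sqrt[symmetric] field_simps)
      then show ?thesis by simp
    qed
    also have "\<dots> \<le> bra k powr (- (s - 1/2)) * (2 * (R * Cn))"
      using aN[OF t, of k] R by (intro mult_left_mono mult_mono) auto
    finally show "cmod (f' k t) \<le> bra k powr (- (s - 1/2)) * (2 * R * Cn)" by simp
  next
    show "(\<lambda>k. bra k powr (- (s - 1/2)) * (2 * R * Cn)) summable_on UNIV"
      using s by (intro summable_on_cmult_left summable_bra_powr) auto
  next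
    fix t assume t: "t \<in> {0..T}"
    have "(\<lambda>p. of_real (\<omega> (-p)) * rcnj (a t) p * a t (- p)) summable_on UNIV"
      by (rule weighted_pair_summable[OF s h[OF t]]) (use w[of "- _"] in simp)
    also have "?this = ((\<lambda>k. of_real (\<omega> k) * (cnj (a t k) * a t k)) summable_on UNIV)"
      by (rule summable_on_reindex_bij_witness[of _ uminus uminus]) (auto simp: rcnj_def mult.assoc)
    finally show "(\<lambda>k. of_real (\<omega> k) * (cnj (a t k) * a t k)) summable_on UNIV" .
  qed (use t in auto)
  moreover have "(\<Sum>\<^sub>\<infinity>k\<in>UNIV. f' k t) = 0" if t: "t \<in> {0..T}" for t
  proof -
    define X where "X k = of_real (\<omega> k) * cnj (a t k) * N t k" for k
    have sX: "X summable_on UNIV"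
    proof (rule abs_summable_summable[OF summable_on_comparison_test])
      show "(\<lambda>k. sqrt (bra k) * cmod (a t k) * Cn) summable_on UNIV"
        by (intro summable_on_cmult_left hbd_abs_summable_weighted[OF s h[OF t]])
      fix k
      have "1 * cmod (N t k) \<le> bra k powr (s/2) * cmod (N t k)"
        using s by (intro mult_right_mono ge_one_powr_ge_zero) auto
      then have "cmod (N t k) \<le> Cn" using aN(2)[OF t, of k] by simp
      then show "cmod (X k) \<le> sqrt (bra k) * cmod (a t k) * Cn"
        unfolding X_def norm_mult by (intro mult_mono) (use w in auto)
    qed auto
    have "cnj (infsum X UNIV) = infsum X UNIV"
      using quartic_real[OF s h[OF t] w add] unfolding X_def[abs_def] N_def by simp
    moreover have "((\<lambda>k. - \<i> * (X k + - cnj (X k))) has_sum (- \<i> * (infsum X UNIV + - cnj (infsum X UNIV)))) UNIV"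
      by (intro has_sum_cmult_right has_sum_add has_sum_uminusI has_sum_infsum sX) (simp add: has_sum_infsum[OF sX])
    moreover have "- \<i> * (X k + - cnj (X k)) = f' k t" for k
      by (simp add: X_def f'_def algebra_simps)
    ultimately show ?thesis by (simp add: infsumI)
  qed
  ultimately have "((\<lambda>t. \<Sum>\<^sub>\<infinity>k\<in>UNIV. of_real (\<omega> k) * (cnj (a t k) * a t k)) has_vector_derivative 0) (at t within {0..T})"
    if "t \<in> {0..T}" for t using that by fastforce
  then obtain c where "\<And>t. t \<in> {0..T} \<Longrightarrow> (\<Sum>\<^sub>\<infinity>k\<in>UNIV. of_real (\<omega> k) * (cnj (a t k) * a t k)) = c"
    using has_vector_derivative_zero_constant[of "{0..T}"] by blast
  then show ?thesis using t by simp
qed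

text \<open>The weights \<open>1\<close> and \<open>k\<close> are additive along interactions. The
  scheme freezes mass and momentum at the initial datum, whereas the local error at time
  \<open>t\<close> involves those of the solution at \<open>t\<close>; conservation reconciles the
  two.\<close>

lemma Mf_Pf_conserved:
  assumes s: "s > 3/2" and sol: "nls_seq s T R a" and t: "t \<in> {0..T}"
  shows "Mf (a t) = Mf (a 0)" "Pf (a t) = Pf (a 0)"
proof -
  have M: "Mf b = (\<Sum>\<^sub>\<infinity>k\<in>UNIV. of_real 1 * (cnj (b k) * b k))" for b
    unfolding Mf_def by (rule infsum_reindex_bij_witness[of _ uminus uminus]) (auto simp: rcnj_def)
  have P: "Pf b = - \<i> * (\<Sum>\<^sub>\<infinity>k\<in>UNIV. of_real (of_int k) * (cnj (b k) * b k))" for b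
    unfolding Pf_def infsum_cmult_right'[symmetric]
    by (rule infsum_reindex_bij_witness[of _ uminus uminus]) (auto simp: rcnj_def)
  show "Mf (a t) = Mf (a 0)"
    unfolding M by (rule conservation[OF s sol _ _ t]) auto
  show "Pf (a t) = Pf (a 0)"
    unfolding P by (subst conservation[OF s sol _ _ t]) (auto simp: abs_le_sqrt_bra simp flip: of_int_add)
qed

subsection \<open>Local error\<close>

text \<open>Untwisting every factor leaves the single phase \<open>phi\<close>. In the untwisted
  variable the unbounded linear term disappears, so its time derivative is bounded in
  \<open>H^s\<close>.\<close>

lemma cubic_twist:
  "ek r k * tri (\<lambda>k p q. 1) (rcnj b) b b k
     = tri (\<lambda>k p q. osc r (phi k p q)) (rcnj (\<lambda>k. ek r k * b k)) (\<lambda>k. ek r k * b k) (\<lambda>k. ek r k * b k) k"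
proof -
  have "ek r k * tri (\<lambda>k p q. 1) (rcnj b) b b k = tri (\<lambda>k p q. ek r k * 1) (rcnj b) b b k" by (rule tri_scale)
  also have "\<dots> = tri (\<lambda>k p q. osc r (phi k p q)) (rcnj (\<lambda>k. ek r k * b k)) (\<lambda>k. ek r k * b k) (\<lambda>k. ek r k * b k) k"
    unfolding tri_def
  proof (rule infsum_cong, clarify)
    fix p q
    have "osc r (phi k p q) * (cnj (ek r p) * ek r q * ek r (k-p-q))
       = ek r k * (ek r p * cnj (ek r p)) * (ek r q * cnj (ek r q)) * (ek r (k-p-q) * cnj (ek r (k-p-q)))"
      unfolding osc_phi[symmetric] by (simp only: mult_ac)
    then have "osc r (phi k p q) * (cnj (ek r p) * ek r q * ek r (k-p-q)) = ek r k" by simp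
    then show "ek r k * 1 * rcnj b p * b q * b (k-p-q) = osc r (phi k p q) * rcnj (\<lambda>k. ek r k * b k) p * (ek r q * b q) * (ek r (k-p-q) * b (k-p-q))"
      by (simp add: rcnj_def mult_ac)
  qed
  finally show ?thesis .
qed

lemma tri_oint_has_vector_derivative:
  assumes s: "s > 3/2" and a: "hbd s a R" and r: "r \<in> {0..t}"
  shows "((\<lambda>r. tri (\<lambda>k p q. oint r (phi k p q)) (rcnj a) a a k) has_vector_derivative
     tri (\<lambda>k p q. osc r (phi k p q)) (rcnj a) a a k) (at r within {0..t})"
  unfolding tri_def
proof (rule has_vector_derivative_infsum[where b = "\<lambda>g. norm (case g of (p,q) \<Rightarrow> 1 * rcnj a p * a q * a (k-p-q))"])
  fix g :: "int \<times> int" and r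
  obtain p q where g: "g = (p,q)" by force
  show "((\<lambda>r. case g of (p,q) \<Rightarrow> oint r (phi k p q) * rcnj a p * a q * a (k-p-q)) has_vector_derivative
      (case g of (p,q) \<Rightarrow> osc r (phi k p q) * rcnj a p * a q * a (k-p-q))) (at r within {0..t})"
    unfolding g prod.case by (intro has_vector_derivative_mult_left oint_has_vector_derivative)
  show "norm (case g of (p,q) \<Rightarrow> osc r (phi k p q) * rcnj a p * a q * a (k-p-q)) \<le> norm (case g of (p,q) \<Rightarrow> 1 * rcnj a p * a q * a (k-p-q))"
    by (simp add: g norm_mult)
next
  show "(\<lambda>g. norm (case g of (p,q) \<Rightarrow> 1 * rcnj a p * a q * a (k-p-q))) summable_on UNIV"
    by (rule tri_summable[OF s hbd_rcnj[OF a] a a mbdD[OF mbd_one]])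
next
  fix r assume "r \<in> {0..t}"
  then have "0 \<le> r" by simp
  then show "(\<lambda>g. case g of (p,q) \<Rightarrow> oint r (phi k p q) * rcnj a p * a q * a (k-p-q)) summable_on UNIV"
    using tsum_mbd[OF s hbd_rcnj[OF a] a a mbd_oint] by (simp add: tsum_def)
qed (use r in auto)

text \<open>Second order in \<open>t\<close> comes from two applications of \<open>hbd_mvt\<close>:
  the untwisted solution stays within order \<open>r\<close> of its start, so the derivative of its
  deviation from the first Duhamel iterate is of order \<open>r\<close>. The coefficient
  \<open>27 * (tcon s)\<^sup>2 * R ^ 5\<close> is the Lipschitz constant of the cubic term times the
  bound on its size.\<close>

lemma local_error:
  assumes s: "s > 3/2" and sol: "nls_seq s T R a" and t0: "0 \<le> t0" and t: "0 \<le> t" "t \<le> 1" "t0 + t \<le> T"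
    and Q: "2 * (cmod (Mf (a t0)) + cmod (Pf (a t0))) \<le> Q"
  shows "hbd s (\<lambda>k. a (t0 + t) k - cnj (ek t k) * psic t (Mf (a t0)) (Pf (a t0)) (a t0) k)
    (t\<^sup>2 * (27 * (tcon s)\<^sup>2 * R ^ 5 + (exp Q * Q\<^sup>2 * R + 2 * sqrt 2 * tcon s * R * R * R)))"
proof -
  define b where "b = a t0"
  define v where "v r k = ek r k * a (t0 + r) k" for r k
  have b: "hbd s b R" using sol t0 t by (simp add: nls_seq_def b_def)
  have R: "0 \<le> R" by (rule hbd_nonneg[OF b])
  have v: "hbd s (v r) R" if "r \<in> {0..t}" for r
  proof (rule hbd_cong_cmod)
    show "hbd s (a (t0 + r)) R" using sol t0 t that by (simp add: nls_seq_def)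
  qed (simp add: v_def norm_mult)
  define V where "V r = tri (\<lambda>k p q. osc r (phi k p q)) (rcnj (v r)) (v r) (v r)" for r
  \<comment> \<open>The right end of the interval varies because \<open>hbd_mvt\<close> compares
    with the initial value at every intermediate time.\<close>
  have dv: "((\<lambda>r. v r k) has_vector_derivative - \<i> * V r k) (at r within {0..t'})" if r: "r \<in> {0..t'}" and t': "t' \<le> t" for r k t'
  proof -
    have "((\<lambda>x. a x k) has_vector_derivative (- \<i> * of_int (k^2) * a (t0 + r) k - \<i> * tri (\<lambda>k p q. 1) (rcnj (a (t0 + r))) (a (t0 + r)) (a (t0 + r)) k)) (at (t0 + r) within {0..T})"
      using sol r t t0 t' unfolding nls_seq_def by auto
    then have "((\<lambda>x. a x k) has_vector_derivative (- \<i> * of_int (k^2) * a (t0 + r) k - \<i> * tri (\<lambda>k p q. 1) (rcnj (a (t0 + r))) (a (t0 + r)) (a (t0 + r)) k)) (at (t0 + r) within (+) t0 ` {0..t'})"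
      by (rule has_vector_derivative_within_subset) (use t t0 t' in auto)
    moreover have "((\<lambda>x. t0 + x) has_vector_derivative 1) (at r within {0..t'})"
      by (auto intro!: derivative_eq_intros)
    ultimately have "((\<lambda>x. a (t0 + x) k) has_vector_derivative (- \<i> * of_int (k^2) * a (t0 + r) k - \<i> * tri (\<lambda>k p q. 1) (rcnj (a (t0 + r))) (a (t0 + r)) (a (t0 + r)) k)) (at r within {0..t'})"
      using vector_diff_chain_within[of "\<lambda>x. t0 + x" 1 r "{0..t'}" "\<lambda>x. a x k"]
      unfolding o_def scaleR_one by blast
    then have "((\<lambda>x. ek x k * a (t0 + x) k) has_vector_derivative
       ek r k * (- \<i> * of_int (k^2) * a (t0 + r) k - \<i> * tri (\<lambda>k p q. 1) (rcnj (a (t0 + r))) (a (t0 + r)) (a (t0 + r)) k)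
       + \<i> * of_real ((of_int k)\<^sup>2) * osc r ((of_int k)\<^sup>2) * a (t0 + r) k) (at r within {0..t'})"
      unfolding ek_def by (intro has_vector_derivative_mult osc_has_vector_derivative)
    moreover have "ek r k * (- \<i> * of_int (k^2) * a (t0 + r) k - \<i> * tri (\<lambda>k p q. 1) (rcnj (a (t0 + r))) (a (t0 + r)) (a (t0 + r)) k)
       + \<i> * of_real ((of_int k)\<^sup>2) * osc r ((of_int k)\<^sup>2) * a (t0 + r) k
       = - \<i> * (ek r k * tri (\<lambda>k p q. 1) (rcnj (a (t0 + r))) (a (t0 + r)) (a (t0 + r)) k)"
      by (simp add: ek_def algebra_simps)
    ultimately show ?thesis unfolding cubic_twist v_def[abs_def] V_def by simp
  qed
  have V: "hbd s (\<lambda>k. - \<i> * V r k) (3 * tcon s * R * R * R)" if "r \<in> {0..t}" for r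
  proof (rule hbd_cong_cmod)
    show "hbd s (V r) (3 * tcon s * R * R * R)"
      unfolding V_def using v[OF that] by (intro hbd_tri_mbd[OF s _ _ _ mbd_osc] hbd_rcnj)
  qed (simp add: norm_mult)
  have v0: "v 0 = b" by (simp add: v_def b_def fun_eq_iff)
  have vb: "hbd s (\<lambda>k. v r k - b k) (r * (3 * tcon s * R * R * R))" if r: "r \<in> {0..t}" for r
  proof -
    have "hbd s (\<lambda>k. v r k - v 0 k) (r * (3 * tcon s * R * R * R))"
      by (rule hbd_mvt[where x' = "\<lambda>r k. - \<i> * V r k"]) (use r dv V in auto)
    then show ?thesis by (simp add: v0)
  qed
  define J where "J r = tri (\<lambda>k p q. oint r (phi k p q)) (rcnj b) b b" for r
  define J' where "J' r = tri (\<lambda>k p q. osc r (phi k p q)) (rcnj b) b b" for r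
  \<comment> \<open>\<open>J\<close> is the exact time integral of the cubic term with its arguments
    frozen at \<open>b\<close>, so the derivative of this combination is the difference of a moving
    and a frozen cubic term.\<close>
  have "hbd s (\<lambda>k. (v t k + \<i> * J t k) - (v 0 k + \<i> * J 0 k)) (t * (27 * (tcon s)\<^sup>2 * R ^ 5 * t))"
  proof (rule hbd_mvt[where x = "\<lambda>r k. v r k + \<i> * J r k" and x' = "\<lambda>r k. - \<i> * V r k + \<i> * J' r k"])
    fix r k assume r: "r \<in> {0..t}"
    show "((\<lambda>r. v r k + \<i> * J r k) has_vector_derivative - \<i> * V r k + \<i> * J' r k) (at r within {0..t})"
      unfolding J_def J'_def
      by (intro has_vector_derivative_add has_vector_derivative_mult_right dv tri_oint_has_vector_derivative[OF s b r] r) simp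
  next
    fix r assume r: "r \<in> {0..t}"
    have "hbd s (\<lambda>k. V r k - J' r k) (3 * 3 * tcon s * R\<^sup>2 * (r * (3 * tcon s * R * R * R)))"
      unfolding V_def J'_def by (rule tri_diff[OF s v[OF r] b vb[OF r] mbd_osc])
    then have h: "hbd s (\<lambda>k. - \<i> * V r k + \<i> * J' r k) (3 * 3 * tcon s * R\<^sup>2 * (r * (3 * tcon s * R * R * R)))"
    proof (rule hbd_cong_cmod)
      fix k
      have "- \<i> * V r k + \<i> * J' r k = - \<i> * (V r k - J' r k)" by (simp add: algebra_simps)
      then show "cmod (- \<i> * V r k + \<i> * J' r k) = cmod (V r k - J' r k)" by (simp only: norm_mult) simp
    qed
    have "3 * 3 * tcon s * R\<^sup>2 * (r * (3 * tcon s * R * R * R)) = (27 * (tcon s)\<^sup>2 * R ^ 5) * r"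
      by (simp add: power2_eq_square eval_nat_numeral)
    also have "\<dots> \<le> (27 * (tcon s)\<^sup>2 * R ^ 5) * t"
      using r R by (intro mult_left_mono) auto
    finally show "hbd s (\<lambda>k. - \<i> * V r k + \<i> * J' r k) (27 * (tcon s)\<^sup>2 * R ^ 5 * t)"
      by (rule hbd_mono[OF h])
  qed (use t in auto)
  moreover have "J 0 k = 0" for k by (simp add: J_def tri_def case_prod_unfold)
  ultimately have 1: "hbd s (\<lambda>k. v t k + \<i> * J t k - b k) (t\<^sup>2 * (27 * (tcon s)\<^sup>2 * R ^ 5))"
    by (simp add: v0 power2_eq_square mult_ac)
  have 2: "hbd s (\<lambda>k. psic t (Mf b) (Pf b) b k + \<i> * J t k - b k) (t\<^sup>2 * (exp Q * Q\<^sup>2 * R + 2 * sqrt 2 * tcon s * R * R * R))"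
    unfolding J_def using Q by (intro psic_local[OF s b t(1,2)]) (simp add: b_def)
  have "hbd s (\<lambda>k. v t k - psic t (Mf b) (Pf b) b k) (t\<^sup>2 * (27 * (tcon s)\<^sup>2 * R ^ 5) + t\<^sup>2 * (exp Q * Q\<^sup>2 * R + 2 * sqrt 2 * tcon s * R * R * R))"
    using hbd_diff[OF 1 2] by simp
  then have "hbd s (\<lambda>k. v t k - psic t (Mf b) (Pf b) b k) (t\<^sup>2 * (27 * (tcon s)\<^sup>2 * R ^ 5 + (exp Q * Q\<^sup>2 * R + 2 * sqrt 2 * tcon s * R * R * R)))"
    by (simp only: distrib_left)
  then show ?thesis
  proof (rule hbd_cong_cmod)
    fix k
    have "a (t0 + t) k - cnj (ek t k) * psic t (Mf (a t0)) (Pf (a t0)) (a t0) k = cnj (ek t k) * (v t k - psic t (Mf b) (Pf b) b k)"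
      by (simp add: v_def b_def right_diff_distrib mult.assoc[symmetric])
    then show "cmod (a (t0 + t) k - cnj (ek t k) * psic t (Mf (a t0)) (Pf (a t0)) (a t0) k) = cmod (v t k - psic t (Mf b) (Pf b) b k)"
      by (simp add: norm_mult)
  qed
qed

section \<open>Accumulation of the local errors\<close>

lemma wien_diff:
  assumes "wien f a" "wien g b" shows "wien (f - g) (\<lambda>k. a k - b k)"
proof -
  have "wien (\<lambda>x. f x + (- 1) * g x) (\<lambda>k. a k + (- 1) * b k)" by (intro wien_add wien_cmult assms)
  then show ?thesis by (simp add: fun_diff_def)
qed

lemma nls_solution_seq:
  assumes s: "s > 3/2" and sol: "nls_solution s T u0 u"
    and M: "\<forall>t\<in>{0..T}. Hnorm s (u t) \<le> sqrt (2*pi) * R"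
  shows "nls_seq s T R (\<lambda>t. fcoef (u t))" "\<And>t. t \<in> {0..T} \<Longrightarrow> wien (u t) (fcoef (u t))"
proof -
  show w: "wien (u t) (fcoef (u t))" if "t \<in> {0..T}" for t
    using sol that by (intro Hs_wien[OF s]) (auto simp: nls_solution_def)
  show "nls_seq s T R (\<lambda>t. fcoef (u t))"
    unfolding nls_seq_def
  proof (intro conjI ballI allI)
    fix t assume t: "t \<in> {0..T}"
    have "hbd s (fcoef (u t)) (Hnorm s (u t) / sqrt (2*pi))"
      using sol t by (intro Hs_hbd) (auto simp: nls_solution_def)
    then show "hbd s (fcoef (u t)) R"
      by (rule hbd_mono) (use M t in \<open>auto simp: field_simps\<close>)
  next
    fix k t assume t: "t \<in> {0..T}"
    show "((\<lambda>r. fcoef (u r) k) has_vector_derivative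
        (- \<i> * of_int (k^2) * fcoef (u t) k - \<i> * tri (\<lambda>k p q. 1) (rcnj (fcoef (u t))) (fcoef (u t)) (fcoef (u t)) k)) (at t within {0..T})"
      using sol t wien_fcoef[OF wien_cubic[OF w[OF t]]] unfolding nls_solution_def by metis
  qed
qed

text \<open>This turns the stability factor of one step into a pure exponential, which composes
  exactly along the induction.\<close>

lemma exp_add_le: "0 \<le> x \<Longrightarrow> 0 \<le> y \<Longrightarrow> exp x + y \<le> exp (x + y :: real)"
proof -
  assume "0 \<le> x" "0 \<le> y"
  then have "exp x + y \<le> exp x + exp x * y"
    using mult_right_mono[of 1 "exp x" y] by simp
  also have "\<dots> = exp x * (1 + y)" by (simp add: algebra_simps)
  also have "\<dots> \<le> exp x * exp y" by (intro mult_left_mono exp_ge_add_one_self) auto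
  finally show ?thesis by (simp add: exp_add)
qed

text \<open>Smallness of \<open>\<tau>\<close> keeps the numerical solution in the ball of radius \<open>R0 + 1\<close>, on which the
  stability constant is uniform.\<close>
lemma global_error:
  fixes s T R0 :: real
  assumes s: "s > 3/2" and T: "T > 0" and R0: "R0 \<ge> 0"
  defines "R \<equiv> R0 + 1"
  defines "Q \<equiv> 4 * sqrt (bsum (s - 1)) * R\<^sup>2"
  defines "L \<equiv> 2 * Q + 27 * tcon s * R\<^sup>2"
  defines "E \<equiv> 27 * (tcon s)\<^sup>2 * R ^ 5 + (exp Q * Q\<^sup>2 * R + 2 * sqrt 2 * tcon s * R * R * R)"
  assumes sol: "nls_solution s T u0 u" and M: "\<forall>t\<in>{0..T}. Hnorm s (u t) \<le> sqrt (2*pi) * R0"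
    and \<tau>: "0 < \<tau>" "\<tau> \<le> 1" "E * T * exp (T * L) * \<tau> \<le> 1" and N: "T = real N * \<tau>" and n: "n \<le> N"
  shows "\<exists>b. wien ((Psi \<tau> u0 ^^ n) u0) b \<and>
     hbd s (\<lambda>k. fcoef (u (real n * \<tau>)) k - b k) (E * \<tau>\<^sup>2 * real n * exp (real n * \<tau> * L))"
  using n
proof (induction n)
  case 0
  have u0: "u 0 = u0" using sol by (simp add: nls_solution_def)
  have "wien (u 0) (fcoef (u 0))" using nls_solution_seq(2)[OF s sol M, of 0] T by simp
  moreover have "hbd s (\<lambda>k. 0) 0"
    by (simp add: hbd_def L2_set_def)
  ultimately show ?case by (intro exI[of _ "fcoef u0"]) (simp add: u0)
next
  case (Suc n)
  define a where "a t = fcoef (u t)" for t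
  have R: "0 \<le> R" "R0 \<le> R" using R0 by (auto simp: R_def)
  have Q: "0 \<le> Q" unfolding Q_def using bsum_nonneg by simp
  have L: "0 \<le> L" unfolding L_def using Q tcon_nonneg by simp
  have E: "0 \<le> E" unfolding E_def using R tcon_nonneg by simp
  have seq0: "nls_seq s T R0 a" unfolding a_def by (rule nls_solution_seq(1)[OF s sol M])
  have seq: "nls_seq s T R a" using seq0 R(2) by (auto simp: nls_seq_def intro: hbd_mono)
  define t where "t = real n * \<tau>"
  have tT: "t + \<tau> \<le> T"
  proof -
    have "real (Suc n) * \<tau> \<le> real N * \<tau>" using Suc.prems \<tau> by (intro mult_right_mono) auto
    then show ?thesis by (simp add: t_def N algebra_simps)
  qed
  have t0: "0 \<le> t" using \<tau> by (simp add: t_def)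
  have t: "t \<in> {0..T}" using t0 tT \<tau> by simp
  obtain b where w: "wien ((Psi \<tau> u0 ^^ n) u0) b"
    and d: "hbd s (\<lambda>k. a t k - b k) (E * \<tau>\<^sup>2 * real n * exp (t * L))"
    using Suc unfolding a_def t_def by auto
  have small: "E * \<tau>\<^sup>2 * real n * exp (t * L) \<le> 1"
  proof -
    have "E * \<tau>\<^sup>2 * real n * exp (t * L) = E * t * exp (t * L) * \<tau>"
      by (simp add: t_def power2_eq_square mult_ac)
    also have "\<dots> \<le> E * T * exp (T * L) * \<tau>"
      using t E L \<tau> by (intro mult_right_mono mult_mono) (auto intro: mult_right_mono)
    finally show ?thesis using \<tau>(3) by simp
  qed
  have a0: "hbd s (a t) R0" using seq0 t by (simp add: nls_seq_def)
  have aR: "hbd s (a t) R" by (rule hbd_mono[OF a0 R(2)])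
  have bR: "hbd s b R"
  proof -
    have "hbd s (\<lambda>k. a t k - (a t k - b k)) (R0 + E * \<tau>\<^sup>2 * real n * exp (t * L))" by (rule hbd_diff[OF a0 d])
    then show ?thesis using small by (auto simp: R_def intro: hbd_mono)
  qed
  have wu0: "wien u0 (a 0)"
    using nls_solution_seq(2)[OF s sol M, of 0] sol T by (simp add: a_def nls_solution_def)
  have h0: "hbd s (a 0) R" using seq T by (simp add: nls_seq_def)
  \<comment> \<open>By conservation the constants built into \<open>Psi\<close> are those of the
    exact solution at the current time, as \<open>local_error\<close> demands.\<close>
  have MP: "M0 u0 = Mf (a t)" "P0 u0 = Pf (a t)"
    using M0_eq_Mf[OF wu0] P0_eq_Pf[OF s h0 wu0] Mf_Pf_conserved[OF s seq t] by simp_all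
  have Qb: "2 * (cmod (Mf (a t)) + cmod (Pf (a t))) \<le> Q"
    using norm_Mf_Pf[OF s aR] unfolding Q_def by simp
  let ?b = "\<lambda>k. cnj (ek \<tau> k) * psic \<tau> (Mf (a t)) (Pf (a t)) b k"
  have wS: "wien ((Psi \<tau> u0 ^^ Suc n) u0) ?b"
    using wien_Psi[OF w, of \<tau> u0] by (simp add: MP)
  have 1: "hbd s (\<lambda>k. a (t + \<tau>) k - cnj (ek \<tau> k) * psic \<tau> (Mf (a t)) (Pf (a t)) (a t) k) (\<tau>\<^sup>2 * E)"
    unfolding E_def using \<tau> t0 tT Qb by (intro local_error[OF s seq]) auto
  have "hbd s (\<lambda>k. psic \<tau> (Mf (a t)) (Pf (a t)) (a t) k - psic \<tau> (Mf (a t)) (Pf (a t)) b k)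
      ((exp (\<tau> * Q) + \<tau> * (Q + 27 * tcon s * R\<^sup>2)) * (E * \<tau>\<^sup>2 * real n * exp (t * L)))"
    using \<tau> by (intro psic_stable[OF s _ aR bR d Qb]) auto
  then have 2: "hbd s (\<lambda>k. cnj (ek \<tau> k) * (psic \<tau> (Mf (a t)) (Pf (a t)) (a t) k - psic \<tau> (Mf (a t)) (Pf (a t)) b k))
      ((exp (\<tau> * Q) + \<tau> * (Q + 27 * tcon s * R\<^sup>2)) * (E * \<tau>\<^sup>2 * real n * exp (t * L)))"
    by (rule hbd_cong_cmod) (simp add: norm_mult)
  have "hbd s (\<lambda>k. a (t + \<tau>) k - ?b k) (\<tau>\<^sup>2 * E + (exp (\<tau> * Q) + \<tau> * (Q + 27 * tcon s * R\<^sup>2)) * (E * \<tau>\<^sup>2 * real n * exp (t * L)))"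
    using hbd_add[OF 1 2] by (simp add: right_diff_distrib)
  moreover have "\<tau>\<^sup>2 * E + (exp (\<tau> * Q) + \<tau> * (Q + 27 * tcon s * R\<^sup>2)) * (E * \<tau>\<^sup>2 * real n * exp (t * L))
     \<le> E * \<tau>\<^sup>2 * real (Suc n) * exp ((t + \<tau>) * L)"
  proof -
    \<comment> \<open>The \<open>2 * Q\<close> in \<open>L\<close> combines the exponential
      multiplier with the zero-mode correction.\<close>
    have "exp (\<tau> * Q) + \<tau> * (Q + 27 * tcon s * R\<^sup>2) \<le> exp (\<tau> * Q + \<tau> * (Q + 27 * tcon s * R\<^sup>2))"
      using \<tau> Q tcon_nonneg by (intro exp_add_le) auto
    also have "\<dots> = exp (\<tau> * L)" by (simp add: L_def algebra_simps)
    finally have "(exp (\<tau> * Q) + \<tau> * (Q + 27 * tcon s * R\<^sup>2)) * (E * \<tau>\<^sup>2 * real n * exp (t * L))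
       \<le> exp (\<tau> * L) * (E * \<tau>\<^sup>2 * real n * exp (t * L))"
      using E by (intro mult_right_mono) auto
    also have "\<dots> = E * \<tau>\<^sup>2 * real n * exp ((t + \<tau>) * L)"
      by (simp add: distrib_right exp_add)
    finally have "(exp (\<tau> * Q) + \<tau> * (Q + 27 * tcon s * R\<^sup>2)) * (E * \<tau>\<^sup>2 * real n * exp (t * L)) \<le> E * \<tau>\<^sup>2 * real n * exp ((t + \<tau>) * L)" .
    moreover have "\<tau>\<^sup>2 * E \<le> E * \<tau>\<^sup>2 * exp ((t + \<tau>) * L)"
      using mult_left_mono[of 1 "exp ((t + \<tau>) * L)" "E * \<tau>\<^sup>2"] E t0 \<tau> L by (simp add: mult.commute)
    ultimately show ?thesis by (simp add: algebra_simps)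
  qed
  ultimately have "hbd s (\<lambda>k. a (t + \<tau>) k - ?b k) (E * \<tau>\<^sup>2 * real (Suc n) * exp ((t + \<tau>) * L))"
    by (rule hbd_mono)
  moreover have "t + \<tau> = real (Suc n) * \<tau>" by (simp add: t_def algebra_simps)
  ultimately show ?case using wS unfolding a_def by auto
qed

theorem theorem1p1:
  fixes \<gamma> T M :: real
  assumes "\<gamma> > 3/2" and "T > 0"
  shows "\<exists>\<tau>0 > 0. \<exists>C > 0. \<forall>u0 u. Hs \<gamma> u0 \<longrightarrow> nls_solution \<gamma> T u0 u \<longrightarrow>
           (\<forall>t\<in>{0..T}. Hnorm \<gamma> (u t) \<le> M) \<longrightarrow>
           (\<forall>\<tau> (N::nat). 0 < \<tau> \<longrightarrow> \<tau> \<le> \<tau>0 \<longrightarrow> T = real N * \<tau> \<longrightarrow>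
              (\<forall>n\<le>N. Hnorm \<gamma> (u (real n * \<tau>) - (Psi \<tau> u0 ^^ n) u0) \<le> C * \<tau>))"
proof -
  \<comment> \<open>The absolute value secures a nonnegative radius for any real \<open>M\<close>;
    the division removes the factor \<open>2*pi\<close> that \<open>Hnorm\<close> has and
    \<open>hbd\<close> has not.\<close>
  define R0 where "R0 = \<bar>M\<bar> / sqrt (2*pi)"
  define R where "R = R0 + 1"
  define Q where "Q = 4 * sqrt (bsum (\<gamma> - 1)) * R\<^sup>2"
  define L where "L = 2 * Q + 27 * tcon \<gamma> * R\<^sup>2"
  define E where "E = 27 * (tcon \<gamma>)\<^sup>2 * R ^ 5 + (exp Q * Q\<^sup>2 * R + 2 * sqrt 2 * tcon \<gamma> * R * R * R)"
  define K where "K = E * T * exp (T * L)"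
  have R0: "0 \<le> R0" by (simp add: R0_def)
  then have R: "0 \<le> R" by (simp add: R_def)
  have Q: "0 \<le> Q" unfolding Q_def using bsum_nonneg by simp
  have L: "0 \<le> L" unfolding L_def using Q tcon_nonneg by simp
  have E: "0 \<le> E" unfolding E_def using R tcon_nonneg by simp
  have K: "0 \<le> K" unfolding K_def using E assms(2) by simp
  show ?thesis
  \<comment> \<open>The \<open>1\<close> is the step restriction of the local error;
    \<open>1 / (K + 1)\<close> forces \<open>K * \<tau> \<le> 1\<close>, which confines the iterates
    to the ball, and is defined even for \<open>K = 0\<close>.\<close>
  proof (rule exI[of _ "min 1 (1 / (K + 1))"], intro conjI)
    show "0 < min 1 (1 / (K + 1))" using K by simp
    show "\<exists>C > 0. \<forall>u0 u. Hs \<gamma> u0 \<longrightarrow> nls_solution \<gamma> T u0 u \<longrightarrow>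
           (\<forall>t\<in>{0..T}. Hnorm \<gamma> (u t) \<le> M) \<longrightarrow>
           (\<forall>\<tau> (N::nat). 0 < \<tau> \<longrightarrow> \<tau> \<le> min 1 (1 / (K + 1)) \<longrightarrow> T = real N * \<tau> \<longrightarrow>
              (\<forall>n\<le>N. Hnorm \<gamma> (u (real n * \<tau>) - (Psi \<tau> u0 ^^ n) u0) \<le> C * \<tau>))"
    \<comment> \<open>The \<open>+ 1\<close> makes the constant positive without a lower bound on
      \<open>K\<close>.\<close>
    proof (rule exI[of _ "sqrt (2*pi) * K + 1"], intro conjI allI impI)
      show "0 < sqrt (2*pi) * K + 1" using K by (simp add: add_nonneg_pos)
      fix u0 u \<tau> and N n :: nat
      assume sol: "nls_solution \<gamma> T u0 u" and M: "\<forall>t\<in>{0..T}. Hnorm \<gamma> (u t) \<le> M"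
        and \<tau>: "0 < \<tau>" "\<tau> \<le> min 1 (1 / (K + 1))" and N: "T = real N * \<tau>" and n: "n \<le> N"
      have M': "\<forall>t\<in>{0..T}. Hnorm \<gamma> (u t) \<le> sqrt (2*pi) * R0"
        using M by (auto simp: R0_def intro: order_trans)
      have K1: "E * T * exp (T * L) * \<tau> \<le> 1"
      proof -
        have "K * \<tau> \<le> K * (1 / (K + 1))" using \<tau> K by (intro mult_left_mono) auto
        also have "\<dots> \<le> 1" using K by (simp add: field_simps)
        finally show ?thesis by (simp add: K_def)
      qed
      obtain b where w: "wien ((Psi \<tau> u0 ^^ n) u0) b"
        and h: "hbd \<gamma> (\<lambda>k. fcoef (u (real n * \<tau>)) k - b k) (E * \<tau>\<^sup>2 * real n * exp (real n * \<tau> * L))"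
        using global_error[OF assms R0 sol M' \<tau>(1) _ _ N n] K1 \<tau>(2)
        unfolding R_def[symmetric] Q_def[symmetric] L_def[symmetric] E_def[symmetric] by auto
      have nT: "real n * \<tau> \<le> T" using n \<tau>(1) by (simp add: N mult_right_mono)
      have wu: "wien (u (real n * \<tau>)) (fcoef (u (real n * \<tau>)))"
        using nls_solution_seq(2)[OF assms(1) sol M'] nT \<tau>(1) by simp
      have "E * \<tau>\<^sup>2 * real n * exp (real n * \<tau> * L) = E * (real n * \<tau>) * exp (real n * \<tau> * L) * \<tau>"
        by (simp add: power2_eq_square mult_ac)
      also have "\<dots> \<le> K * \<tau>"
        unfolding K_def using nT E L \<tau> assms(2) by (intro mult_right_mono mult_mono) (auto intro: mult_right_mono)
      finally have "hbd \<gamma> (\<lambda>k. fcoef (u (real n * \<tau>)) k - b k) (K * \<tau>)"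
        by (rule hbd_mono[OF h])
      then have "hbd \<gamma> (fcoef (u (real n * \<tau>) - (Psi \<tau> u0 ^^ n) u0)) (K * \<tau>)"
        using wien_fcoef[OF wien_diff[OF wu w]] by simp
      then have "Hnorm \<gamma> (u (real n * \<tau>) - (Psi \<tau> u0 ^^ n) u0) \<le> sqrt (2*pi) * (K * \<tau>)"
        by (rule hbd_Hnorm)
      also have "\<dots> \<le> (sqrt (2*pi) * K + 1) * \<tau>" using \<tau> by (simp add: algebra_simps)
      finally show "Hnorm \<gamma> (u (real n * \<tau>) - (Psi \<tau> u0 ^^ n) u0) \<le> (sqrt (2*pi) * K + 1) * \<tau>" .
    qed
  qed
qed

end
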